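(* Let $X(s,\omega)$, $s\in\mathbb{R}$, be a symmetric stable process of index $\gamma$, $\frac43<\gamma\le 2$, let $f\in L^1(\mathbb{R})\cap L^{\gamma}(\mathbb{R})$, and let $$a_n=\int_{-\infty}^{\infty}f(t)\psi_n(t)\,dt,\qquad A_n(\omega)=\int_{-\infty}^{\infty}\psi_n(t)\,dX(t,\omega),\qquad n\in\mathbb{N}_0,$$ where $\psi_n$ are the normalized Hermite functions. Then for every $t\in\mathbb{R}$ the random series $$\sum_{n=0}^{\infty}a_nA_n(\omega)\psi_n(t)$$ converges in the mean (i.e. in $L^1(\Omega)$) to the stochastic integral $\int_{-\infty}^{\infty}f(s,t)\,dX(s,\omega)$, where $f(s,t)=\sum_{k=0}^{\infty}a_k\psi_k(s)\psi_k(t)$ (sum of the series in $L^{\gamma}(\mathbb{R})$ in the variable $s$).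
   Context: $\mathbb{N}_0=\{0,1,2,\dots\}$. The normalized Hermite functions are $\psi_n(t)=\frac{1}{\sqrt{2^n n!\sqrt{\pi}}}H_n(t)e^{-t^2/2}$, $t\in\mathbb{R}$, where $H_n(t)=(-1)^n e^{t^2}\frac{d^n}{dt^n}e^{-t^2}$. A symmetric stable process of index $\gamma$ is a real-valued process $X(t,\omega)$, $t\in\mathbb{R}$, with independent increments such that $E\,e^{iu(X(t)-X(s))}=\exp(-c|t-s||u|^{\gamma})$ for all $s,t,u\in\mathbb{R}$, where $c>0$ is a constant. For a bounded interval $[a,b]$ and $h\in L^{\gamma}[a,b]$, the stochastic integral $\int_a^b h\,dX$ is the $L^1(\Omega)$ limit of the integrals of step functions converging to $h$ in $L^{\gamma}[a,b]$ (the integral of $\sum_j c_j\chi_{(t_j,t_{j+1}]}$ being $\sum_j c_j(X(t_{j+1})-X(t_j))$), and $\int_{-\infty}^{\infty}h\,dX$ is the $L^1(\Omega)$ limit of $\int_{-n}^n h\,dX$ as $n\to\infty$. *)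

theory Defs
  imports "HOL-Probability.Probability"
begin

definition hermite_polynomial :: "nat \<Rightarrow> real \<Rightarrow> real" where
  "hermite_polynomial n t = (-1) ^ n * exp (t\<^sup>2) * (deriv ^^ n) (\<lambda>x. exp (- x\<^sup>2)) t"

definition hermite_function :: "nat \<Rightarrow> real \<Rightarrow> real" where
  "hermite_function n t =
     1 / sqrt (2 ^ n * fact n * sqrt pi) * hermite_polynomial n t * exp (- t\<^sup>2 / 2)"

(* Representatives, not classes modulo null sets. *)
definition Lp_space :: "'b measure \<Rightarrow> real \<Rightarrow> ('b \<Rightarrow> real) set" where
  "Lp_space N p = {h \<in> borel_measurable N. integrable N (\<lambda>x. \<bar>h x\<bar> powr p)}"

(* Membership in the space is part of the definition because the Bochner integral of a
   non-integrable function is 0. *)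
definition Lp_tendsto ::
  "'b measure \<Rightarrow> real \<Rightarrow> (nat \<Rightarrow> 'b \<Rightarrow> real) \<Rightarrow> ('b \<Rightarrow> real) \<Rightarrow> bool" where
  "Lp_tendsto N p u h \<longleftrightarrow>
     (\<forall>n. u n \<in> Lp_space N p) \<and> h \<in> Lp_space N p \<and>
     (\<lambda>n. \<integral>x. \<bar>u n x - h x\<bar> powr p \<partial>N) \<longlonglongrightarrow> 0"

definition symmetric_stable_process ::
  "'a measure \<Rightarrow> real \<Rightarrow> (real \<Rightarrow> 'a \<Rightarrow> real) \<Rightarrow> bool" where
  "symmetric_stable_process M \<gamma> X \<longleftrightarrow>
     prob_space M \<and>
     (\<forall>t. X t \<in> borel_measurable M) \<and>
     (\<forall>(m::nat) t. strict_mono_on {..m} t \<longrightarrow>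
        prob_space.indep_vars M (\<lambda>_. borel) (\<lambda>j \<omega>. X (t (Suc j)) \<omega> - X (t j) \<omega>) {..<m}) \<and>
     (\<exists>c>0. \<forall>s t u.
        (\<integral>\<omega>. exp (\<i> * complex_of_real (u * (X t \<omega> - X s \<omega>))) \<partial>M)
          = complex_of_real (exp (- c * \<bar>t - s\<bar> * \<bar>u\<bar> powr \<gamma>)))"

definition step_partition :: "real \<Rightarrow> real \<Rightarrow> nat \<Rightarrow> (nat \<Rightarrow> real) \<Rightarrow> bool" where
  "step_partition a b m t \<longleftrightarrow> strict_mono_on {..m} t \<and> t ` {..m} \<subseteq> {a..b}"

definition step_function :: "nat \<Rightarrow> (nat \<Rightarrow> real) \<Rightarrow> (nat \<Rightarrow> real) \<Rightarrow> real \<Rightarrow> real" where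
  "step_function m t c x = (\<Sum>j<m. c j * indicator {t j<..t (Suc j)} x)"

definition step_integral ::
  "(real \<Rightarrow> 'a \<Rightarrow> real) \<Rightarrow> nat \<Rightarrow> (nat \<Rightarrow> real) \<Rightarrow> (nat \<Rightarrow> real) \<Rightarrow> 'a \<Rightarrow> real" where
  "step_integral X m t c \<omega> = (\<Sum>j<m. c j * (X (t (Suc j)) \<omega> - X (t j) \<omega>))"

(* The limit must be the same along every approximating sequence of step functions; since step
   functions are dense in the L^gamma space of [a, b], there always is such a sequence. *)
definition has_stoch_integral_on ::
  "'a measure \<Rightarrow> (real \<Rightarrow> 'a \<Rightarrow> real) \<Rightarrow> real \<Rightarrow> real \<Rightarrow> real \<Rightarrow> (real \<Rightarrow> real) \<Rightarrow> ('a \<Rightarrow> real) \<Rightarrow> bool" where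
  "has_stoch_integral_on M X \<gamma> a b h Y \<longleftrightarrow>
     h \<in> Lp_space (lebesgue_on {a..b}) \<gamma> \<and> Y \<in> Lp_space M 1 \<and>
     (\<forall>m t c.
        (\<forall>n. step_partition a b (m n) (t n)) \<longrightarrow>
        Lp_tendsto (lebesgue_on {a..b}) \<gamma> (\<lambda>n. step_function (m n) (t n) (c n)) h \<longrightarrow>
        Lp_tendsto M 1 (\<lambda>n. step_integral X (m n) (t n) (c n)) Y)"

definition has_stoch_integral ::
  "'a measure \<Rightarrow> (real \<Rightarrow> 'a \<Rightarrow> real) \<Rightarrow> real \<Rightarrow> (real \<Rightarrow> real) \<Rightarrow> ('a \<Rightarrow> real) \<Rightarrow> bool" where
  "has_stoch_integral M X \<gamma> h Y \<longleftrightarrow>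
     (\<exists>Z. (\<forall>n. has_stoch_integral_on M X \<gamma> (- real n) (real n) h (Z n)) \<and> Lp_tendsto M 1 Z Y)"

definition stoch_integrable ::
  "'a measure \<Rightarrow> (real \<Rightarrow> 'a \<Rightarrow> real) \<Rightarrow> real \<Rightarrow> (real \<Rightarrow> real) \<Rightarrow> bool" where
  "stoch_integrable M X \<gamma> h \<longleftrightarrow> (\<exists>Y. has_stoch_integral M X \<gamma> h Y)"

(* The integral is determined only almost surely; this picks one version. *)
definition stoch_integral ::
  "'a measure \<Rightarrow> (real \<Rightarrow> 'a \<Rightarrow> real) \<Rightarrow> real \<Rightarrow> (real \<Rightarrow> real) \<Rightarrow> 'a \<Rightarrow> real" where
  "stoch_integral M X \<gamma> h = (SOME Y. has_stoch_integral M X \<gamma> h Y)"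

end

theory Submission
  imports Defs
begin

text \<open>
  Write \<open>\<psi>\<^sub>k\<close> for the Hermite functions and \<open>c\<^sub>k = a\<^sub>k \<psi>\<^sub>k(t)\<close>.  Two facts carry the theorem.

  The first is that the stochastic integral is a continuous linear map from \<open>L\<^sup>\<gamma>\<close> of the line to \<open>L\<^sup>1\<close> of
  the probability space.  For a step function \<open>\<phi>\<close> the integral has the characteristic function
  \<open>u \<mapsto> exp (- c \<bar>u\<bar>\<^sup>\<gamma> \<integral> \<bar>\<phi>\<bar>\<^sup>\<gamma>)\<close>, whence \<open>E \<bar>\<integral> \<phi> dX\<bar> \<le> K (\<integral> \<bar>\<phi>\<bar>\<^sup>\<gamma>)\<^bsup>1/\<gamma>\<^esup>\<close> (\<open>stable_step_bound\<close>).  Step functions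
  are dense, so the bound extends to all of \<open>L\<^sup>\<gamma>\<close> (\<open>has_line_integral_exists\<close>,
  \<open>has_line_integral_diff_bound\<close>), and the integral obtained in this way is the one defined through
  bounded intervals (\<open>has_stoch_integral_iff_line\<close>).  The partial sums of the random series are the
  integrals of the partial sums of \<open>\<Sum> c\<^sub>k \<psi>\<^sub>k\<close>, so it remains to see that this series converges in \<open>L\<^sup>\<gamma>\<close>.

  This convergence (\<open>hermite_series_Lp_convergent\<close>) is the second fact.  For \<open>\<gamma> < 2\<close> the space \<open>L\<^sup>\<gamma>\<close> is
  more demanding at infinity than \<open>L\<^sup>2\<close>, and the gap is bridged by the weight \<open>w = (1 + x\<^sup>2)\<^bsup>1/4\<^esup>\<close>:
  by Hoelder's inequality, \<open>L\<^sup>2\<close> with the weight \<open>w\<close> embeds into \<open>L\<^sup>\<gamma>\<close> when \<open>\<gamma> > 4/3\<close>.  Multiplication by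
  \<open>1 + x\<^sup>2\<close> is dominated, as a quadratic form, by the operator with the eigenvalues \<open>2k + 2\<close>; taking fourth
  roots keeps the comparison up to a constant, so \<open>\<integral> w (\<Sum> c\<^sub>k \<psi>\<^sub>k)\<^sup>2 \<le> 16 \<Sum> (2k + 2)\<^bsup>1/4\<^esup> c\<^sub>k\<^sup>2\<close>
  (\<open>hermite_sum_weighted\<close>).  It suffices therefore that \<open>\<Sum> (k + 1)\<^bsup>1/4\<^esup> a\<^sub>k\<^sup>2 \<psi>\<^sub>k(t)\<^sup>2\<close> converges.

  For fixed \<open>t\<close> one has \<open>\<psi>\<^sub>k(t)\<^sup>2 = O((k + 1)\<^bsup>-1/2\<^esup>)\<close>, because the energy
  \<open>\<psi>'\<^sup>2 + (2k + 1 - x\<^sup>2) \<psi>\<^sup>2\<close> is largest at the origin (\<open>hermite_function_pointwise_decay\<close>).  For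
  the coefficients of \<open>f\<close> in \<open>L\<^sup>\<gamma>\<close> one has \<open>\<Sum>\<^bsub>k<n\<^esub> a\<^sub>k\<^sup>2 = O(n\<^bsup>1/\<gamma>-1/2\<^esup>)\<close> (\<open>hermite_coeffs_growth\<close>): this
  interpolates between Bessel's inequality in \<open>L\<^sup>2\<close> and a bound \<open>O(n\<^bsup>1/2\<^esup>)\<close> in \<open>L\<^sup>1\<close>, which is dual to the
  estimate of the supremum of a Hermite sum by its norm (\<open>hermite_sum_sup\<close>).  The
  exponent \<open>1/\<gamma> - 1/2\<close> is less than \<open>1/4\<close>, again because \<open>\<gamma> > 4/3\<close>, and the series converges.
\<close>

section \<open>Spaces of \<open>p\<close>-integrable functions\<close>

text \<open>This quasi-triangle inequality does the work of Minkowski's inequality below: the factor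
  \<open>2\<^sup>p\<close> is harmless, because only convergence to \<open>0\<close> is ever at stake.\<close>
lemma abs_add_powr_le:
  fixes x y p :: real
  assumes "0 \<le> p"
  shows "\<bar>x + y\<bar> powr p \<le> 2 powr p * (\<bar>x\<bar> powr p + \<bar>y\<bar> powr p)"
proof -
  have "\<bar>x + y\<bar> powr p \<le> (2 * max \<bar>x\<bar> \<bar>y\<bar>) powr p"
    using assms by (intro powr_mono2) auto
  also have "\<dots> = 2 powr p * max \<bar>x\<bar> \<bar>y\<bar> powr p"
    by (simp add: powr_mult)
  also have "\<dots> \<le> 2 powr p * (\<bar>x\<bar> powr p + \<bar>y\<bar> powr p)"
    by (intro mult_left_mono) (auto simp: max_def)
  finally show ?thesis .
qed

lemma Lp_spaceD:
  assumes "u \<in> Lp_space N p"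
  shows "u \<in> borel_measurable N" "integrable N (\<lambda>x. \<bar>u x\<bar> powr p)"
  using assms by (auto simp: Lp_space_def)

lemma Lp_space_bound:
  assumes "u \<in> borel_measurable N" "integrable N g" "AE x in N. \<bar>u x\<bar> powr p \<le> g x"
  shows "u \<in> Lp_space N p"
proof -
  have "integrable N (\<lambda>x. \<bar>u x\<bar> powr p)"
    by (rule Bochner_Integration.integrable_bound[OF assms(2)]) (use assms(1,3) in auto)
  then show ?thesis using assms(1) by (simp add: Lp_space_def)
qed

lemma Lp_space_add:
  assumes "0 \<le> p" "u \<in> Lp_space N p" "v \<in> Lp_space N p"
  shows "(\<lambda>x. u x + v x) \<in> Lp_space N p"
    and "(\<integral>x. \<bar>u x + v x\<bar> powr p \<partial>N)
      \<le> 2 powr p * ((\<integral>x. \<bar>u x\<bar> powr p \<partial>N) + (\<integral>x. \<bar>v x\<bar> powr p \<partial>N))"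
proof -
  note [measurable] = Lp_spaceD(1)[OF assms(2)] Lp_spaceD(1)[OF assms(3)]
  have i: "integrable N (\<lambda>x. 2 powr p * (\<bar>u x\<bar> powr p + \<bar>v x\<bar> powr p))"
    using assms by (auto simp: Lp_space_def)
  show *: "(\<lambda>x. u x + v x) \<in> Lp_space N p"
    by (rule Lp_space_bound[OF _ i]) (auto intro: abs_add_powr_le assms(1))
  have "(\<integral>x. \<bar>u x + v x\<bar> powr p \<partial>N)
      \<le> (\<integral>x. 2 powr p * (\<bar>u x\<bar> powr p + \<bar>v x\<bar> powr p) \<partial>N)"
    by (rule integral_mono[OF Lp_spaceD(2)[OF *] i]) (rule abs_add_powr_le[OF assms(1)])
  also have "\<dots> = 2 powr p * ((\<integral>x. \<bar>u x\<bar> powr p \<partial>N) + (\<integral>x. \<bar>v x\<bar> powr p \<partial>N))"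
    using assms by (auto simp: Lp_space_def)
  finally show "(\<integral>x. \<bar>u x + v x\<bar> powr p \<partial>N) \<le> \<dots>" .
qed

lemma Lp_space_cmult:
  assumes "u \<in> Lp_space N p"
  shows "(\<lambda>x. c * u x) \<in> Lp_space N p"
  using assms by (auto simp: Lp_space_def abs_mult powr_mult)

lemma Lp_space_zero: "(\<lambda>x. 0) \<in> Lp_space N p"
  by (auto simp: Lp_space_def)

lemma Lp_space_diff:
  assumes "0 \<le> p" "u \<in> Lp_space N p" "v \<in> Lp_space N p"
  shows "(\<lambda>x. u x - v x) \<in> Lp_space N p"
  using Lp_space_add(1)[OF assms(1,2) Lp_space_cmult[OF assms(3), of "-1"]] by simp

lemma Lp_space_sum:
  assumes "0 \<le> p" "\<And>i. i \<in> I \<Longrightarrow> u i \<in> Lp_space N p"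
  shows "(\<lambda>x. \<Sum>i\<in>I. u i x) \<in> Lp_space N p"
  using assms(2)
proof (induction I rule: infinite_finite_induct)
  case (insert i I)
  then show ?case using Lp_space_add(1)[OF assms(1), of "u i" N "\<lambda>x. \<Sum>i\<in>I. u i x"] by simp
qed (auto simp: Lp_space_zero)

abbreviation (input) power_dist :: "'b measure \<Rightarrow> real \<Rightarrow> ('b \<Rightarrow> real) \<Rightarrow> ('b \<Rightarrow> real) \<Rightarrow> real" where
  "power_dist N p u v \<equiv> \<integral>x. \<bar>u x - v x\<bar> powr p \<partial>N"

abbreviation (input) mean_dist :: "'b measure \<Rightarrow> ('b \<Rightarrow> real) \<Rightarrow> ('b \<Rightarrow> real) \<Rightarrow> real" where
  "mean_dist N u v \<equiv> \<integral>x. \<bar>u x - v x\<bar> \<partial>N"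

lemma Lp_triangle:
  assumes "0 \<le> p" "u \<in> Lp_space N p" "v \<in> Lp_space N p" "w \<in> Lp_space N p"
  shows "power_dist N p u w
      \<le> 2 powr p * (power_dist N p u v + power_dist N p v w)"
  using Lp_space_add(2)[OF assms(1) Lp_space_diff[OF assms(1,2,3)] Lp_space_diff[OF assms(1,3,4)]]
  by simp

text \<open>A Cauchy sequence has a subsequence whose consecutive differences \<open>d\<^sub>k\<close> satisfy
  \<open>\<integral> 2\<^bsup>pk\<^esup> \<bar>d\<^sub>k\<bar>\<^sup>p \<le> 2\<^bsup>-k\<^esup>\<close>.  Then \<open>\<Sum> 2\<^bsup>pk\<^esup> \<bar>d\<^sub>k\<bar>\<^sup>p\<close> is finite almost everywhere, so
  \<open>\<bar>d\<^sub>k\<bar>\<close> decays geometrically and the subsequence converges almost everywhere; Fatou's lemma turns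
  this into convergence in the mean of the whole sequence.  One argument serves both the exponent
  \<open>\<gamma>\<close> on the line and the exponent \<open>1\<close> on the probability space.\<close>
lemma Lp_complete:
  fixes u :: "nat \<Rightarrow> 'b \<Rightarrow> real"
  assumes p: "0 < p" and u: "\<And>n. u n \<in> Lp_space N p"
    and Cauchy: "\<And>e. 0 < e \<Longrightarrow> \<exists>K. \<forall>m\<ge>K. \<forall>n\<ge>K. power_dist N p (u m) (u n) < e"
  shows "\<exists>h. Lp_tendsto N p u h"
proof -
  have [measurable]: "u n \<in> borel_measurable N" for n using Lp_spaceD(1)[OF u] .
  have int: "integrable N (\<lambda>x. \<bar>u m x - u n x\<bar> powr p)" for m n
    using Lp_spaceD(2)[OF Lp_space_diff[OF less_imp_le[OF p] u u]] .
  have term_le: "f k \<le> suminf f" for f :: "nat \<Rightarrow> ennreal" and k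
    using sum_le_suminf[of f "{k}"] by simp
  define q where "q = 2 powr (-p) / 2"
  have q: "0 < q" by (simp add: q_def)
  define G where "G k K \<longleftrightarrow> (\<forall>m\<ge>K. \<forall>n\<ge>K. power_dist N p (u m) (u n) < q ^ k)"
    for k K
  have "\<exists>r. \<forall>k. G k (r k) \<and> r k < r (Suc k)"
  proof (rule dependent_nat_choice)
    show "\<exists>K. G 0 K" unfolding G_def using Cauchy[of "q ^ 0"] by simp
    fix K k
    obtain K' where "G (Suc k) K'" unfolding G_def using Cauchy[of "q ^ Suc k"] q by auto
    then have "G (Suc k) (max K' (Suc K)) \<and> K < max K' (Suc K)" unfolding G_def by auto
    then show "\<exists>L. G (Suc k) L \<and> K < L" by blast
  qed
  then obtain r where rG: "\<And>k. G k (r k)" and rlt: "\<And>k. r k < r (Suc k)" by blast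
  have r_mono: "strict_mono r" using rlt by (simp add: strict_mono_Suc_iff)
  define d where "d k x = u (r (Suc k)) x - u (r k) x" for k x
  have [measurable]: "d k \<in> borel_measurable N" for k unfolding d_def[abs_def] by measurable
  have dint: "(\<integral>\<^sup>+x. ennreal (2 powr (p * k) * \<bar>d k x\<bar> powr p) \<partial>N) \<le> ennreal ((1/2) ^ k)" for k
  proof -
    have "(\<integral>\<^sup>+x. ennreal (2 powr (p * k) * \<bar>d k x\<bar> powr p) \<partial>N)
        = ennreal (\<integral>x. 2 powr (p * k) * \<bar>d k x\<bar> powr p \<partial>N)"
      using int by (intro nn_integral_eq_integral) (auto simp: d_def)
    also have "(\<integral>x. 2 powr (p * k) * \<bar>d k x\<bar> powr p \<partial>N) \<le> 2 powr (p * k) * q ^ k"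
      using rG[of k] rlt[of k] unfolding G_def d_def by (auto intro: less_imp_le)
    also have "2 powr (p * k) * q ^ k = (1/2) ^ k"
      by (simp add: q_def power_divide powr_power powr_minus field_simps)
    finally show ?thesis by (simp add: ennreal_leI)
  qed
  have "(\<integral>\<^sup>+x. (\<Sum>k. ennreal (2 powr (p * k) * \<bar>d k x\<bar> powr p)) \<partial>N)
      = (\<Sum>k. \<integral>\<^sup>+x. ennreal (2 powr (p * k) * \<bar>d k x\<bar> powr p) \<partial>N)"
    by (rule nn_integral_suminf) auto
  also have "\<dots> \<le> (\<Sum>k. ennreal ((1/2) ^ k))"
    by (intro suminf_le dint) auto
  also have "\<dots> = ennreal (\<Sum>k. (1/2) ^ k)"
    by (intro suminf_ennreal2) (auto intro: summable_geometric)
  also have "\<dots> < \<infinity>" by simp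
  finally have "AE x in N. (\<Sum>k. ennreal (2 powr (p * k) * \<bar>d k x\<bar> powr p)) \<noteq> \<infinity>"
    by (intro nn_integral_PInf_AE) auto
  then have AE_conv: "AE x in N. convergent (\<lambda>k. u (r k) x)"
  proof (rule AE_mp, intro AE_I2 impI)
    fix x assume "(\<Sum>k. ennreal (2 powr (p * k) * \<bar>d k x\<bar> powr p)) \<noteq> \<infinity>"
    then have fin: "(\<Sum>k. ennreal (2 powr (p * k) * \<bar>d k x\<bar> powr p)) < top"
      by (simp only: infinity_ennreal_def less_top)
    define C where "C = enn2real (\<Sum>k. ennreal (2 powr (p * k) * \<bar>d k x\<bar> powr p))"
    have C: "0 \<le> C" "(\<Sum>k. ennreal (2 powr (p * k) * \<bar>d k x\<bar> powr p)) = ennreal C"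
      unfolding C_def by (rule enn2real_nonneg, rule ennreal_enn2real[OF fin, symmetric])
    have bound: "norm (d k x) \<le> C powr (1/p) * (1/2) ^ k" for k
    proof -
      have "ennreal (2 powr (p * k) * \<bar>d k x\<bar> powr p) \<le> ennreal C"
        unfolding C(2)[symmetric] by (rule term_le)
      then have "2 powr (p * k) * \<bar>d k x\<bar> powr p \<le> C" using C(1) by simp
      then have "\<bar>d k x\<bar> powr p \<le> C * 2 powr (- (p * k))"
        by (simp add: powr_minus field_simps)
      then have "(\<bar>d k x\<bar> powr p) powr (1/p) \<le> (C * 2 powr (- (p * k))) powr (1/p)"
        using p by (intro powr_mono2) auto
      also have "\<dots> = C powr (1/p) * 2 powr (- real k)"
        using p C(1) by (simp add: powr_mult powr_powr)
      also have "2 powr (- real k) = (1/2) ^ k"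
        by (simp add: powr_minus powr_realpow field_simps power_divide)
      finally show ?thesis using p by (simp add: powr_powr)
    qed
    have "summable (\<lambda>k. d k x)"
      by (rule summable_comparison_test'[OF summable_mult[OF summable_geometric]])
        (use bound in auto)
    then have "convergent (\<lambda>n. \<Sum>k<n. d k x)" by (simp add: summable_iff_convergent)
    then have "convergent (\<lambda>n. u (r n) x - u (r 0) x)"
      unfolding d_def sum_lessThan_telescope[where f = "\<lambda>k. u (r k) x"] .
    then show "convergent (\<lambda>n. u (r n) x)"
      by (simp add: convergent_diff_const_right_iff)
  qed
  define h where "h x = lim (\<lambda>k. u (r k) x)" for x
  have [measurable]: "h \<in> borel_measurable N" unfolding h_def[abs_def] by measurable
  have AE_lim: "AE x in N. (\<lambda>k. u (r k) x) \<longlonglongrightarrow> h x"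
    using AE_conv by eventually_elim (simp add: h_def convergent_LIMSEQ_iff)
  have Fatou: "(\<integral>\<^sup>+x. ennreal (\<bar>u m x - h x\<bar> powr p) \<partial>N) \<le> ennreal e"
    if K: "\<forall>m\<ge>K. \<forall>n\<ge>K. power_dist N p (u m) (u n) < e" and m: "m \<ge> K" for e K m
  proof -
    have "(\<integral>\<^sup>+x. ennreal (\<bar>u m x - h x\<bar> powr p) \<partial>N)
        \<le> (\<integral>\<^sup>+x. liminf (\<lambda>k. ennreal (\<bar>u m x - u (r k) x\<bar> powr p)) \<partial>N)"
    proof (rule nn_integral_mono_AE, use AE_lim in eventually_elim)
      fix x assume "(\<lambda>k. u (r k) x) \<longlonglongrightarrow> h x"
      then have "(\<lambda>k. ennreal (\<bar>u m x - u (r k) x\<bar> powr p)) \<longlonglongrightarrow> ennreal (\<bar>u m x - h x\<bar> powr p)"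
        using p by (intro tendsto_ennrealI tendsto_powr' tendsto_intros) auto
      then show "ennreal (\<bar>u m x - h x\<bar> powr p)
          \<le> liminf (\<lambda>k. ennreal (\<bar>u m x - u (r k) x\<bar> powr p))"
        by (intro eq_refl lim_imp_Liminf[symmetric] sequentially_bot)
    qed
    also have "\<dots> \<le> liminf (\<lambda>k. \<integral>\<^sup>+x. ennreal (\<bar>u m x - u (r k) x\<bar> powr p) \<partial>N)"
      by (rule nn_integral_liminf) auto
    also have "\<dots> \<le> ennreal e"
    proof (rule Liminf_le)
      show "\<forall>\<^sub>F k in sequentially. (\<integral>\<^sup>+x. ennreal (\<bar>u m x - u (r k) x\<bar> powr p) \<partial>N) \<le> ennreal e"
        using eventually_ge_at_top[of K]
      proof eventually_elim
        fix k assume "K \<le> k"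
        then have "K \<le> r k" using seq_suble[OF r_mono, of k] by simp
        then have "power_dist N p (u m) (u (r k)) \<le> e" using K m less_imp_le by blast
        then show "(\<integral>\<^sup>+x. ennreal (\<bar>u m x - u (r k) x\<bar> powr p) \<partial>N) \<le> ennreal e"
          by (subst nn_integral_eq_integral[OF int]) (auto simp: ennreal_leI)
      qed
    qed auto
    finally show ?thesis .
  qed
  have diff_Lp: "(\<lambda>x. u m x - h x) \<in> Lp_space N p"
    and diff_le: "power_dist N p (u m) h \<le> e"
    if "\<forall>m\<ge>K. \<forall>n\<ge>K. power_dist N p (u m) (u n) < e" "m \<ge> K" "0 < e" for e K m
  proof -
    have *: "(\<integral>\<^sup>+x. ennreal (\<bar>u m x - h x\<bar> powr p) \<partial>N) \<le> ennreal e"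
      using Fatou[OF that(1,2)] .
    then show "(\<lambda>x. u m x - h x) \<in> Lp_space N p"
      by (auto simp: Lp_space_def integrable_iff_bounded le_less_trans)
    show "power_dist N p (u m) h \<le> e"
      using * that(3) by (intro integral_real_bounded) auto
  qed
  obtain K1 where "\<forall>m\<ge>K1. \<forall>n\<ge>K1. power_dist N p (u m) (u n) < 1"
    using Cauchy[of 1] by auto
  from Lp_space_diff[OF less_imp_le[OF p] u[of K1] diff_Lp[OF this order_refl zero_less_one]]
  have h: "h \<in> Lp_space N p" by simp
  have "(\<lambda>n. power_dist N p (u n) h) \<longlonglongrightarrow> 0"
  proof (rule LIMSEQ_I)
    fix e :: real assume "0 < e"
    then obtain K where "\<forall>m\<ge>K. \<forall>n\<ge>K. power_dist N p (u m) (u n) < e/2"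
      using Cauchy[of "e/2"] by auto
    from diff_le[OF this] \<open>0 < e\<close>
    show "\<exists>K. \<forall>n\<ge>K. norm (power_dist N p (u n) h - 0) < e"
      by (intro exI[of _ K]) fastforce
  qed
  then show ?thesis using u h by (auto simp: Lp_tendsto_def)
qed

lemma integrable_even_lborel:
  fixes f :: "real \<Rightarrow> real"
  assumes [measurable]: "f \<in> borel_measurable borel" and even: "\<And>x. f (- x) = f x"
    and i: "integrable lborel (\<lambda>x. indicator {0..} x * f x)"
  shows "integrable lborel f"
proof -
  have "integrable lborel (\<lambda>x. indicator {0..} (0 + (-1) * x) * f (0 + (-1) * x))"
    by (rule lborel_integrable_real_affine[OF i]) simp
  then have j: "integrable lborel (\<lambda>x. indicator {..0} x * f x)"
    by (simp add: even indicator_def)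
  have "integrable lborel (\<lambda>x. \<bar>indicator {0..} x * f x\<bar> + \<bar>indicator {..0} x * f x\<bar>)"
    by (intro Bochner_Integration.integrable_add integrable_abs i j)
  then show ?thesis
    by (rule Bochner_Integration.integrable_bound) (auto simp: indicator_def)
qed

lemma integrable_one_plus_abs_powr:
  assumes "1 < q"
  shows "integrable lborel (\<lambda>x::real. (1 + \<bar>x\<bar>) powr (- q))"
proof (rule integrable_even_lborel)
  define F where "F x = (1 + x) powr (1 - q) / (1 - q)" for x :: real
  have "(\<integral>\<^sup>+x. ennreal ((1 + x) powr (- q)) * indicator {0..} x \<partial>lborel) = ennreal (0 - F 0)"
  proof (rule nn_integral_FTC_atLeast)
    show "(F has_real_derivative (1 + x) powr (- q)) (at x)" if "0 \<le> x" for x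
    proof -
      have "((\<lambda>x. (1 + x) powr (1 - q)) has_real_derivative
          (1 - q) * (1 + x) powr (1 - q - 1) * 1) (at x)"
        using that
        by (intro DERIV_chain2[OF has_real_derivative_powr]) (auto intro!: derivative_eq_intros)
      from DERIV_cdivide[OF this, of "1 - q"] show ?thesis
        using assms by (simp add: F_def[abs_def])
    qed
    have "((\<lambda>x. (1 + x) powr (1 - q)) \<longlongrightarrow> 0) at_top"
      using assms
      by (intro tendsto_neg_powr filterlim_tendsto_add_at_top[OF tendsto_const] filterlim_ident) auto
    then show "(F \<longlongrightarrow> 0) at_top" unfolding F_def
      using tendsto_divide_zero by blast
  qed auto
  then have *: "(\<integral>\<^sup>+x. ennreal ((1 + x) powr (- q)) * indicator {0..} x \<partial>lborel) < \<infinity>" by simp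
  have "(\<integral>\<^sup>+x. ennreal (norm (indicator {0..} x * (1 + \<bar>x\<bar>) powr (- q))) \<partial>lborel)
      = (\<integral>\<^sup>+x. ennreal ((1 + x) powr (- q)) * indicator {0..} x \<partial>lborel)"
    by (intro nn_integral_cong) (auto simp: indicator_def)
  with * show "integrable lborel (\<lambda>x. indicator {0..} x * (1 + \<bar>x\<bar>) powr (- q))"
    by (auto simp: integrable_iff_bounded)
qed auto

section \<open>Hermite functions: recurrences, decay, orthonormality\<close>

notation hermite_function ("\<psi>")

abbreviation gauss :: "real \<Rightarrow> real" where "gauss \<equiv> \<lambda>x. exp (- x\<^sup>2)"

text \<open>The two assertions are proved in one induction: differentiating the recurrence for the
  \<open>n\<close>-th derivative requires that the two preceding derivatives are differentiable.\<close>
lemma gauss_derivs: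
  "((deriv ^^ n) gauss has_real_derivative (deriv ^^ Suc n) gauss x) (at x)
   \<and> (deriv ^^ Suc n) gauss x = - 2 * x * (deriv ^^ n) gauss x
        - 2 * real n * (deriv ^^ (n - 1)) gauss x"
proof (induction n arbitrary: x rule: less_induct)
  case (less n)
  show ?case
  proof (cases n)
    case 0
    have *: "(gauss has_real_derivative - 2 * x * gauss x) (at x)" for x
      by (auto intro!: derivative_eq_intros)
    have "deriv gauss = (\<lambda>x. - 2 * x * gauss x)"
      using DERIV_imp_deriv[OF *] by auto
    then show ?thesis using * 0 by simp
  next
    case (Suc m)
    have eq: "(deriv ^^ n) gauss = (\<lambda>x. - 2 * x * (deriv ^^ m) gauss x
        - 2 * real m * (deriv ^^ (m - 1)) gauss x)"
      using less.IH[of m] Suc by auto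
    have d1: "((deriv ^^ m) gauss has_real_derivative (deriv ^^ n) gauss x) (at x)" for x
    proof -
      have "m < n" using Suc by simp
      from conjunct1[OF less.IH[OF this]] show ?thesis unfolding Suc .
    qed
    have d2: "((\<lambda>x. 2 * real m * (deriv ^^ (m - 1)) gauss x) has_real_derivative
        2 * real m * (deriv ^^ m) gauss x) (at x)" for x
    proof (cases m)
      case (Suc l)
      then show ?thesis using less.IH[of l x] \<open>n = Suc m\<close> by (intro DERIV_cmult) auto
    qed simp
    have "((\<lambda>x. - 2 * x * (deriv ^^ m) gauss x - 2 * real m * (deriv ^^ (m - 1)) gauss x)
        has_real_derivative
        (- 2 * (deriv ^^ m) gauss x + - 2 * x * (deriv ^^ n) gauss x)
          - 2 * real m * (deriv ^^ m) gauss x) (at x)" for x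
      by (rule DERIV_diff[OF _ d2]) (auto intro!: derivative_eq_intros d1)
    then have D: "((deriv ^^ n) gauss has_real_derivative
        (- 2 * (deriv ^^ m) gauss x + - 2 * x * (deriv ^^ n) gauss x)
          - 2 * real m * (deriv ^^ m) gauss x) (at x)" for x
      unfolding eq[symmetric] .
    have E: "(deriv ^^ Suc n) gauss x = (- 2 * (deriv ^^ m) gauss x + - 2 * x * (deriv ^^ n) gauss x)
          - 2 * real m * (deriv ^^ m) gauss x" for x
      using DERIV_imp_deriv[OF D] by simp
    have n: "n - 1 = m" "real n = real m + 1" using Suc by simp_all
    show ?thesis
    proof
      show "((deriv ^^ n) gauss has_real_derivative (deriv ^^ Suc n) gauss x) (at x)"
        unfolding E by (rule D)
      show "(deriv ^^ Suc n) gauss x = - 2 * x * (deriv ^^ n) gauss x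
          - 2 * real n * (deriv ^^ (n - 1)) gauss x"
        unfolding E n by (simp add: algebra_simps)
    qed
  qed
qed

lemma hermite_function_eq:
  "\<psi> n x
    = 1 / sqrt (2 ^ n * fact n * sqrt pi) * (-1) ^ n * exp (x\<^sup>2 / 2) * (deriv ^^ n) gauss x"
proof -
  have "exp (x\<^sup>2) * exp (- x\<^sup>2 / 2) = exp (x\<^sup>2 / 2)" by (simp add: exp_add[symmetric])
  then show ?thesis unfolding hermite_function_def hermite_polynomial_def by (simp add: mult_ac)
qed

lemma sqrt_norm_Suc:
  "sqrt (2 ^ Suc n * fact (Suc n) * sqrt pi)
    = sqrt (2 * real (Suc n)) * sqrt (2 ^ n * fact n * sqrt pi)"
  by (simp add: real_sqrt_mult[symmetric] algebra_simps)

text \<open>The three-term recurrence of the Hermite polynomials, in the normalization of the Hermite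
  functions.  For \<open>n = 0\<close> the index \<open>n - 1\<close> means \<open>0\<close>, but its coefficient vanishes, here and in
  the ladder relations below.\<close>
lemma hermite_function_Suc:
  "sqrt (2 * real (Suc n)) * \<psi> (Suc n) x
    = 2 * x * \<psi> n x - sqrt (2 * real n) * \<psi> (n - 1) x"
proof -
  define c where "c k = 1 / sqrt (2 ^ k * fact k * sqrt pi)" for k :: nat
  have c: "sqrt (2 * real (Suc k)) * c (Suc k) = c k" for k
    unfolding c_def sqrt_norm_Suc by simp
  have h: "\<psi> k x = c k * ((-1) ^ k * exp (x\<^sup>2 / 2) * (deriv ^^ k) gauss x)" for k
    by (simp add: hermite_function_eq c_def)
  have 1: "sqrt (2 * real (Suc n)) * \<psi> (Suc n) x
      = c n * ((-1) ^ Suc n * exp (x\<^sup>2 / 2) * (deriv ^^ Suc n) gauss x)"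
    unfolding h mult.assoc[symmetric] c by simp
  have 2: "sqrt (2 * real n) * \<psi> (n - 1) x
      = - 2 * real n * c n * ((-1) ^ n * exp (x\<^sup>2 / 2) * (deriv ^^ (n - 1)) gauss x)"
  proof (cases n)
    case (Suc m)
    have cm: "c m = sqrt (2 * real n) * c n"
      using c[of m] unfolding Suc by (rule sym)
    have "sqrt (2 * real n) * c m = sqrt (2 * real n) * sqrt (2 * real n) * c n"
      unfolding cm by (rule mult.assoc[symmetric])
    also have "\<dots> = 2 * real n * c n" by simp
    finally have e: "sqrt (2 * real n) * c m = 2 * real n * c n" .
    have n: "n - 1 = m" "(-1::real) ^ n = - ((-1) ^ m)" using Suc by simp_all
    show ?thesis
      unfolding h n mult.assoc[symmetric] e by simp
  qed simp
  show ?thesis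
    unfolding 1 2 unfolding h conjunct2[OF gauss_derivs] by (simp add: algebra_simps)
qed

lemma hermite_function_DERIV:
  "(\<psi> n has_real_derivative
     x * \<psi> n x - sqrt (2 * real (Suc n)) * \<psi> (Suc n) x) (at x)"
proof -
  define c where "c k = 1 / sqrt (2 ^ k * fact k * sqrt pi)" for k :: nat
  have c: "sqrt (2 * real (Suc k)) * c (Suc k) = c k" for k
    unfolding c_def sqrt_norm_Suc by simp
  have h: "\<psi> k = (\<lambda>x. c k * ((-1) ^ k * exp (x\<^sup>2 / 2) * (deriv ^^ k) gauss x))" for k
    by (rule ext) (simp add: hermite_function_eq c_def)
  have 1: "sqrt (2 * real (Suc n)) * \<psi> (Suc n) x
      = c n * ((-1) ^ Suc n * exp (x\<^sup>2 / 2) * (deriv ^^ Suc n) gauss x)"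
    unfolding h mult.assoc[symmetric] c by simp
  show ?thesis
    unfolding 1 unfolding h
    by (auto intro!: derivative_eq_intros conjunct1[OF gauss_derivs] simp del: funpow.simps)
      (simp add: algebra_simps)
qed

lemma hermite_function_times_id:
  "x * \<psi> n x = sqrt (real n / 2) * \<psi> (n - 1) x
     + sqrt (real (Suc n) / 2) * \<psi> (Suc n) x"
proof -
  have s: "sqrt (2 * y) = 2 * sqrt (y / 2)" if "0 \<le> y" for y
    using that real_sqrt_mult[of 4 "y/2"] by simp
  show ?thesis
    using hermite_function_Suc[of n x] s[of "real n"] s[of "real (Suc n)"] by simp
qed

lemma hermite_function_DERIV':
  "(\<psi> n has_real_derivative sqrt (real n / 2) * \<psi> (n - 1) x
     - sqrt (real (Suc n) / 2) * \<psi> (Suc n) x) (at x)"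
proof -
  have s: "sqrt (2 * y) = 2 * sqrt (y / 2)" if "0 \<le> y" for y
    using that real_sqrt_mult[of 4 "y/2"] by simp
  show ?thesis
    using hermite_function_DERIV[of n x] s[of "real (Suc n)"]
    by (simp add: hermite_function_times_id algebra_simps)
qed

lemma continuous_on_hermite_function: "continuous_on A (\<psi> n)"
  by (rule DERIV_continuous_on[OF has_field_derivative_at_within[OF hermite_function_DERIV]])

lemma isCont_hermite_function: "isCont (\<psi> n) x"
  using hermite_function_DERIV DERIV_isCont by blast

lemma borel_measurable_hermite_function [measurable]:
  "\<psi> n \<in> borel_measurable borel"
  by (intro borel_measurable_continuous_onI continuous_on_hermite_function)

lemma borel_measurable_hermite_function_lebesgue [measurable]:
  "\<psi> n \<in> borel_measurable lebesgue"
  by (simp add: measurable_completion)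

text \<open>For \<open>n = 0\<close> the Gaussian beats every power of \<open>x\<close>.  The recurrence trades one factor \<open>x\<close> for one
  step in \<open>n\<close>, which is why the power \<open>k\<close> has to vary during the induction.\<close>
lemma hermite_function_decay:
  "\<exists>C. \<forall>x. \<bar>x\<bar> ^ k * \<bar>\<psi> n x\<bar> \<le> C"
proof (induction n arbitrary: k rule: less_induct)
  case (less n)
  show ?case
  proof (cases n)
    case 0
    have "\<bar>x\<bar> ^ k * \<bar>\<psi> n x\<bar> \<le> 1 + 4 ^ k * fact k" for x
    proof -
      have y: "\<bar>x\<bar> ^ k \<le> 1 + (x\<^sup>2) ^ k"
      proof (cases "\<bar>x\<bar> \<le> 1")
        case True
        then have "\<bar>x\<bar> ^ k \<le> 1" by (simp add: power_le_one)
        then show ?thesis by (simp add: add_increasing2)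
      next
        case False
        then have "\<bar>x\<bar> ^ k \<le> \<bar>x\<bar> ^ (2 * k)" by (intro power_increasing) auto
        then show ?thesis by (simp add: power_mult)
      qed
      have "(x\<^sup>2 / 2) ^ k / fact k \<le> exp (x\<^sup>2 / 2)"
      proof -
        have "sum (\<lambda>i. (x\<^sup>2 / 2) ^ i /\<^sub>R fact i) {k} \<le> exp (x\<^sup>2 / 2)"
          unfolding exp_def by (rule sum_le_suminf[OF summable_exp_generic]) simp_all
        then show ?thesis
          by (simp only: sum.empty sum.insert finite.emptyI empty_iff not_False_eq_True
              add_0_right real_scaleR_def divide_inverse mult.commute)
      qed
      then have "(x\<^sup>2) ^ k \<le> 2 ^ k * fact k * exp (x\<^sup>2 / 2)"
        by (simp add: power_divide field_simps)
      also have "\<dots> \<le> 4 ^ k * fact k * exp (x\<^sup>2 / 2)"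
        by (intro mult_right_mono power_mono) auto
      finally have "(x\<^sup>2) ^ k * exp (- (x\<^sup>2 / 2)) \<le> 4 ^ k * fact k"
        by (simp add: exp_minus field_simps)
      moreover have "\<bar>\<psi> n x\<bar> \<le> exp (- (x\<^sup>2 / 2))"
      proof -
        have "exp (x\<^sup>2 / 2) * exp (- x\<^sup>2) = exp (- (x\<^sup>2 / 2))" by (simp add: exp_add[symmetric])
        moreover have "1 \<le> sqrt (sqrt pi)" using pi_ge_two by simp
        ultimately show ?thesis by (simp add: hermite_function_eq 0 abs_mult divide_le_eq)
      qed
      moreover have "exp (- (x\<^sup>2 / 2)) \<le> 1" by simp
      ultimately have "(1 + (x\<^sup>2) ^ k) * exp (- (x\<^sup>2 / 2)) \<le> 1 + 4 ^ k * fact k"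
        unfolding distrib_right by (intro add_mono) auto
      moreover have "\<bar>x\<bar> ^ k * \<bar>\<psi> n x\<bar> \<le> (1 + (x\<^sup>2) ^ k) * exp (- (x\<^sup>2 / 2))"
        using y \<open>\<bar>\<psi> n x\<bar> \<le> exp (- (x\<^sup>2 / 2))\<close> by (intro mult_mono) auto
      ultimately show ?thesis by linarith
    qed
    then show ?thesis by blast
  next
    case (Suc m)
    obtain C1 where C1: "\<bar>x\<bar> ^ Suc k * \<bar>\<psi> m x\<bar> \<le> C1" for x
      using less.IH[of m "Suc k"] Suc by auto
    obtain C2 where C2: "\<bar>x\<bar> ^ k * (sqrt (2 * real m) * \<bar>\<psi> (m - 1) x\<bar>) \<le> C2" for x
    proof (cases m)
      case 0
      then show ?thesis using that[of 0] by simp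
    next
      case (Suc l)
      obtain C where C: "\<bar>x\<bar> ^ k * \<bar>\<psi> l x\<bar> \<le> C" for x
        using less.IH[of l k] Suc \<open>n = Suc m\<close> by auto
      then show ?thesis
        using that[of "sqrt (2 * real m) * C"] Suc by (simp add: mult.left_commute mult_left_mono)
    qed
    have "\<bar>x\<bar> ^ k * \<bar>\<psi> n x\<bar> \<le> 2 * C1 + C2" for x
    proof -
      have "1 * \<bar>\<psi> n x\<bar> \<le> sqrt (2 * real n) * \<bar>\<psi> n x\<bar>"
        using Suc by (intro mult_right_mono) auto
      also have "\<dots> = \<bar>sqrt (2 * real (Suc m)) * \<psi> (Suc m) x\<bar>"
        using Suc by (simp add: abs_mult)
      also have "\<dots> \<le> 2 * \<bar>x\<bar> * \<bar>\<psi> m x\<bar>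
          + sqrt (2 * real m) * \<bar>\<psi> (m - 1) x\<bar>"
        unfolding hermite_function_Suc
        by (rule order_trans[OF abs_triangle_ineq4]) (simp add: abs_mult)
      finally have "\<bar>x\<bar> ^ k * \<bar>\<psi> n x\<bar> \<le> \<bar>x\<bar> ^ k * (2 * \<bar>x\<bar> * \<bar>\<psi> m x\<bar>
          + sqrt (2 * real m) * \<bar>\<psi> (m - 1) x\<bar>)"
        by (intro mult_left_mono) auto
      also have "\<dots> = 2 * (\<bar>x\<bar> ^ Suc k * \<bar>\<psi> m x\<bar>)
          + \<bar>x\<bar> ^ k * (sqrt (2 * real m) * \<bar>\<psi> (m - 1) x\<bar>)"
        by (simp add: algebra_simps)
      also have "\<dots> \<le> 2 * C1 + C2" using C1[of x] C2[of x] by simp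
      finally show ?thesis .
    qed
    then show ?thesis by blast
  qed
qed

lemma hermite_function_bound:
  obtains C where "0 \<le> C" "\<And>x. \<bar>\<psi> n x\<bar> \<le> C * (1 + \<bar>x\<bar>) powr (- 2)"
proof -
  obtain C0 where C0: "\<And>x. \<bar>x\<bar> ^ 0 * \<bar>\<psi> n x\<bar> \<le> C0"
    using hermite_function_decay[of 0 n] by (elim exE) (rule that, erule spec)
  obtain C1 where C1: "\<And>x. \<bar>x\<bar> ^ 1 * \<bar>\<psi> n x\<bar> \<le> C1"
    using hermite_function_decay[of 1 n] by (elim exE) (rule that, erule spec)
  obtain C2 where C2: "\<And>x. \<bar>x\<bar> ^ 2 * \<bar>\<psi> n x\<bar> \<le> C2"
    using hermite_function_decay[of 2 n] by (elim exE) (rule that, erule spec)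
  have *: "\<bar>\<psi> n x\<bar> \<le> (C0 + 2 * C1 + C2) * (1 + \<bar>x\<bar>) powr (- 2)" for x
  proof -
    have "(1 + \<bar>x\<bar>)\<^sup>2 * \<bar>\<psi> n x\<bar> \<le> C0 + 2 * C1 + C2"
      using C0[of x] C1[of x] C2[of x] by (simp add: power2_eq_square algebra_simps)
    then show ?thesis by (simp add: powr_minus powr_numeral field_simps)
  qed
  moreover have "0 \<le> C0 + 2 * C1 + C2"
    using order_trans[OF abs_ge_zero *[of 0]] by simp
  ultimately show ?thesis using that by blast
qed

lemma hermite_function_Lp:
  assumes "1 \<le> p"
  shows "\<psi> n \<in> Lp_space lebesgue p"
proof -
  obtain C where C: "0 \<le> C" "\<And>x. \<bar>\<psi> n x\<bar> \<le> C * (1 + \<bar>x\<bar>) powr (- 2)"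
    using hermite_function_bound[of n] by blast
  have i: "integrable lebesgue (\<lambda>x. C powr p * (1 + \<bar>x\<bar>) powr (- (2 * p)))"
    using assms by (intro integrable_mult_right)
      (simp add: integrable_completion integrable_one_plus_abs_powr)
  show ?thesis
  proof (rule Lp_space_bound[OF _ i])
    show "AE x in lebesgue. \<bar>\<psi> n x\<bar> powr p \<le> C powr p * (1 + \<bar>x\<bar>) powr - (2 * p)"
    proof (rule AE_I2)
      fix x
      have "\<bar>\<psi> n x\<bar> powr p \<le> (C * (1 + \<bar>x\<bar>) powr (- 2)) powr p"
        using C assms by (intro powr_mono2) auto
      then show "\<bar>\<psi> n x\<bar> powr p \<le> C powr p * (1 + \<bar>x\<bar>) powr - (2 * p)"
        using C by (simp add: powr_mult powr_powr)
    qed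
  qed simp
qed

lemma integral_deriv_eq_0:
  fixes F f :: "real \<Rightarrow> real"
  assumes "\<And>x. (F has_real_derivative f x) (at x)" and "\<And>x. isCont f x"
    and "integrable lborel f" and "(F \<longlongrightarrow> 0) at_top" "(F \<longlongrightarrow> 0) at_bot"
  shows "(\<integral>x. f x \<partial>lborel) = 0"
proof -
  have "(LBINT x=-\<infinity>..\<infinity>. f x) = 0 - 0"
  proof (rule interval_integral_FTC_integrable)
    show "((F \<circ> real_of_ereal) \<longlongrightarrow> 0) (at_right (-\<infinity>))"
      by (simp add: ereal_tendsto_simps1 assms)
    show "((F \<circ> real_of_ereal) \<longlongrightarrow> 0) (at_left \<infinity>)"
      by (simp add: ereal_tendsto_simps1 assms)
    show "set_integrable lborel (einterval (- \<infinity>) \<infinity>) f"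
      using assms(3) by (simp add: set_integrable_def)
  qed (use assms in \<open>auto simp: has_real_derivative_iff_has_vector_derivative\<close>)
  then show ?thesis by (simp add: interval_lebesgue_integral_def set_lebesgue_integral_def)
qed

lemma integrable_hermite_prod_lborel:
  "integrable lborel (\<lambda>x. \<psi> m x * \<psi> n x)"
proof -
  obtain C where C: "0 \<le> C" "\<And>x. \<bar>\<psi> m x\<bar> \<le> C * (1 + \<bar>x\<bar>) powr (- 2)"
    using hermite_function_bound[of m] by blast
  obtain D where D: "0 \<le> D" "\<And>x. \<bar>\<psi> n x\<bar> \<le> D * (1 + \<bar>x\<bar>) powr (- 2)"
    using hermite_function_bound[of n] by blast
  have "integrable lborel (\<lambda>x::real. C * D * (1 + \<bar>x\<bar>) powr (- 4))"
    by (intro integrable_mult_right integrable_one_plus_abs_powr) simp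
  then show ?thesis
  proof (rule Bochner_Integration.integrable_bound)
    show "AE x in lborel. norm (\<psi> m x * \<psi> n x)
        \<le> norm (C * D * (1 + \<bar>x\<bar>) powr - 4)"
    proof (rule AE_I2)
      fix x :: real
      have "\<bar>\<psi> m x\<bar> * \<bar>\<psi> n x\<bar>
          \<le> (C * (1 + \<bar>x\<bar>) powr (- 2)) * (D * (1 + \<bar>x\<bar>) powr (- 2))"
        using C D by (intro mult_mono) auto
      also have "\<dots> = C * D * (1 + \<bar>x\<bar>) powr (- 4)"
        by (simp add: powr_add[symmetric])
      finally show "norm (\<psi> m x * \<psi> n x)
        \<le> norm (C * D * (1 + \<bar>x\<bar>) powr - 4)"
        using C D by (simp add: abs_mult)
    qed
  qed measurable
qed

lemma hermite_function_tendsto_0: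
  "(\<psi> n \<longlongrightarrow> 0) at_top" "(\<psi> n \<longlongrightarrow> 0) at_bot"
proof -
  obtain C where C: "0 \<le> C" "\<And>x. \<bar>\<psi> n x\<bar> \<le> C * (1 + \<bar>x\<bar>) powr (- 2)"
    using hermite_function_bound[of n] by blast
  have "filterlim (\<lambda>x::real. 1 + \<bar>x\<bar>) at_top F" if "filterlim abs at_top F" for F
    by (rule filterlim_tendsto_add_at_top[OF tendsto_const that])
  from tendsto_mult_right_zero[OF tendsto_neg_powr[OF _ this], of "-2" _ C]
  have *: "((\<lambda>x. C * (1 + \<bar>x\<bar>) powr (- 2)) \<longlongrightarrow> 0) F" if "filterlim abs at_top F" for F
    using that by simp
  have F: "(\<psi> n \<longlongrightarrow> 0) F" if "filterlim abs at_top F" for F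
    by (rule Lim_null_comparison[OF _ *[OF that]]) (simp add: C)
  show "(\<psi> n \<longlongrightarrow> 0) at_top"
    by (intro F filterlim_at_top_mono[OF filterlim_ident] always_eventually) auto
  show "(\<psi> n \<longlongrightarrow> 0) at_bot"
    by (intro F filterlim_at_top_mono[OF filterlim_uminus_at_top_at_bot] always_eventually) auto
qed

text \<open>The derivative of \<open>\<psi>\<^sub>m \<psi>\<^sub>n\<close> has integral \<open>0\<close>: raising one factor is adjoint to lowering the other.
  Iterating this down to index \<open>0\<close> yields orthonormality.\<close>
lemma hermite_prod_ladder:
  "sqrt (real (Suc m)) * (\<integral>x. \<psi> (Suc m) x * \<psi> n x \<partial>lborel)
    = sqrt (real n) * (\<integral>x. \<psi> m x * \<psi> (n - 1) x \<partial>lborel)"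
proof -
  note i = integrable_hermite_prod_lborel
  have d: "((\<lambda>x. \<psi> m x * \<psi> n x) has_real_derivative
      - sqrt (2 * real (Suc m)) * (\<psi> (Suc m) x * \<psi> n x)
        + sqrt (2 * real n) * (\<psi> m x * \<psi> (n - 1) x)) (at x)" for x
  proof -
    have "(\<psi> n has_real_derivative sqrt (2 * real n) * \<psi> (n - 1) x - x * \<psi> n x) (at x)"
      using hermite_function_DERIV[of n x] hermite_function_Suc[of n x] by simp
    from DERIV_mult[OF hermite_function_DERIV[of m x] this]
    show ?thesis by (simp add: algebra_simps)
  qed
  have "(\<integral>x. - sqrt (2 * real (Suc m)) * (\<psi> (Suc m) x * \<psi> n x)
        + sqrt (2 * real n) * (\<psi> m x * \<psi> (n - 1) x) \<partial>lborel) = 0"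
  proof (rule integral_deriv_eq_0[OF d])
    show "((\<lambda>x. \<psi> m x * \<psi> n x) \<longlongrightarrow> 0) at_top" "((\<lambda>x. \<psi> m x * \<psi> n x) \<longlongrightarrow> 0) at_bot"
      by (auto intro!: tendsto_mult_zero hermite_function_tendsto_0)
  qed (auto intro!: continuous_intros isCont_hermite_function i)
  then have "sqrt 2 * sqrt (real (Suc m)) * (\<integral>x. \<psi> (Suc m) x * \<psi> n x \<partial>lborel)
      = sqrt 2 * sqrt (real n) * (\<integral>x. \<psi> m x * \<psi> (n - 1) x \<partial>lborel)"
    using i by (simp add: real_sqrt_mult del: of_nat_Suc)
  then show ?thesis by (simp del: of_nat_Suc add: mult.assoc)
qed

lemma hermite_orthonormal_lborel:
  "(\<integral>x. \<psi> m x * \<psi> n x \<partial>lborel) = (if m = n then 1 else 0)"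
proof (induction m arbitrary: n)
  case 0
  show ?case
  proof (cases n)
    case 0
    have "\<psi> 0 x * \<psi> 0 x = normal_density 0 (1 / sqrt 2) x" for x
    proof -
      have "\<psi> 0 x * \<psi> 0 x
          = (1 / (sqrt (sqrt pi) * sqrt (sqrt pi))) * (exp (x\<^sup>2 / 2) * exp (x\<^sup>2 / 2) * exp (- x\<^sup>2) * exp (- x\<^sup>2))"
        by (simp add: hermite_function_eq)
      also have "exp (x\<^sup>2 / 2) * exp (x\<^sup>2 / 2) * exp (- x\<^sup>2) * exp (- x\<^sup>2) = exp (- x\<^sup>2)"
        by (simp add: exp_add[symmetric])
      finally show ?thesis by (simp add: normal_density_def power_divide)
    qed
    then show ?thesis using integral_normal_density[of "1 / sqrt 2" 0] 0 by simp
  next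
    case (Suc k)
    then show ?thesis
      using hermite_prod_ladder[of k 0] by (simp add: mult.commute)
  qed
next
  case (Suc m)
  show ?case
  proof (cases n)
    case 0
    then show ?thesis using hermite_prod_ladder[of m 0] by simp
  next
    case (Suc k)
    then show ?thesis using hermite_prod_ladder[of m n] Suc.IH[of k] by auto
  qed
qed

lemma integrable_hermite_prod:
  "integrable lebesgue (\<lambda>x. \<psi> m x * \<psi> n x)"
  by (simp add: integrable_completion integrable_hermite_prod_lborel)

lemma hermite_orthonormal:
  "(\<integral>x. \<psi> m x * \<psi> n x \<partial>lebesgue) = (if m = n then 1 else 0)"
  by (simp add: integral_completion hermite_orthonormal_lborel)

section \<open>Norm estimates for finite Hermite sums\<close>

lemma hermite_sum_square:
  assumes "finite K" "inj_on j K"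
  shows "integrable lebesgue (\<lambda>x. (\<Sum>k\<in>K. b k * \<psi> (j k) x)\<^sup>2)"
    and "(\<integral>x. (\<Sum>k\<in>K. b k * \<psi> (j k) x)\<^sup>2 \<partial>lebesgue) = (\<Sum>k\<in>K. (b k)\<^sup>2)"
proof -
  have eq: "(\<Sum>k\<in>K. b k * \<psi> (j k) x)\<^sup>2
      = (\<Sum>k\<in>K. \<Sum>l\<in>K. b k * b l * (\<psi> (j k) x * \<psi> (j l) x))" for x
    by (simp add: power2_eq_square sum_product algebra_simps)
  show "integrable lebesgue (\<lambda>x. (\<Sum>k\<in>K. b k * \<psi> (j k) x)\<^sup>2)"
    unfolding eq by (intro Bochner_Integration.integrable_sum integrable_mult_right
        integrable_hermite_prod)
  have "(\<integral>x. (\<Sum>k\<in>K. b k * \<psi> (j k) x)\<^sup>2 \<partial>lebesgue)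
      = (\<Sum>k\<in>K. \<Sum>l\<in>K. b k * b l * (if j k = j l then 1 else 0))"
    unfolding eq
    by (subst Bochner_Integration.integral_sum Bochner_Integration.integral_sum,
        intro Bochner_Integration.integrable_sum integrable_mult_right integrable_hermite_prod)+
      (simp add: integrable_hermite_prod hermite_orthonormal)
  also have "\<dots> = (\<Sum>k\<in>K. \<Sum>l\<in>K. if k = l then (b k)\<^sup>2 else 0)"
    using assms(2) by (intro sum.cong refl) (auto simp: inj_on_def power2_eq_square)
  also have "\<dots> = (\<Sum>k\<in>K. (b k)\<^sup>2)" using assms(1) by simp
  finally show "(\<integral>x. (\<Sum>k\<in>K. b k * \<psi> (j k) x)\<^sup>2 \<partial>lebesgue) = (\<Sum>k\<in>K. (b k)\<^sup>2)" .
qed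

text \<open>For \<open>q = \<Sum> b\<^sub>k \<psi>\<^sub>k\<close> the function \<open>v\<close> is \<open>x q\<close> when \<open>s = 1\<close> and \<open>q'\<close> when \<open>s = -1\<close>.  The
  lowering half and the raising half of \<open>v\<close> are orthogonal expansions separately, so Parseval's
  identity and \<open>(u + v)\<^sup>2 \<le> 2 u\<^sup>2 + 2 v\<^sup>2\<close> give the eigenvalue \<open>2k + 1\<close> of the harmonic oscillator as
  weight.\<close>
lemma hermite_sum_ladder:
  fixes s :: real and b :: "nat \<Rightarrow> real"
  assumes "finite K" "s\<^sup>2 = 1"
  defines "v \<equiv> \<lambda>x. \<Sum>k\<in>K. b k * (sqrt (real k / 2) * \<psi> (k - 1) x
      + s * (sqrt (real (Suc k) / 2) * \<psi> (Suc k) x))"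
  shows "integrable lebesgue (\<lambda>x. (v x)\<^sup>2)"
    and "(\<integral>x. (v x)\<^sup>2 \<partial>lebesgue) \<le> (\<Sum>k\<in>K. (2 * real k + 1) * (b k)\<^sup>2)"
proof -
  define v1 where "v1 x = (\<Sum>k\<in>K - {0}. (b k * sqrt (real k / 2)) * \<psi> (k - 1) x)" for x
  define v2 where "v2 x = (\<Sum>k\<in>K. (b k * sqrt (real (Suc k) / 2)) * \<psi> (Suc k) x)" for x
  have 1: "integrable lebesgue (\<lambda>x. (v1 x)\<^sup>2)"
    "(\<integral>x. (v1 x)\<^sup>2 \<partial>lebesgue) = (\<Sum>k\<in>K - {0}. (b k * sqrt (real k / 2))\<^sup>2)"
    unfolding v1_def
    by (rule hermite_sum_square[where j = "\<lambda>k. k - 1"]; use assms(1) in \<open>auto simp: inj_on_def\<close>)+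
  have 2: "integrable lebesgue (\<lambda>x. (v2 x)\<^sup>2)"
    "(\<integral>x. (v2 x)\<^sup>2 \<partial>lebesgue) = (\<Sum>k\<in>K. (b k * sqrt (real (Suc k) / 2))\<^sup>2)"
    unfolding v2_def
    by (rule hermite_sum_square[where j = Suc]; use assms(1) in \<open>auto simp: inj_on_def\<close>)+
  have v: "v x = v1 x + s * v2 x" for x
  proof -
    have "(\<Sum>k\<in>K. (b k * sqrt (real k / 2)) * \<psi> (k - 1) x) = v1 x"
      unfolding v1_def using assms(1) by (intro sum.mono_neutral_right) auto
    then show ?thesis
      unfolding v_def v2_def
      by (simp add: algebra_simps sum.distrib sum_distrib_left)
  qed
  have le: "(v x)\<^sup>2 \<le> 2 * (v1 x)\<^sup>2 + 2 * (v2 x)\<^sup>2" for x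
  proof -
    have "2 * (v1 x)\<^sup>2 + 2 * (v2 x)\<^sup>2 - (v x)\<^sup>2 = (v1 x - s * v2 x)\<^sup>2 + 2 * (1 - s\<^sup>2) * (v2 x)\<^sup>2"
      unfolding v by (simp add: power2_eq_square algebra_simps)
    then have "2 * (v1 x)\<^sup>2 + 2 * (v2 x)\<^sup>2 - (v x)\<^sup>2 = (v1 x - s * v2 x)\<^sup>2"
      using assms(2) by simp
    moreover have "0 \<le> (v1 x - s * v2 x)\<^sup>2" by simp
    ultimately show ?thesis by linarith
  qed
  have i: "integrable lebesgue (\<lambda>x. 2 * (v1 x)\<^sup>2 + 2 * (v2 x)\<^sup>2)" using 1 2 by auto
  show "integrable lebesgue (\<lambda>x. (v x)\<^sup>2)"
    by (rule Bochner_Integration.integrable_bound[OF i]) (use le in \<open>auto simp: v_def\<close>)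
  then have "(\<integral>x. (v x)\<^sup>2 \<partial>lebesgue) \<le> (\<integral>x. 2 * (v1 x)\<^sup>2 + 2 * (v2 x)\<^sup>2 \<partial>lebesgue)"
    by (rule integral_mono[OF _ i le])
  also have "\<dots> = 2 * (\<Sum>k\<in>K - {0}. (b k * sqrt (real k / 2))\<^sup>2)
      + 2 * (\<Sum>k\<in>K. (b k * sqrt (real (Suc k) / 2))\<^sup>2)"
    using 1 2 by simp
  also have "(\<Sum>k\<in>K - {0}. (b k * sqrt (real k / 2))\<^sup>2) = (\<Sum>k\<in>K. (b k * sqrt (real k / 2))\<^sup>2)"
    using assms(1) by (intro sum.mono_neutral_left) auto
  also have "2 * \<dots> + 2 * (\<Sum>k\<in>K. (b k * sqrt (real (Suc k) / 2))\<^sup>2)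
      = (\<Sum>k\<in>K. (2 * real k + 1) * (b k)\<^sup>2)"
    unfolding sum_distrib_left sum.distrib[symmetric]
    by (intro sum.cong refl) (simp add: power_mult_distrib field_simps)
  finally show "(\<integral>x. (v x)\<^sup>2 \<partial>lebesgue) \<le> \<dots>" .
qed

lemma hermite_sum_weight_id:
  fixes b :: "nat \<Rightarrow> real"
  assumes "finite K"
  defines "q \<equiv> \<lambda>x. \<Sum>k\<in>K. b k * \<psi> k x"
  shows "integrable lebesgue (\<lambda>x. (1 + x\<^sup>2) * (q x)\<^sup>2)"
    and "(\<integral>x. (1 + x\<^sup>2) * (q x)\<^sup>2 \<partial>lebesgue) \<le> (\<Sum>k\<in>K. (2 * real k + 2) * (b k)\<^sup>2)"
proof -
  have 1: "integrable lebesgue (\<lambda>x. (q x)\<^sup>2)" "(\<integral>x. (q x)\<^sup>2 \<partial>lebesgue) = (\<Sum>k\<in>K. (b k)\<^sup>2)"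
    unfolding q_def by (rule hermite_sum_square[where j = "\<lambda>k. k"]; use assms(1) in simp)+
  have eq: "x * q x = (\<Sum>k\<in>K. b k * (sqrt (real k / 2) * \<psi> (k - 1) x
      + 1 * (sqrt (real (Suc k) / 2) * \<psi> (Suc k) x)))" for x
    unfolding q_def sum_distrib_left mult_1 hermite_function_times_id[symmetric]
    by (intro sum.cong) auto
  have 2: "integrable lebesgue (\<lambda>x. (x * q x)\<^sup>2)"
    "(\<integral>x. (x * q x)\<^sup>2 \<partial>lebesgue) \<le> (\<Sum>k\<in>K. (2 * real k + 1) * (b k)\<^sup>2)"
    unfolding eq by (rule hermite_sum_ladder[OF assms(1)]; simp)+
  have eq2: "(1 + x\<^sup>2) * (q x)\<^sup>2 = (q x)\<^sup>2 + (x * q x)\<^sup>2" for x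
    by (simp add: power2_eq_square algebra_simps)
  show "integrable lebesgue (\<lambda>x. (1 + x\<^sup>2) * (q x)\<^sup>2)"
    unfolding eq2 using 1 2 by simp
  have "(\<integral>x. (1 + x\<^sup>2) * (q x)\<^sup>2 \<partial>lebesgue)
      \<le> (\<Sum>k\<in>K. (b k)\<^sup>2) + (\<Sum>k\<in>K. (2 * real k + 1) * (b k)\<^sup>2)"
    unfolding eq2 using 1 2 by simp
  also have "\<dots> = (\<Sum>k\<in>K. (2 * real k + 2) * (b k)\<^sup>2)"
    by (simp add: sum.distrib[symmetric] algebra_simps)
  finally show "(\<integral>x. (1 + x\<^sup>2) * (q x)\<^sup>2 \<partial>lebesgue) \<le> \<dots>" .
qed

text \<open>Agmon's inequality \<open>sup q\<^sup>2 \<le> 2 \<parallel>q\<parallel> \<parallel>q'\<parallel>\<close>: write \<open>q(x)\<^sup>2\<close> as the integral of \<open>2 q q'\<close> over the half-line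
  to the left of \<open>x\<close>.  For an expansion of length \<open>n\<close> one has \<open>\<parallel>q'\<parallel> \<le> sqrt (2n) \<parallel>q\<parallel>\<close>.\<close>
lemma hermite_sum_sup:
  fixes b :: "nat \<Rightarrow> real"
  assumes n: "0 < n"
  defines "q \<equiv> \<lambda>x. \<Sum>k<n. b k * \<psi> k x"
  shows "(q x)\<^sup>2 \<le> 2 * sqrt (2 * real n) * (\<Sum>k<n. (b k)\<^sup>2)"
proof -
  define B where "B = (\<Sum>k<n. (b k)\<^sup>2)"
  define q' where "q' x = (\<Sum>k<n. b k * (sqrt (real k / 2) * \<psi> (k - 1) x
      + (- 1) * (sqrt (real (Suc k) / 2) * \<psi> (Suc k) x)))" for x
  \<comment> \<open>the weight that balances the two terms of \<open>2 q q' \<le> m q\<^sup>2 + q'\<^sup>2 / m\<close>\<close>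
  define m where "m = sqrt (2 * real n)"
  have m: "0 < m" "m * m = 2 * real n" using n by (auto simp: m_def)
  have 1: "integrable lebesgue (\<lambda>x. (q x)\<^sup>2)" "(\<integral>x. (q x)\<^sup>2 \<partial>lebesgue) = B"
    unfolding q_def B_def by (rule hermite_sum_square[where j = "\<lambda>k. k"]; simp)+
  have 2: "integrable lebesgue (\<lambda>x. (q' x)\<^sup>2)"
    "(\<integral>x. (q' x)\<^sup>2 \<partial>lebesgue) \<le> (\<Sum>k<n. (2 * real k + 1) * (b k)\<^sup>2)"
    unfolding q'_def by (rule hermite_sum_ladder; simp)+
  note 2(2)
  also have "(\<Sum>k<n. (2 * real k + 1) * (b k)\<^sup>2) \<le> (\<Sum>k<n. (m * m) * (b k)\<^sup>2)"
    unfolding m by (intro sum_mono mult_right_mono) auto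
  also have "\<dots> = m * m * B" by (simp add: B_def sum_distrib_left)
  finally have q'B: "(\<integral>x. (q' x)\<^sup>2 \<partial>lebesgue) \<le> m * m * B" .
  have dq: "(q has_real_derivative q' x) (at x)" for x
    unfolding q_def q'_def
    by (auto intro!: DERIV_sum DERIV_cmult DERIV_cong[OF hermite_function_DERIV'])
  have contq: "isCont q x" for x using DERIV_isCont[OF dq] .
  have contq': "isCont q' x" for x
    unfolding q'_def by (intro continuous_intros isCont_hermite_function)
  have [measurable]: "q \<in> borel_measurable borel" "q' \<in> borel_measurable borel"
    unfolding q_def q'_def by measurable
  define g where "g y = m * (q y)\<^sup>2 + (q' y)\<^sup>2 / m" for y
  have g: "integrable lebesgue g" unfolding g_def[abs_def] using 1 2 by auto
  have "(\<integral>y. g y \<partial>lebesgue) = m * B + (\<integral>y. (q' y)\<^sup>2 \<partial>lebesgue) / m"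
    unfolding g_def using 1 2 by simp
  also have "\<dots> \<le> m * B + m * m * B / m"
    using q'B m by (intro add_mono divide_right_mono) auto
  also have "m * m * B / m = m * B" using m(1) by simp
  finally have gB: "(\<integral>y. g y \<partial>lebesgue) \<le> 2 * m * B" by (simp add: algebra_simps)
  have AM: "2 * q y * q' y \<le> g y" for y
  proof -
    have "0 \<le> (m * q y - q' y)\<^sup>2 / m" using m by simp
    also have "\<dots> = g y - 2 * q y * q' y"
      using m by (simp add: g_def power2_eq_square field_simps)
    finally show ?thesis by simp
  qed
  have gnn: "0 \<le> g y" for y using m by (simp add: g_def)
  have step: "(q x)\<^sup>2 - (q r)\<^sup>2 \<le> 2 * m * B" if "r \<le> x" for r
  proof -
    have F: "((\<lambda>x. (q x)\<^sup>2) has_real_derivative 2 * q y * q' y) (at y)" for y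
      by (auto intro!: derivative_eq_intros dq)
    have hb: "has_bochner_integral lborel (\<lambda>y. 2 * q y * q' y * indicator {r..x} y)
        ((q x)\<^sup>2 - (q r)\<^sup>2)"
      by (rule has_bochner_integral_FTC_Icc_real[OF that F])
        (auto intro!: continuous_intros contq contq')
    have "(q x)\<^sup>2 - (q r)\<^sup>2 = (\<integral>y. 2 * q y * q' y * indicator {r..x} y \<partial>lebesgue)"
      using hb by (simp add: integral_completion has_bochner_integral_iff)
    also have "\<dots> \<le> (\<integral>y. g y \<partial>lebesgue)"
    proof (rule integral_mono[OF _ g])
      show "integrable lebesgue (\<lambda>y. 2 * q y * q' y * indicator {r..x} y)"
        using hb by (simp add: integrable_completion has_bochner_integral_iff)
      show "2 * q y * q' y * indicator {r..x} y \<le> g y" for y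
        using AM[of y] gnn[of y] by (auto simp: indicator_def)
    qed
    finally show ?thesis using gB by linarith
  qed
  have "(q \<longlongrightarrow> (\<Sum>k<n. b k * 0)) at_bot"
    unfolding q_def by (intro tendsto_intros hermite_function_tendsto_0)
  then have "((\<lambda>r. (q x)\<^sup>2 - (q r)\<^sup>2) \<longlongrightarrow> (q x)\<^sup>2 - 0\<^sup>2) at_bot"
    by (intro tendsto_intros) simp
  moreover have "\<forall>\<^sub>F r in at_bot. (q x)\<^sup>2 - (q r)\<^sup>2 \<le> 2 * m * B"
    using eventually_le_at_bot[of x] by eventually_elim (rule step)
  ultimately have "(q x)\<^sup>2 - 0\<^sup>2 \<le> 2 * m * B"
    by (rule tendsto_upperbound) simp
  then show ?thesis by (simp add: m_def B_def)
qed

text \<open>If the quadratic form of a positive operator \<open>A\<close> is dominated by that of \<open>B\<close>, then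
  \<open>A (l + A)\<^sup>-\<^sup>1\<close> is dominated by \<open>B (l + B)\<^sup>-\<^sup>1\<close>.  Here \<open>A\<close> is multiplication by \<open>1 + x\<^sup>2\<close> and \<open>B\<close> has the
  eigenvalues \<open>y\<^sub>k = 2k + 2\<close>.  The proof splits each coefficient in the ratio \<open>l : y\<^sub>k\<close>, which minimizes
  \<open>y\<^sub>k b\<^sub>0\<^sup>2 / l + b\<^sub>1\<^sup>2\<close> over \<open>b\<^sub>0 + b\<^sub>1 = b\<^sub>k\<close>, and compares it with the pointwise bound
  \<open>p / (l + p) (u + v)\<^sup>2 \<le> p u\<^sup>2 / l + v\<^sup>2\<close>, which holds for every splitting.\<close>
lemma hermite_sum_resolvent:
  fixes l :: real and b :: "nat \<Rightarrow> real"
  assumes K: "finite K" and l: "0 < l"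
  defines "q \<equiv> \<lambda>x. \<Sum>k\<in>K. b k * \<psi> k x"
  shows "(\<integral>x. (1 + x\<^sup>2) / (l + (1 + x\<^sup>2)) * (q x)\<^sup>2 \<partial>lebesgue)
    \<le> (\<Sum>k\<in>K. (2 * real k + 2) / (l + (2 * real k + 2)) * (b k)\<^sup>2)"
    and "integrable lebesgue (\<lambda>x. (1 + x\<^sup>2) / (l + (1 + x\<^sup>2)) * (q x)\<^sup>2)"
proof -
  define y where "y k = 2 * real k + 2" for k
  have y: "0 < y k" for k by (simp add: y_def)
  define b0 where "b0 k = l / (l + y k) * b k" for k
  define b1 where "b1 k = y k / (l + y k) * b k" for k
  define u where "u x = (\<Sum>k\<in>K. b0 k * \<psi> k x)" for x
  define v where "v x = (\<Sum>k\<in>K. b1 k * \<psi> k x)" for x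
  have uv: "q x = u x + v x" for x
  proof -
    have "b k = b0 k + b1 k" for k
      using y[of k] l by (simp add: b0_def b1_def distrib_right[symmetric] add_divide_distrib[symmetric])
    then show ?thesis by (simp add: q_def u_def v_def sum.distrib[symmetric] distrib_right[symmetric])
  qed
  have 0: "integrable lebesgue (\<lambda>x. (q x)\<^sup>2)"
    unfolding q_def by (rule hermite_sum_square[where j = "\<lambda>k. k"]; use K in simp)
  have 1: "integrable lebesgue (\<lambda>x. (v x)\<^sup>2)" "(\<integral>x. (v x)\<^sup>2 \<partial>lebesgue) = (\<Sum>k\<in>K. (b1 k)\<^sup>2)"
    unfolding v_def by (rule hermite_sum_square[where j = "\<lambda>k. k"]; use K in simp)+
  have 2: "integrable lebesgue (\<lambda>x. (1 + x\<^sup>2) * (u x)\<^sup>2)"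
    "(\<integral>x. (1 + x\<^sup>2) * (u x)\<^sup>2 \<partial>lebesgue) \<le> (\<Sum>k\<in>K. y k * (b0 k)\<^sup>2)"
    unfolding u_def y_def by (rule hermite_sum_weight_id[OF K])+
  have le: "(1 + x\<^sup>2) / (l + (1 + x\<^sup>2)) * (q x)\<^sup>2 \<le> (1 / l) * ((1 + x\<^sup>2) * (u x)\<^sup>2) + (v x)\<^sup>2" for x
  proof -
    define p where "p = 1 + x\<^sup>2"
    have p: "0 < p" by (simp add: p_def add_pos_nonneg)
    have "((1 / l) * (p * (u x)\<^sup>2) + (v x)\<^sup>2) - p / (l + p) * (u x + v x)\<^sup>2
        = (p * u x - l * v x)\<^sup>2 / (l * (l + p))"
      using p l by (simp add: divide_simps) (simp add: power2_eq_square algebra_simps)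
    also have "\<dots> \<ge> 0" using p l by simp
    finally show ?thesis unfolding uv p_def by simp
  qed
  show int: "integrable lebesgue (\<lambda>x. (1 + x\<^sup>2) / (l + (1 + x\<^sup>2)) * (q x)\<^sup>2)"
  proof (rule Bochner_Integration.integrable_bound[OF 0])
    show "AE x in lebesgue. norm ((1 + x\<^sup>2) / (l + (1 + x\<^sup>2)) * (q x)\<^sup>2) \<le> norm ((q x)\<^sup>2)"
    proof (rule AE_I2)
      fix x :: real
      have "0 < l + (1 + x\<^sup>2)" using l by (simp add: add_pos_nonneg)
      then have "0 \<le> (1 + x\<^sup>2) / (l + (1 + x\<^sup>2))" "(1 + x\<^sup>2) / (l + (1 + x\<^sup>2)) \<le> 1"
        using l by (auto simp: divide_le_eq)
      then show "norm ((1 + x\<^sup>2) / (l + (1 + x\<^sup>2)) * (q x)\<^sup>2) \<le> norm ((q x)\<^sup>2)"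
        using mult_right_mono[of "(1 + x\<^sup>2) / (l + (1 + x\<^sup>2))" 1 "(q x)\<^sup>2"]
        by (simp only: real_norm_def abs_of_nonneg mult_nonneg_nonneg zero_le_power2 mult_1)
    qed
  qed (simp add: q_def measurable_completion)
  have "(\<integral>x. (1 + x\<^sup>2) / (l + (1 + x\<^sup>2)) * (q x)\<^sup>2 \<partial>lebesgue)
      \<le> (\<integral>x. (1 / l) * ((1 + x\<^sup>2) * (u x)\<^sup>2) + (v x)\<^sup>2 \<partial>lebesgue)"
    by (rule integral_mono[OF int _ le]) (use 1 2 in simp)
  also have "\<dots> = (1 / l) * (\<integral>x. (1 + x\<^sup>2) * (u x)\<^sup>2 \<partial>lebesgue) + (\<integral>x. (v x)\<^sup>2 \<partial>lebesgue)"
    using 1 2 by simp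
  also have "\<dots> \<le> (1 / l) * (\<Sum>k\<in>K. y k * (b0 k)\<^sup>2) + (\<Sum>k\<in>K. (b1 k)\<^sup>2)"
    using 1 2 l by (intro add_mono mult_left_mono) auto
  also have "\<dots> = (\<Sum>k\<in>K. (1 / l) * (y k * (b0 k)\<^sup>2) + (b1 k)\<^sup>2)"
    by (simp add: sum_distrib_left sum.distrib)
  also have "\<dots> = (\<Sum>k\<in>K. y k / (l + y k) * (b k)\<^sup>2)"
  proof (rule sum.cong[OF refl])
    fix k
    define d where "d = 1 / (l + y k)"
    have d: "l / (l + y k) = l * d" "y k / (l + y k) = y k * d" by (simp_all add: d_def)
    have 1: "l * d + y k * d = 1"
      using l y[of k] by (simp add: d_def add_divide_distrib[symmetric])
    have "(1 / l) * (y k * (b0 k)\<^sup>2) = y k * l * d\<^sup>2 * (b k)\<^sup>2"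
      unfolding b0_def d using l by (simp add: power2_eq_square)
    then have "(1 / l) * (y k * (b0 k)\<^sup>2) + (b1 k)\<^sup>2
        = (y k * d) * (b k)\<^sup>2 * (l * d + y k * d)"
      unfolding b1_def d by (simp add: power2_eq_square algebra_simps)
    then show "(1 / l) * (y k * (b0 k)\<^sup>2) + (b1 k)\<^sup>2 = y k / (l + y k) * (b k)\<^sup>2"
      unfolding 1 d by simp
  qed
  finally show "(\<integral>x. (1 + x\<^sup>2) / (l + (1 + x\<^sup>2)) * (q x)\<^sup>2 \<partial>lebesgue)
    \<le> (\<Sum>k\<in>K. (2 * real k + 2) / (l + (2 * real k + 2)) * (b k)\<^sup>2)"
    unfolding y_def .
qed

lemma two_power_cubed: "((2::real) ^ n) ^ 3 = 8 ^ n"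
  using power_mult[of "2::real" 3 n] power_mult[of "2::real" n 3] by (simp add: mult.commute)

lemma two_power_fourth: "((2::real) ^ n) ^ 4 = 16 ^ n"
  using power_mult[of "2::real" 4 n] power_mult[of "2::real" n 4] by (simp add: mult.commute)

abbreviation dyadic_resolvent_sum :: "nat \<Rightarrow> real \<Rightarrow> real" where
  "dyadic_resolvent_sum J s \<equiv> \<Sum>j<J. 2 ^ j * (s ^ 4 / (16 ^ j + s ^ 4))"

text \<open>The functions \<open>p \<mapsto> p / (16\<^sup>j + p)\<close>, superposed with the coefficients \<open>2\<^sup>j\<close>, reproduce \<open>p\<^bsup>1/4\<^esup>\<close> up to
  constants; below \<open>p = s\<^sup>4\<close>.  The terms grow like \<open>2\<^sup>j\<close> until \<open>2\<^sup>j\<close> reaches \<open>s\<close> and then decay like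
  \<open>s\<^sup>4 / 8\<^sup>j\<close>; the induction carries one bound for each of the two regimes.\<close>
lemma dyadic_resolvent_sum_upper:
  fixes s :: real
  assumes "1 \<le> s"
  shows "dyadic_resolvent_sum J s \<le> 4 * s"
proof -
  have s: "0 < s ^ 4" using assms by simp
  have t1: "2 ^ j * (s ^ 4 / (16 ^ j + s ^ 4)) \<le> 2 ^ j" for j :: nat
    using s by (intro mult_left_le) (auto simp: divide_le_eq add_pos_pos)
  have t2: "2 ^ j * (s ^ 4 / (16 ^ j + s ^ 4)) \<le> s ^ 4 / 8 ^ j" for j :: nat
  proof -
    have "2 ^ j * (s ^ 4 / (16 ^ j + s ^ 4)) \<le> 2 ^ j * (s ^ 4 / 16 ^ j)"
      using s by (intro mult_left_mono divide_left_mono mult_pos_pos add_pos_pos) auto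
    also have "\<dots> = s ^ 4 / 8 ^ j"
    proof -
      have "(16::real) ^ j = 2 ^ j * 8 ^ j" by (simp add: power_mult_distrib[symmetric])
      then show ?thesis by simp
    qed
    finally show ?thesis .
  qed
  have "dyadic_resolvent_sum J s \<le> 2 ^ J - 1 \<and>
    (s < 2 ^ J \<longrightarrow> dyadic_resolvent_sum J s \<le> 4 * s - 2 * (s ^ 4 / 8 ^ J))"
  proof (induction J)
    case 0
    then show ?case using assms by simp
  next
    case (Suc J)
    have S1: "dyadic_resolvent_sum (Suc J) s \<le> 2 ^ Suc J - 1" using Suc.IH t1[of J] by simp
    have "dyadic_resolvent_sum (Suc J) s \<le> 4 * s - 2 * (s ^ 4 / 8 ^ Suc J)" if "s < 2 ^ Suc J"
    proof (cases "s < 2 ^ J")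
      case True
      have "dyadic_resolvent_sum (Suc J) s \<le> 4 * s - 2 * (s ^ 4 / 8 ^ J) + s ^ 4 / 8 ^ J"
        using Suc.IH True t2[of J] by simp
      also have "\<dots> \<le> 4 * s - 2 * (s ^ 4 / 8 ^ Suc J)"
      proof -
        define z where "z = s ^ 4 / 8 ^ J"
        have "0 \<le> z" "s ^ 4 / 8 ^ Suc J = z / 8" using s by (simp_all add: z_def)
        then show ?thesis unfolding z_def[symmetric] by simp
      qed
      finally show ?thesis .
    next
      case False
      have "s ^ 3 \<le> (2 ^ Suc J) ^ 3" using that assms by (intro power_mono) auto
      also have "(2 ^ Suc J) ^ 3 = (8::real) ^ Suc J" by (rule two_power_cubed)
      finally have "s * s ^ 3 \<le> s * 8 ^ Suc J" using assms by (intro mult_left_mono) auto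
      then have "s ^ 4 / 8 ^ Suc J \<le> s"
        by (simp add: divide_le_eq power4_eq_xxxx power3_eq_cube mult.assoc)
      moreover have "dyadic_resolvent_sum (Suc J) s \<le> 2 * s" using S1 False by simp
      ultimately show ?thesis by linarith
    qed
    with S1 show ?case by blast
  qed
  then show ?thesis
  proof (elim conjE)
    assume a: "dyadic_resolvent_sum J s \<le> 2 ^ J - 1"
      and b: "s < 2 ^ J \<longrightarrow> dyadic_resolvent_sum J s \<le> 4 * s - 2 * (s ^ 4 / 8 ^ J)"
    show ?thesis
    proof (cases "s < 2 ^ J")
      case True
      moreover have "0 \<le> s ^ 4 / 8 ^ J" using s by simp
      ultimately show ?thesis using b by linarith
    next
      case False
      then show ?thesis using a assms by linarith
    qed
  qed
qed

text \<open>The term with \<open>2\<^sup>j \<le> s < 2\<^bsup>j+1\<^esup>\<close> alone is at least \<open>s / 4\<close>.  When \<open>s\<close> lies beyond the range of the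
  finite sum, the remainder takes over.\<close>
lemma dyadic_resolvent_sum_lower:
  fixes s :: real
  assumes "1 \<le> s"
  shows "s \<le> 4 * dyadic_resolvent_sum J s + s ^ 4 / 8 ^ J"
proof -
  have s: "0 < s ^ 4" using assms by simp
  have nn: "0 \<le> 2 ^ j * (s ^ 4 / (16 ^ j + s ^ 4))" for j :: nat
    using s by (intro mult_nonneg_nonneg divide_nonneg_nonneg) auto
  have *: "s \<le> 4 * dyadic_resolvent_sum J s" if "s < 2 ^ J"
    using that
  proof (induction J)
    case 0
    then show ?case using assms by simp
  next
    case (Suc J)
    show ?case
    proof (cases "s < 2 ^ J")
      case True
      from Suc.IH[OF this] nn[of J] show ?thesis
        unfolding sum.lessThan_Suc distrib_left by linarith
    next
      case False
      then have "(2 ^ J) ^ 4 \<le> s ^ 4" by (intro power_mono) auto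
      also have "(2 ^ J) ^ 4 = (16::real) ^ J" by (rule two_power_fourth)
      finally have "1 / 2 \<le> s ^ 4 / (16 ^ J + s ^ 4)"
        using s by (simp add: le_divide_eq add_pos_pos)
      then have "2 ^ J * (1 / 2) \<le> 2 ^ J * (s ^ 4 / (16 ^ J + s ^ 4))"
        by (intro mult_left_mono) auto
      moreover have "0 \<le> dyadic_resolvent_sum J s"
        by (intro sum_nonneg nn)
      ultimately show ?thesis using Suc.prems by simp
    qed
  qed
  show ?thesis
  proof (cases "s < 2 ^ J")
    case True
    moreover have "0 \<le> s ^ 4 / 8 ^ J" using s by simp
    ultimately show ?thesis using * by linarith
  next
    case False
    then have "(2 ^ J) ^ 3 \<le> s ^ 3" by (intro power_mono) auto
    also have "(2 ^ J) ^ 3 = (8::real) ^ J" by (rule two_power_cubed)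
    finally have "s * 8 ^ J \<le> s * s ^ 3" using assms by (intro mult_left_mono) auto
    then have "s \<le> s ^ 4 / 8 ^ J"
      by (simp add: le_divide_eq power4_eq_xxxx power3_eq_cube mult.assoc)
    moreover have "0 \<le> dyadic_resolvent_sum J s"
      by (intro sum_nonneg nn)
    ultimately show ?thesis by linarith
  qed
qed

text \<open>The resolvent comparison summed over the scales \<open>l = 16\<^sup>j\<close>: it passes from the operators to
  their fourth roots, that is, interpolates between Parseval's identity and the bound with the weight
  \<open>1 + x\<^sup>2\<close>.  Only finitely many scales enter at a time; the remainder \<open>8\<^bsup>-J\<^esup> (1 + x\<^sup>2)\<close> is integrable
  against \<open>q\<^sup>2\<close> and disappears as \<open>J\<close> grows.\<close>
lemma hermite_sum_weighted:
  fixes b :: "nat \<Rightarrow> real"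
  assumes K: "finite K"
  defines "q \<equiv> \<lambda>x. \<Sum>k\<in>K. b k * \<psi> k x"
  shows "integrable lebesgue (\<lambda>x. (1 + x\<^sup>2) powr (1/4) * (q x)\<^sup>2)"
    and "(\<integral>x. (1 + x\<^sup>2) powr (1/4) * (q x)\<^sup>2 \<partial>lebesgue)
      \<le> 16 * (\<Sum>k\<in>K. (2 * real k + 2) powr (1/4) * (b k)\<^sup>2)"
proof -
  define y where "y k = 2 * real k + 2" for k
  have root4: "(z powr (1/4)) ^ 4 = z" "1 \<le> z powr (1/4)" if "1 \<le> z" for z :: real
    using that by (auto simp: powr_power ge_one_powr_ge_zero)
  have i1: "integrable lebesgue (\<lambda>x. (1 + x\<^sup>2) * (q x)\<^sup>2)"
    unfolding q_def by (rule hermite_sum_weight_id[OF K])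
  have i2: "integrable lebesgue (\<lambda>x. (1 + x\<^sup>2) / (l + (1 + x\<^sup>2)) * (q x)\<^sup>2)" if "0 < l" for l
    unfolding q_def by (rule hermite_sum_resolvent[OF K that])
  have p1: "1 \<le> 1 + x\<^sup>2" for x :: real by simp
  show int: "integrable lebesgue (\<lambda>x. (1 + x\<^sup>2) powr (1/4) * (q x)\<^sup>2)"
  proof (rule Bochner_Integration.integrable_bound[OF i1])
    show "AE x in lebesgue. norm ((1 + x\<^sup>2) powr (1/4) * (q x)\<^sup>2) \<le> norm ((1 + x\<^sup>2) * (q x)\<^sup>2)"
    proof (rule AE_I2)
      fix x :: real
      have "(1 + x\<^sup>2) powr (1/4) \<le> (1 + x\<^sup>2) powr 1" by (intro powr_mono) auto
      then have "(1 + x\<^sup>2) powr (1/4) \<le> 1 + x\<^sup>2" by simp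
      then show "norm ((1 + x\<^sup>2) powr (1/4) * (q x)\<^sup>2) \<le> norm ((1 + x\<^sup>2) * (q x)\<^sup>2)"
        by (simp add: abs_mult mult_right_mono)
    qed
  qed (simp add: q_def measurable_completion)
  define D where "D = (\<Sum>k\<in>K. y k * (b k)\<^sup>2)"
  have J: "(\<integral>x. (1 + x\<^sup>2) powr (1/4) * (q x)\<^sup>2 \<partial>lebesgue)
      \<le> 16 * (\<Sum>k\<in>K. y k powr (1/4) * (b k)\<^sup>2) + D * (1/8) ^ J" for J :: nat
  proof -
    define R where "R j x = (1 + x\<^sup>2) / (16 ^ j + (1 + x\<^sup>2)) * (q x)\<^sup>2" for j :: nat and x :: real
    have R: "integrable lebesgue (R j)" for j unfolding R_def[abs_def] by (rule i2) simp
    define T where "T x = (\<Sum>j<J. 4 * 2 ^ j * R j x) + (1/8) ^ J * ((1 + x\<^sup>2) * (q x)\<^sup>2)" for x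
    have T: "integrable lebesgue T"
      unfolding T_def[abs_def]
      by (intro Bochner_Integration.integrable_add Bochner_Integration.integrable_sum
          integrable_mult_right R i1)
    have "(\<integral>x. (1 + x\<^sup>2) powr (1/4) * (q x)\<^sup>2 \<partial>lebesgue) \<le> (\<integral>x. T x \<partial>lebesgue)"
    proof (rule integral_mono[OF int T])
      fix x :: real
      have "(1 + x\<^sup>2) powr (1/4) \<le> 4 * (\<Sum>j<J. 2 ^ j * ((1 + x\<^sup>2) / (16 ^ j + (1 + x\<^sup>2))))
          + (1 + x\<^sup>2) / 8 ^ J"
        using dyadic_resolvent_sum_lower[OF root4(2)[OF p1], of x J] by (simp only: root4(1)[OF p1])
      then have "(1 + x\<^sup>2) powr (1/4) * (q x)\<^sup>2
          \<le> (4 * (\<Sum>j<J. 2 ^ j * ((1 + x\<^sup>2) / (16 ^ j + (1 + x\<^sup>2)))) + (1 + x\<^sup>2) / 8 ^ J) * (q x)\<^sup>2"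
        by (rule mult_right_mono) simp
      also have "\<dots> = T x"
        unfolding T_def R_def
        by (simp add: distrib_right sum_distrib_left sum_distrib_right power_one_over mult.assoc)
      finally show "(1 + x\<^sup>2) powr (1/4) * (q x)\<^sup>2 \<le> T x" .
    qed
    also have "\<dots> = (\<Sum>j<J. 4 * 2 ^ j * (\<integral>x. R j x \<partial>lebesgue))
        + (1/8) ^ J * (\<integral>x. (1 + x\<^sup>2) * (q x)\<^sup>2 \<partial>lebesgue)"
      unfolding T_def using R i1 by (subst Bochner_Integration.integral_add) auto
    also have "\<dots> \<le> (\<Sum>j<J. 4 * 2 ^ j * (\<Sum>k\<in>K. y k / (16 ^ j + y k) * (b k)\<^sup>2)) + (1/8) ^ J * D"
      unfolding R_def D_def y_def q_def
      by (intro add_mono sum_mono mult_left_mono hermite_sum_resolvent(1)[OF K]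
          hermite_sum_weight_id(2)[OF K]) auto
    also have "(\<Sum>j<J. 4 * 2 ^ j * (\<Sum>k\<in>K. y k / (16 ^ j + y k) * (b k)\<^sup>2))
        = (\<Sum>k\<in>K. 4 * (\<Sum>j<J. 2 ^ j * (y k / (16 ^ j + y k))) * (b k)\<^sup>2)"
      unfolding sum_distrib_left sum_distrib_right by (subst sum.swap) (simp add: mult.assoc)
    also have "\<dots> \<le> (\<Sum>k\<in>K. 16 * (y k powr (1/4) * (b k)\<^sup>2))"
    proof (rule sum_mono)
      fix k
      have y1: "1 \<le> y k" by (simp add: y_def)
      have "(\<Sum>j<J. 2 ^ j * (y k / (16 ^ j + y k))) \<le> 4 * y k powr (1/4)"
        using dyadic_resolvent_sum_upper[OF root4(2)[OF y1], of J] by (simp only: root4(1)[OF y1])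
      then show "4 * (\<Sum>j<J. 2 ^ j * (y k / (16 ^ j + y k))) * (b k)\<^sup>2 \<le> 16 * (y k powr (1/4) * (b k)\<^sup>2)"
        unfolding mult.assoc[symmetric] by (intro mult_right_mono) auto
    qed
    finally show ?thesis by (simp add: sum_distrib_left mult.commute)
  qed
  have "(\<lambda>J. 16 * (\<Sum>k\<in>K. y k powr (1/4) * (b k)\<^sup>2) + D * (1/8) ^ J)
      \<longlonglongrightarrow> 16 * (\<Sum>k\<in>K. y k powr (1/4) * (b k)\<^sup>2) + D * 0"
    by (intro tendsto_intros LIMSEQ_power_zero) simp
  from LIMSEQ_le_const[OF this] J
  show "(\<integral>x. (1 + x\<^sup>2) powr (1/4) * (q x)\<^sup>2 \<partial>lebesgue)
      \<le> 16 * (\<Sum>k\<in>K. (2 * real k + 2) powr (1/4) * (b k)\<^sup>2)"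
    unfolding y_def by auto
qed

section \<open>Pointwise size of the Hermite functions and size of the coefficients\<close>

text \<open>At the origin the recurrence links only indices of equal parity,
  \<open>\<psi>\<^bsub>m+2\<^esub>(0)\<^sup>2 = (m + 1) / (m + 2) \<psi>\<^sub>m(0)\<^sup>2\<close>, and the claimed bound survives a step because
  \<open>(m + 1)(m + 3) \<le> (m + 2)\<^sup>2\<close>.\<close>
lemma hermite_function_at_0: "(\<psi> n 0)\<^sup>2 \<le> 1 / sqrt (real n + 1)"
proof (induction n rule: less_induct)
  case (less n)
  consider "n = 0" | "n = 1" | m where "n = Suc (Suc m)" by (metis One_nat_def old.nat.exhaust)
  then show ?case
  proof cases
    case 1
    have "1 \<le> sqrt pi" using pi_ge_two by simp
    then show ?thesis by (simp add: 1 hermite_function_eq power_divide)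
  next
    case 2
    then show ?thesis using hermite_function_Suc[of 0 0] by simp
  next
    case (3 m)
    define N where "N = real m + 1"
    have N: "0 < N" by (simp add: N_def)
    have "(sqrt (2 * real (Suc (Suc m))) * \<psi> n 0)\<^sup>2
        = (sqrt (2 * real (Suc m)) * \<psi> m 0)\<^sup>2"
      using hermite_function_Suc[of "Suc m" 0] unfolding 3 by simp
    then have "2 * (N + 1) * (\<psi> n 0)\<^sup>2 = 2 * N * (\<psi> m 0)\<^sup>2"
      by (simp add: power_mult_distrib N_def algebra_simps)
    also have "\<dots> \<le> 2 * N * (1 / sqrt N)"
      using less.IH[of m] 3 N by (intro mult_left_mono) (auto simp: N_def)
    also have "\<dots> = 2 * sqrt N" using N by (simp add: divide_eq_eq)
    also have "\<dots> \<le> 2 * ((N + 1) * (1 / sqrt (N + 2)))"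
    proof -
      have "sqrt N * sqrt (N + 2) = sqrt (N * (N + 2))" by (simp add: real_sqrt_mult)
      also have "\<dots> \<le> sqrt ((N + 1)\<^sup>2)"
        by (intro real_sqrt_le_mono) (simp add: power2_eq_square algebra_simps)
      finally show ?thesis using N by (simp add: le_divide_eq)
    qed
    finally have "(N + 1) * (\<psi> n 0)\<^sup>2 \<le> (N + 1) * (1 / sqrt (N + 2))"
      unfolding mult.assoc by (rule mult_left_le_imp_le) simp
    then have "(\<psi> n 0)\<^sup>2 \<le> 1 / sqrt (N + 2)"
      using N by (subst (asm) mult_le_cancel_left_pos) auto
    then show ?thesis using 3 by (simp add: N_def algebra_simps)
  qed
qed

text \<open>The function \<open>\<psi>\<^sub>k\<close> solves \<open>\<psi>'' = (x\<^sup>2 - (2k + 1)) \<psi>\<close>, so its energy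
  \<open>E = \<psi>'\<^sup>2 + (2k + 1 - x\<^sup>2) \<psi>\<^sup>2\<close> has the derivative \<open>-2 x \<psi>\<^sup>2\<close> and is largest at the origin, where the
  values of \<open>\<psi>\<^sub>k\<close> and \<open>\<psi>\<^sub>k'\<close> are under control.\<close>
lemma hermite_function_energy:
  "(2 * real k + 1 - x\<^sup>2) * (\<psi> k x)\<^sup>2 \<le> 4 * sqrt (real k + 1)"
proof -
  define s where "s = sqrt (2 * real (Suc k))"
  have s2: "s * s = 2 * real k + 2" by (simp add: s_def)
  define D where "D x = x * \<psi> k x - s * \<psi> (Suc k) x" for x
  have dk: "(\<psi> k has_real_derivative D x) (at x)" for x
    unfolding D_def s_def by (rule hermite_function_DERIV)
  have dS: "(\<psi> (Suc k) has_real_derivative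
      s * \<psi> k x - x * \<psi> (Suc k) x) (at x)" for x
    using hermite_function_DERIV[of "Suc k" x] hermite_function_Suc[of "Suc k" x]
    by (simp add: s_def)
  have dD: "(D has_real_derivative (x\<^sup>2 - (2 * real k + 1)) * \<psi> k x) (at x)" for x
  proof -
    have "(D has_real_derivative 1 * \<psi> k x + D x * x
        - s * (s * \<psi> k x - x * \<psi> (Suc k) x)) (at x)"
      unfolding D_def[abs_def]
      by (intro DERIV_diff DERIV_cmult dS DERIV_mult DERIV_ident dk[unfolded D_def])
    moreover have "1 * \<psi> k x + D x * x
        - s * (s * \<psi> k x - x * \<psi> (Suc k) x)
        = (x\<^sup>2 - (2 * real k + 1)) * \<psi> k x"
    proof -
      have "1 * \<psi> k x + D x * x
          - s * (s * \<psi> k x - x * \<psi> (Suc k) x)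
          = (x\<^sup>2 + 1 - s * s) * \<psi> k x"
        by (simp add: D_def power2_eq_square algebra_simps)
      also have "x\<^sup>2 + 1 - s * s = x\<^sup>2 - (2 * real k + 1)" using s2 by simp
      finally show ?thesis .
    qed
    ultimately show ?thesis by (rule DERIV_cong)
  qed
  define E where "E x = (D x)\<^sup>2 + (2 * real k + 1 - x\<^sup>2) * (\<psi> k x)\<^sup>2" for x
  have dE: "(E has_real_derivative - 2 * x * (\<psi> k x)\<^sup>2) (at x)" for x
    unfolding E_def[abs_def]
    by (auto intro!: derivative_eq_intros dk dD) (simp add: power2_eq_square algebra_simps)
  have "E x \<le> E 0"
  proof (cases "0 \<le> x")
    case True
    show ?thesis
      by (rule DERIV_nonpos_imp_nonincreasing[OF True]) (use dE in \<open>force simp: mult_nonneg_nonneg\<close>)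
  next
    case False
    then have "x \<le> 0" by simp
    then show ?thesis
    proof (rule DERIV_nonneg_imp_nondecreasing)
      fix y assume "x \<le> y" "y \<le> 0"
      then have "y * (\<psi> k y)\<^sup>2 \<le> 0" by (intro mult_nonpos_nonneg) auto
      then have "0 \<le> - 2 * y * (\<psi> k y)\<^sup>2" by linarith
      then show "\<exists>z. (E has_real_derivative z) (at y) \<and> 0 \<le> z" using dE by blast
    qed
  qed
  also have "E 0 = (2 * real k + 2) * (\<psi> (Suc k) 0)\<^sup>2
      + (2 * real k + 1) * (\<psi> k 0)\<^sup>2"
    by (simp add: E_def D_def power_mult_distrib s2[symmetric] power2_eq_square)
  also have "\<dots> \<le> (2 * real k + 2) * (1 / sqrt (real k + 1)) + (2 * real k + 2) * (1 / sqrt (real k + 1))"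
  proof (intro add_mono mult_mono)
    have "1 / sqrt (real (Suc k) + 1) \<le> 1 / sqrt (real k + 1)"
      by (intro divide_left_mono mult_pos_pos) auto
    then show "(\<psi> (Suc k) 0)\<^sup>2 \<le> 1 / sqrt (real k + 1)"
      using hermite_function_at_0[of "Suc k"] by linarith
  qed (use hermite_function_at_0[of k] in auto)
  also have "\<dots> = 4 * ((real k + 1) / sqrt (real k + 1))" by (simp add: field_simps)
  also have "\<dots> = 4 * sqrt (real k + 1)" by (simp add: real_div_sqrt)
  finally show ?thesis
    unfolding E_def using zero_le_power2[of "D x"] by linarith
qed

lemma hermite_function_sup: "(\<psi> k x)\<^sup>2 \<le> 3 * sqrt (real k + 1)"
proof -
  have 1: "(\<Sum>j<Suc k. (if j = k then 1 else 0) * \<psi> j x) = \<psi> k x"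
    by (simp add: if_distrib[of "\<lambda>c. c * _"] cong: if_cong)
  have 2: "(\<Sum>j<Suc k. (if j = k then 1 else 0)\<^sup>2) = (1::real)"
    by (simp add: if_distrib[of "\<lambda>c. c\<^sup>2"] cong: if_cong)
  have "(\<psi> k x)\<^sup>2 \<le> 2 * sqrt (2 * real (Suc k)) * 1"
    using hermite_sum_sup[of "Suc k" "\<lambda>j. if j = k then 1 else 0" x] unfolding 1 2 by simp
  also have "2 * sqrt (2 * real (Suc k)) * 1 = sqrt 8 * sqrt (real k + 1)"
  proof -
    have "sqrt (2 * real (Suc k)) = sqrt 2 * sqrt (real k + 1)"
      by (simp only: real_sqrt_mult of_nat_Suc add.commute)
    moreover have "sqrt 8 = 2 * sqrt 2" using real_sqrt_mult[of 4 2] by simp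
    ultimately show ?thesis by (simp only: mult_1_right mult.assoc)
  qed
  also have "\<dots> \<le> 3 * sqrt (real k + 1)"
    by (intro mult_right_mono real_le_lsqrt) auto
  finally show ?thesis .
qed

text \<open>Once \<open>k\<close> is large compared with \<open>t\<^sup>2\<close> the energy bound applies; each of the finitely many remaining
  indices satisfies \<open>3k + 1 < 2 t\<^sup>2\<close>, so the crude supremum bound is absorbed by the constant.\<close>
lemma hermite_function_pointwise_decay:
  "(\<psi> k t)\<^sup>2 \<le> (8 + 2 * t\<^sup>2) / sqrt (real k + 1)"
proof -
  define r where "r = sqrt (real k + 1)"
  have r: "0 < r" "r * r = real k + 1" by (auto simp: r_def)
  have "r * (\<psi> k t)\<^sup>2 \<le> 8 + 2 * t\<^sup>2"
  proof (cases "2 * t\<^sup>2 \<le> 3 * real k + 1")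
    case True
    have "r * (r * (\<psi> k t)\<^sup>2) = (real k + 1) * (\<psi> k t)\<^sup>2"
      using r(2) by (simp add: mult.assoc[symmetric])
    also have "\<dots> \<le> 2 * ((2 * real k + 1 - t\<^sup>2) * (\<psi> k t)\<^sup>2)"
      unfolding mult.assoc[symmetric] using True by (intro mult_right_mono) auto
    also have "\<dots> \<le> 2 * (4 * r)"
      using hermite_function_energy[of k t] unfolding r_def by (intro mult_left_mono) auto
    finally have "r * (r * (\<psi> k t)\<^sup>2) \<le> r * 8" by simp
    then have "r * (\<psi> k t)\<^sup>2 \<le> 8" using r(1) by simp
    then show ?thesis using zero_le_power2[of t] by linarith
  next
    case False
    have "r * (\<psi> k t)\<^sup>2 \<le> r * (3 * r)"
      using hermite_function_sup[of k t] r(1) by (intro mult_left_mono) (auto simp: r_def)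
    also have "\<dots> = 3 * (real k + 1)" using r(2) by simp
    finally show ?thesis using False by simp
  qed
  then show ?thesis using r(1) by (simp add: le_divide_eq r_def mult.commute)
qed

lemma integrable_mult_hermite:
  fixes g :: "real \<Rightarrow> real"
  assumes "integrable lebesgue g"
  shows "integrable lebesgue (\<lambda>x. g x * \<psi> k x)"
proof -
  define C where "C = sqrt (3 * sqrt (real k + 1))"
  have C: "\<bar>\<psi> k x\<bar> \<le> C" for x
    using real_sqrt_le_mono[OF hermite_function_sup[of k x]] by (simp add: C_def)
  have "integrable lebesgue (\<lambda>x. C * \<bar>g x\<bar>)" using assms by simp
  then show ?thesis
  proof (rule Bochner_Integration.integrable_bound)
    show "AE x in lebesgue. norm (g x * \<psi> k x) \<le> norm (C * \<bar>g x\<bar>)"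
    proof (rule AE_I2)
      fix x
      have "\<bar>g x\<bar> * \<bar>\<psi> k x\<bar> \<le> \<bar>g x\<bar> * C" by (intro mult_left_mono C) auto
      moreover have "0 \<le> C" using C[of 0] by linarith
      ultimately show "norm (g x * \<psi> k x) \<le> norm (C * \<bar>g x\<bar>)"
        by (simp add: abs_mult mult.commute)
    qed
  qed (use borel_measurable_integrable[OF assms] in simp)
qed

lemma integrable_mult_hermite_square:
  fixes f :: "real \<Rightarrow> real"
  assumes [measurable]: "f \<in> borel_measurable lebesgue" and "integrable lebesgue (\<lambda>x. (f x)\<^sup>2)"
  shows "integrable lebesgue (\<lambda>x. f x * \<psi> k x)"
proof -
  have "integrable lebesgue (\<lambda>x. (f x)\<^sup>2 + \<psi> k x * \<psi> k x)"
    using assms integrable_hermite_prod by auto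
  then show ?thesis
  proof (rule Bochner_Integration.integrable_bound)
    show "AE x in lebesgue. norm (f x * \<psi> k x)
        \<le> norm ((f x)\<^sup>2 + \<psi> k x * \<psi> k x)"
    proof (rule AE_I2)
      fix x
      have "0 \<le> (\<bar>f x\<bar> - \<bar>\<psi> k x\<bar>)\<^sup>2" by simp
      then have "2 * (\<bar>f x\<bar> * \<bar>\<psi> k x\<bar>) \<le> (f x)\<^sup>2 + (\<psi> k x)\<^sup>2"
        by (simp add: power2_diff)
      moreover have "0 \<le> \<bar>f x\<bar> * \<bar>\<psi> k x\<bar>" by simp
      ultimately have "\<bar>f x\<bar> * \<bar>\<psi> k x\<bar> \<le> (f x)\<^sup>2 + (\<psi> k x)\<^sup>2"
        by linarith
      then show "norm (f x * \<psi> k x)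
        \<le> norm ((f x)\<^sup>2 + \<psi> k x * \<psi> k x)"
        by (simp add: abs_mult power2_eq_square)
    qed
  qed simp
qed

abbreviation (input) hermite_coeff :: "(real \<Rightarrow> real) \<Rightarrow> nat \<Rightarrow> real" where
  "hermite_coeff f k \<equiv> \<integral>x. f x * \<psi> k x \<partial>lebesgue"

lemma hermite_Bessel:
  fixes f :: "real \<Rightarrow> real"
  assumes "f \<in> borel_measurable lebesgue" and f2: "integrable lebesgue (\<lambda>x. (f x)\<^sup>2)"
  shows "(\<Sum>k<n. (hermite_coeff f k)\<^sup>2) \<le> (\<integral>x. (f x)\<^sup>2 \<partial>lebesgue)"
proof -
  note i = integrable_mult_hermite_square[OF assms]
  define a where "a k = hermite_coeff f k" for k
  define q where "q x = (\<Sum>k<n. a k * \<psi> k x)" for x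
  have q: "integrable lebesgue (\<lambda>x. (q x)\<^sup>2)" "(\<integral>x. (q x)\<^sup>2 \<partial>lebesgue) = (\<Sum>k<n. (a k)\<^sup>2)"
    unfolding q_def by (rule hermite_sum_square[where j = "\<lambda>k. k"]; simp)+
  have fq: "f x * q x = (\<Sum>k<n. a k * (f x * \<psi> k x))" for x
    by (simp add: q_def sum_distrib_left mult.left_commute)
  have ifq: "integrable lebesgue (\<lambda>x. f x * q x)"
    unfolding fq by (intro Bochner_Integration.integrable_sum integrable_mult_right i)
  have "(\<integral>x. f x * q x \<partial>lebesgue) = (\<Sum>k<n. (a k)\<^sup>2)"
    unfolding fq using i by (simp add: a_def power2_eq_square)
  then have "(\<Sum>k<n. (a k)\<^sup>2) = (\<integral>x. 2 * (f x * q x) - (q x)\<^sup>2 \<partial>lebesgue)"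
    using ifq q by simp
  also have "\<dots> \<le> (\<integral>x. (f x)\<^sup>2 \<partial>lebesgue)"
  proof (rule integral_mono[OF _ f2])
    show "integrable lebesgue (\<lambda>x. 2 * (f x * q x) - (q x)\<^sup>2)" using ifq q by simp
    fix x
    have "0 \<le> (f x - q x)\<^sup>2" by simp
    then show "2 * (f x * q x) - (q x)\<^sup>2 \<le> (f x)\<^sup>2" by (simp add: power2_diff)
  qed
  finally show ?thesis by (simp add: a_def)
qed

text \<open>Dual to the supremum bound: with \<open>q = \<Sum> a\<^sub>k \<psi>\<^sub>k\<close> the sum \<open>B\<close> of the squared coefficients equals
  \<open>\<integral> g q \<le> \<parallel>g\<parallel>\<^sub>1 sup \<bar>q\<bar> \<le> \<parallel>g\<parallel>\<^sub>1 sqrt (2 sqrt (2n) B)\<close>.\<close>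
lemma hermite_coeffs_L1:
  fixes g :: "real \<Rightarrow> real"
  assumes g: "integrable lebesgue g"
  shows "(\<Sum>k<n. (hermite_coeff g k)\<^sup>2)
    \<le> 2 * sqrt (2 * real n) * (\<integral>x. \<bar>g x\<bar> \<partial>lebesgue)\<^sup>2"
proof (cases "n = 0")
  case False
  note i = integrable_mult_hermite[OF g]
  define a where "a k = hermite_coeff g k" for k
  define B where "B = (\<Sum>k<n. (a k)\<^sup>2)"
  define D where "D = 2 * sqrt (2 * real n)"
  define G where "G = (\<integral>x. \<bar>g x\<bar> \<partial>lebesgue)"
  define q where "q x = (\<Sum>k<n. a k * \<psi> k x)" for x
  have B: "0 \<le> B" by (simp add: B_def sum_nonneg)
  have D: "0 \<le> D" by (simp add: D_def)
  have sup: "\<bar>q x\<bar> \<le> sqrt (D * B)" for x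
    using real_sqrt_le_mono[OF hermite_sum_sup[of n a x]] False
    by (simp add: q_def B_def D_def)
  have gq: "g x * q x = (\<Sum>k<n. a k * (g x * \<psi> k x))" for x
    by (simp add: q_def sum_distrib_left mult.left_commute)
  have igq: "integrable lebesgue (\<lambda>x. g x * q x)"
    unfolding gq by (intro Bochner_Integration.integrable_sum integrable_mult_right i)
  have "(\<integral>x. g x * q x \<partial>lebesgue) = B"
    unfolding gq using i by (simp add: a_def B_def power2_eq_square)
  moreover have "(\<integral>x. g x * q x \<partial>lebesgue) \<le> (\<integral>x. \<bar>g x\<bar> * sqrt (D * B) \<partial>lebesgue)"
  proof (rule integral_mono[OF igq])
    show "integrable lebesgue (\<lambda>x. \<bar>g x\<bar> * sqrt (D * B))" using g by simp
    fix x
    have "g x * q x \<le> \<bar>g x\<bar> * \<bar>q x\<bar>" by (metis abs_ge_self abs_mult)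
    also have "\<dots> \<le> \<bar>g x\<bar> * sqrt (D * B)" by (intro mult_left_mono sup) auto
    finally show "g x * q x \<le> \<bar>g x\<bar> * sqrt (D * B)" .
  qed
  ultimately have "B \<le> G * sqrt (D * B)" using g by (simp add: G_def)
  then have "B\<^sup>2 \<le> (G * sqrt (D * B))\<^sup>2" using B by (intro power_mono) auto
  then have "B * B \<le> B * (D * G\<^sup>2)" using B D
    by (simp add: power2_eq_square power_mult_distrib algebra_simps)
  then have "B \<le> D * G\<^sup>2" using B D
    by (cases "B = 0") auto
  then show ?thesis by (simp add: B_def a_def D_def G_def)
qed simp

text \<open>Cut \<open>f\<close> at the height \<open>h\<close>.  The low part is square integrable and obeys Bessel's inequality, the
  high part is integrable and obeys the \<open>L\<^sup>1\<close> bound; the two contributions are of the orders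
  \<open>h\<^bsup>2-\<gamma>\<^esup>\<close> and \<open>n\<^bsup>1/2\<^esup> h\<^bsup>2-2\<gamma>\<^esup>\<close>, which are equal for \<open>h = n\<^bsup>1/(2\<gamma>)\<^esup>\<close>.\<close>
lemma hermite_coeffs_growth:
  fixes f :: "real \<Rightarrow> real" and \<gamma> :: real
  assumes f: "f \<in> Lp_space lebesgue \<gamma>" and \<gamma>: "1 \<le> \<gamma>" "\<gamma> \<le> 2" and n: "0 < n"
  defines "F \<equiv> \<integral>x. \<bar>f x\<bar> powr \<gamma> \<partial>lebesgue"
  shows "(\<Sum>k<n. (hermite_coeff f k)\<^sup>2)
    \<le> (2 * F + 8 * F\<^sup>2) * real n powr (1 / \<gamma> - 1 / 2)"
proof -
  define h where "h = real n powr (1 / (2 * \<gamma>))"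
  have h: "1 \<le> h" using n \<gamma> by (simp add: h_def ge_one_powr_ge_zero)
  define lo where "lo x = (if \<bar>f x\<bar> \<le> h then f x else 0)" for x
  define hi where "hi x = (if \<bar>f x\<bar> \<le> h then 0 else f x)" for x
  note [measurable] = Lp_spaceD(1)[OF f]
  note fi = Lp_spaceD(2)[OF f]
  have [measurable]: "lo \<in> borel_measurable lebesgue" "hi \<in> borel_measurable lebesgue"
    unfolding lo_def[abs_def] hi_def[abs_def] by measurable
  have lo_le: "(lo x)\<^sup>2 \<le> h powr (2 - \<gamma>) * \<bar>f x\<bar> powr \<gamma>" for x
  proof (cases "\<bar>f x\<bar> \<le> h \<and> f x \<noteq> 0")
    case True
    have "(lo x)\<^sup>2 = \<bar>f x\<bar> powr 2" using True by (simp add: lo_def powr_numeral)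
    also have "\<dots> = \<bar>f x\<bar> powr (2 - \<gamma>) * \<bar>f x\<bar> powr \<gamma>" by (simp add: powr_add[symmetric])
    also have "\<dots> \<le> h powr (2 - \<gamma>) * \<bar>f x\<bar> powr \<gamma>"
      using True \<gamma> by (intro mult_right_mono powr_mono2) auto
    finally show ?thesis .
  qed (auto simp: lo_def)
  have hi_le: "\<bar>hi x\<bar> \<le> h powr (1 - \<gamma>) * \<bar>f x\<bar> powr \<gamma>" for x
  proof (cases "\<bar>f x\<bar> \<le> h")
    case False
    then have "\<bar>hi x\<bar> = \<bar>f x\<bar> powr 1" using h by (simp add: hi_def)
    also have "\<dots> = \<bar>f x\<bar> powr (1 - \<gamma>) * \<bar>f x\<bar> powr \<gamma>" by (simp only: powr_add[symmetric]) simp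
    also have "\<dots> \<le> h powr (1 - \<gamma>) * \<bar>f x\<bar> powr \<gamma>"
      using False \<gamma> h by (intro mult_right_mono powr_mono2') auto
    finally show ?thesis .
  qed (simp add: hi_def)
  have lo_int: "integrable lebesgue (\<lambda>x. (lo x)\<^sup>2)"
    by (rule Bochner_Integration.integrable_bound[OF integrable_mult_right[OF fi, of "h powr (2 - \<gamma>)"]])
      (use lo_le in auto)
  have hi_int: "integrable lebesgue hi"
    by (rule Bochner_Integration.integrable_bound[OF integrable_mult_right[OF fi, of "h powr (1 - \<gamma>)"]])
      (use hi_le in auto)
  have "(\<integral>x. (lo x)\<^sup>2 \<partial>lebesgue) \<le> (\<integral>x. h powr (2 - \<gamma>) * \<bar>f x\<bar> powr \<gamma> \<partial>lebesgue)"
    by (rule integral_mono[OF lo_int _ lo_le]) (use fi in simp)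
  then have lo_F: "(\<integral>x. (lo x)\<^sup>2 \<partial>lebesgue) \<le> h powr (2 - \<gamma>) * F" by (simp add: F_def)
  have "(\<integral>x. \<bar>hi x\<bar> \<partial>lebesgue) \<le> (\<integral>x. h powr (1 - \<gamma>) * \<bar>f x\<bar> powr \<gamma> \<partial>lebesgue)"
    by (rule integral_mono[OF _ _ hi_le]) (use fi hi_int in simp_all)
  then have hi_F: "(\<integral>x. \<bar>hi x\<bar> \<partial>lebesgue) \<le> h powr (1 - \<gamma>) * F" by (simp add: F_def)
  have split: "(hermite_coeff f k)\<^sup>2
      \<le> 2 * (hermite_coeff lo k)\<^sup>2
        + 2 * (hermite_coeff hi k)\<^sup>2" for k
  proof -
    have "f x * \<psi> k x = lo x * \<psi> k x + hi x * \<psi> k x" for x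
      by (simp add: lo_def hi_def)
    then have eq: "hermite_coeff f k
        = hermite_coeff lo k + hermite_coeff hi k"
      using integrable_mult_hermite_square[OF _ lo_int, of k] integrable_mult_hermite[OF hi_int, of k]
      by simp
    have "0 \<le> (hermite_coeff lo k - hermite_coeff hi k)\<^sup>2"
      by simp
    then show ?thesis unfolding eq by (simp add: power2_diff power2_sum)
  qed
  have e1: "h powr (2 - \<gamma>) = real n powr (1 / \<gamma> - 1 / 2)"
  proof -
    have "1 / (2 * \<gamma>) * (2 - \<gamma>) = 1 / \<gamma> - 1 / 2" using \<gamma> by (simp add: field_simps)
    then show ?thesis by (simp add: h_def powr_powr)
  qed
  have e2: "sqrt (real n) * (h powr (1 - \<gamma>))\<^sup>2 = real n powr (1 / \<gamma> - 1 / 2)"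
  proof -
    have "1 / 2 + (1 / (2 * \<gamma>) * (1 - \<gamma>) + 1 / (2 * \<gamma>) * (1 - \<gamma>)) = 1 / \<gamma> - 1 / 2"
      using \<gamma> by (simp add: field_simps)
    moreover have "sqrt (real n) * (h powr (1 - \<gamma>))\<^sup>2
        = real n powr (1 / 2 + (1 / (2 * \<gamma>) * (1 - \<gamma>) + 1 / (2 * \<gamma>) * (1 - \<gamma>)))"
      using n by (simp only: h_def powr_powr power2_eq_square powr_add powr_half_sqrt of_nat_0_le_iff)
    ultimately show ?thesis by (simp only:)
  qed
  have F: "0 \<le> F" by (simp add: F_def)
  have "(\<Sum>k<n. (hermite_coeff f k)\<^sup>2)
      \<le> 2 * (\<Sum>k<n. (hermite_coeff lo k)\<^sup>2)
        + 2 * (\<Sum>k<n. (hermite_coeff hi k)\<^sup>2)"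
    unfolding sum_distrib_left sum.distrib[symmetric] by (rule sum_mono[OF split])
  also have "\<dots> \<le> 2 * (h powr (2 - \<gamma>) * F) + 2 * (2 * sqrt (2 * real n) * (h powr (1 - \<gamma>) * F)\<^sup>2)"
  proof (intro add_mono mult_left_mono)
    show "(\<Sum>k<n. (hermite_coeff lo k)\<^sup>2) \<le> h powr (2 - \<gamma>) * F"
      using hermite_Bessel[OF _ lo_int, of n] lo_F by simp
    have "(\<Sum>k<n. (hermite_coeff hi k)\<^sup>2)
        \<le> 2 * sqrt (2 * real n) * (\<integral>x. \<bar>hi x\<bar> \<partial>lebesgue)\<^sup>2"
      by (rule hermite_coeffs_L1[OF hi_int])
    also have "\<dots> \<le> 2 * sqrt (2 * real n) * (h powr (1 - \<gamma>) * F)\<^sup>2"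
      using hi_F by (intro mult_left_mono power_mono) auto
    finally show "(\<Sum>k<n. (hermite_coeff hi k)\<^sup>2) \<le> \<dots>" .
  qed auto
  also have "2 * (2 * sqrt (2 * real n) * (h powr (1 - \<gamma>) * F)\<^sup>2)
      = 4 * sqrt 2 * F\<^sup>2 * (sqrt (real n) * (h powr (1 - \<gamma>))\<^sup>2)"
    by (simp add: real_sqrt_mult power_mult_distrib)
  also have "2 * (h powr (2 - \<gamma>) * F) + 4 * sqrt 2 * F\<^sup>2 * (sqrt (real n) * (h powr (1 - \<gamma>))\<^sup>2)
      = (2 * F + 4 * sqrt 2 * F\<^sup>2) * real n powr (1 / \<gamma> - 1 / 2)"
    unfolding e1 e2 by (simp add: algebra_simps)
  also have "\<dots> \<le> (2 * F + 8 * F\<^sup>2) * real n powr (1 / \<gamma> - 1 / 2)"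
  proof -
    have "sqrt 2 \<le> 2" by (rule real_le_lsqrt) auto
    then have "4 * sqrt 2 * F\<^sup>2 \<le> 8 * F\<^sup>2" by (intro mult_right_mono) auto
    then show ?thesis by (intro mult_right_mono) auto
  qed
  finally show ?thesis .
qed

text \<open>Over the dyadic block from \<open>2\<^sup>J\<close> to \<open>2\<^bsup>J+1\<^esup>\<close> the weighted sum is at most a constant times
  \<open>2\<^bsup>J(\<beta>-\<theta>)\<^esup>\<close>, a geometric series in \<open>J\<close>.\<close>
lemma summable_weighted_of_growth:
  fixes u :: "nat \<Rightarrow> real" and C \<beta> \<theta> :: real
  assumes u: "\<And>k. 0 \<le> u k" and growth: "\<And>n. 0 < n \<Longrightarrow> (\<Sum>k<n. u k) \<le> C * real n powr \<beta>"
    and "0 \<le> C" "0 \<le> \<theta>" "\<beta> < \<theta>"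
  shows "summable (\<lambda>k. u k * (real k + 1) powr (- \<theta>))"
proof -
  define w where "w k = u k * (real k + 1) powr (- \<theta>)" for k
  have w: "0 \<le> w k" for k by (simp add: w_def u)
  define r where "r = 2 powr (\<beta> - \<theta>)"
  have r: "0 < r" "r < 1"
    using assms(5) powr_less_mono[of "\<beta> - \<theta>" 0 2] by (auto simp: r_def)
  have dyadic: "(\<Sum>k<2 ^ J. w k) \<le> u 0 + C * 2 powr \<beta> * (\<Sum>j<J. r ^ j)" for J
  proof (induction J)
    case 0
    then show ?case by (simp add: w_def)
  next
    case (Suc J)
    have split: "{..<(2::nat) ^ Suc J} = {..<2 ^ J} \<union> {2 ^ J..<2 ^ Suc J}" by auto
    have "(\<Sum>k\<in>{2 ^ J..<2 ^ Suc J}. w k) \<le> (\<Sum>k\<in>{2 ^ J..<2 ^ Suc J}. u k * (2 ^ J) powr (- \<theta>))"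
      unfolding w_def
    proof (intro sum_mono mult_left_mono u)
      fix k assume "k \<in> {(2::nat) ^ J..<2 ^ Suc J}"
      then have "real (2 ^ J) \<le> real k" by (subst of_nat_le_iff) simp
      then have le: "2 ^ J \<le> real k + 1" unfolding of_nat_power of_nat_numeral by linarith
      then show "(real k + 1) powr (- \<theta>) \<le> (2 ^ J) powr (- \<theta>)"
        using assms(4) by (intro powr_mono2' le) auto
    qed
    also have "\<dots> \<le> (\<Sum>k<2 ^ Suc J. u k * (2 ^ J) powr (- \<theta>))"
      by (intro sum_mono2) (auto simp: u)
    also have "\<dots> = (\<Sum>k<2 ^ Suc J. u k) * (2 ^ J) powr (- \<theta>)"
      by (simp add: sum_distrib_right)
    also have "\<dots> \<le> C * real (2 ^ Suc J) powr \<beta> * (2 ^ J) powr (- \<theta>)"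
      by (intro mult_right_mono growth) auto
    also have "\<dots> = C * 2 powr \<beta> * r ^ J"
    proof -
      have "real (2 ^ Suc J) powr \<beta> = 2 powr \<beta> * (2 ^ J) powr \<beta>" by (simp add: powr_mult)
      moreover have "(2 ^ J) powr \<beta> * (2 ^ J) powr (- \<theta>) = r ^ J"
        by (simp add: r_def powr_add[symmetric] powr_powr powr_realpow[symmetric] algebra_simps)
      ultimately show ?thesis by (simp add: mult.assoc)
    qed
    finally have "(\<Sum>k\<in>{2 ^ J..<2 ^ Suc J}. w k) \<le> C * 2 powr \<beta> * r ^ J" .
    moreover have "(\<Sum>k<2 ^ Suc J. w k) = (\<Sum>k<2 ^ J. w k) + (\<Sum>k\<in>{2 ^ J..<2 ^ Suc J}. w k)"
      unfolding split by (rule sum.union_disjoint) auto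
    ultimately show ?case using Suc.IH by (simp add: distrib_left)
  qed
  have "(\<Sum>k<n. w k) \<le> u 0 + C * 2 powr \<beta> * (1 / (1 - r))" for n
  proof -
    have "n < 2 ^ n" by (rule less_exp)
    then have "(\<Sum>k<n. w k) \<le> (\<Sum>k<2 ^ n. w k)" by (intro sum_mono2) (auto simp: w)
    also have "\<dots> \<le> u 0 + C * 2 powr \<beta> * (\<Sum>j<n. r ^ j)" by (rule dyadic)
    also have "(\<Sum>j<n. r ^ j) \<le> (\<Sum>j. r ^ j)"
      using r by (intro sum_le_suminf summable_geometric) auto
    also have "(\<Sum>j. r ^ j) = 1 / (1 - r)" using r by (intro suminf_geometric) auto
    finally show ?thesis using assms(3) by (simp add: mult_left_mono)
  qed
  then have "summable w" by (rule summableI_nonneg_bounded[OF w])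
  then show ?thesis by (simp add: w_def[abs_def])
qed

text \<open>The factor \<open>\<psi>\<^sub>k(t)\<^sup>2\<close> is of the order \<open>k\<^bsup>-1/2\<^esup>\<close>, so the claim is that \<open>\<Sum> k\<^bsup>-1/4\<^esup> a\<^sub>k\<^sup>2\<close> converges.  The
  growth exponent \<open>1/\<gamma> - 1/2\<close> of the partial sums of \<open>a\<^sub>k\<^sup>2\<close> is below \<open>1/4\<close> exactly when \<open>\<gamma> > 4/3\<close>.\<close>
lemma summable_hermite_weights:
  fixes f :: "real \<Rightarrow> real" and \<gamma> t :: real
  assumes f: "f \<in> Lp_space lebesgue \<gamma>" and \<gamma>: "4 / 3 < \<gamma>" "\<gamma> \<le> 2"
  defines "a \<equiv> \<lambda>k. hermite_coeff f k"
  shows "summable (\<lambda>k. (2 * real k + 2) powr (1/4) * (a k * \<psi> k t)\<^sup>2)"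
proof -
  define F where "F = (\<integral>x. \<bar>f x\<bar> powr \<gamma> \<partial>lebesgue)"
  have F: "0 \<le> F" by (simp add: F_def)
  have "summable (\<lambda>k. (a k)\<^sup>2 * (real k + 1) powr (- (1/4)))"
  proof (rule summable_weighted_of_growth)
    show "(\<Sum>k<n. (a k)\<^sup>2) \<le> (2 * F + 8 * F\<^sup>2) * real n powr (1 / \<gamma> - 1 / 2)" if "0 < n" for n
      unfolding a_def F_def by (rule hermite_coeffs_growth[OF f]) (use \<gamma> that in auto)
    show "1 / \<gamma> - 1 / 2 < 1 / 4" using \<gamma> by (simp add: divide_less_eq)
  qed (use F in auto)
  then have "summable (\<lambda>k. 2 powr (1/4) * (8 + 2 * t\<^sup>2) * ((a k)\<^sup>2 * (real k + 1) powr (- (1/4))))"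
    by (rule summable_mult)
  then show ?thesis
  proof (rule summable_comparison_test'[where N = 0])
    fix k :: nat
    have pw: "(2 * real k + 2) powr (1/4) = 2 powr (1/4) * (real k + 1) powr (1/4)"
      by (simp add: powr_mult[symmetric] algebra_simps)
    have half: "(real k + 1) powr (- (1/2)) = 1 / sqrt (real k + 1)"
      unfolding powr_minus[of "real k + 1" "1/2"] by (simp add: powr_half_sqrt inverse_eq_divide)
    have decay: "(\<psi> k t)\<^sup>2 \<le> (8 + 2 * t\<^sup>2) * (real k + 1) powr (- (1/2))"
      using hermite_function_pointwise_decay[of k t]
      unfolding half by simp
    have "(2 * real k + 2) powr (1/4) * (a k * \<psi> k t)\<^sup>2
        \<le> (2 powr (1/4) * (real k + 1) powr (1/4)) * ((a k)\<^sup>2 * ((8 + 2 * t\<^sup>2) * (real k + 1) powr (- (1/2))))"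
      unfolding power_mult_distrib pw
      by (rule mult_left_mono[OF mult_left_mono[OF decay]]) simp_all
    also have "\<dots> = 2 powr (1/4) * (8 + 2 * t\<^sup>2) * ((a k)\<^sup>2 * ((real k + 1) powr (1/4) * (real k + 1) powr (- (1/2))))"
      by (simp add: mult_ac)
    also have "(real k + 1) powr (1/4) * (real k + 1) powr (- (1/2)) = (real k + 1) powr (- (1/4))"
      by (simp add: powr_add[symmetric])
    finally show "norm ((2 * real k + 2) powr (1/4) * (a k * \<psi> k t)\<^sup>2)
        \<le> 2 powr (1/4) * (8 + 2 * t\<^sup>2) * ((a k)\<^sup>2 * (real k + 1) powr (- (1/4)))" by simp
  qed
qed

section \<open>Convergence of Hermite series in the space with exponent \<open>\<gamma>\<close>\<close>

text \<open>If the first term on the right is too small, then \<open>\<bar>z\<bar>\<^bsup>2-\<gamma>\<^esup> < 1 / (l w)\<close>, and the second term is large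
  enough.  The free parameter \<open>l\<close> makes this a substitute for Hoelder's inequality.\<close>
lemma powr_le_weighted_square:
  fixes z w l \<gamma> :: real
  assumes "0 < w" "0 < l" "0 < \<gamma>" "\<gamma> < 2"
  shows "\<bar>z\<bar> powr \<gamma> \<le> l * (w * z\<^sup>2) + (l * w) powr (- (\<gamma> / (2 - \<gamma>)))"
proof (cases "\<bar>z\<bar> powr \<gamma> \<le> l * (w * z\<^sup>2)")
  case False
  then have z: "z \<noteq> 0" by auto
  have "z\<^sup>2 = \<bar>z\<bar> powr \<gamma> * \<bar>z\<bar> powr (2 - \<gamma>)"
    using z by (simp only: powr_add[symmetric]) (simp add: powr_numeral)
  then have "\<bar>z\<bar> powr \<gamma> * ((l * w) * \<bar>z\<bar> powr (2 - \<gamma>)) < \<bar>z\<bar> powr \<gamma> * 1"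
    using False by (simp add: mult_ac)
  then have "(l * w) * \<bar>z\<bar> powr (2 - \<gamma>) < 1"
    using z by (subst (asm) mult_less_cancel_left_pos) auto
  then have "\<bar>z\<bar> powr (2 - \<gamma>) \<le> 1 / (l * w)" using assms by (simp add: field_simps)
  then have "(\<bar>z\<bar> powr (2 - \<gamma>)) powr (\<gamma> / (2 - \<gamma>)) \<le> (1 / (l * w)) powr (\<gamma> / (2 - \<gamma>))"
    using assms by (intro powr_mono2) auto
  then have "\<bar>z\<bar> powr \<gamma> \<le> (l * w) powr (- (\<gamma> / (2 - \<gamma>)))"
  proof -
    have e: "(2 - \<gamma>) * (\<gamma> / (2 - \<gamma>)) = \<gamma>" using assms by simp
    have "(1 / x) powr y = x powr (- y)" if "0 < x" for x y :: real
      using that by (simp add: powr_def ln_div)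
    from this[of "l * w"] show ?thesis
      using assms \<open>(\<bar>z\<bar> powr (2 - \<gamma>)) powr (\<gamma> / (2 - \<gamma>)) \<le> _\<close>
      by (simp only: powr_powr e mult_pos_pos)
  qed
  moreover have "0 \<le> l * (w * z\<^sup>2)" using assms by simp
  ultimately show ?thesis by linarith
qed (simp add: add_increasing2)

lemma integrable_weight_powr:
  fixes r :: real
  assumes "2 < r"
  shows "integrable lebesgue (\<lambda>x. ((1 + x\<^sup>2) powr (1/4)) powr (- r))"
proof -
  have "integrable lebesgue (\<lambda>x::real. 2 powr (r/4) * (1 + \<bar>x\<bar>) powr (- (r/2)))"
    using assms by (intro integrable_mult_right)
      (simp add: integrable_completion integrable_one_plus_abs_powr)
  then show ?thesis
  proof (rule Bochner_Integration.integrable_bound)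
    show "AE x in lebesgue. norm (((1 + x\<^sup>2) powr (1/4)) powr (- r))
        \<le> norm (2 powr (r/4) * (1 + \<bar>x\<bar>) powr (- (r/2)))"
    proof (rule AE_I2)
      fix x :: real
      have "0 \<le> (1 - \<bar>x\<bar>)\<^sup>2" by simp
      then have le: "(1 + \<bar>x\<bar>)\<^sup>2 / 2 \<le> 1 + x\<^sup>2" by (simp add: power2_sum power2_diff)
      have "((1 + x\<^sup>2) powr (1/4)) powr (- r) = (1 + x\<^sup>2) powr (- (r/4))" by (simp add: powr_powr)
      also have "\<dots> \<le> ((1 + \<bar>x\<bar>)\<^sup>2 / 2) powr (- (r/4))"
        using assms le by (intro powr_mono2') auto
      also have "\<dots> = ((1 + \<bar>x\<bar>)\<^sup>2) powr (- (r/4)) * 2 powr (r/4)"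
        unfolding powr_minus[of 2 "r/4"] powr_minus[of "(1 + \<bar>x\<bar>)\<^sup>2 / 2" "r/4"]
          powr_minus[of "(1 + \<bar>x\<bar>)\<^sup>2" "r/4"]
        by (simp add: powr_divide inverse_eq_divide)
      also have "((1 + \<bar>x\<bar>)\<^sup>2) powr (- (r/4)) = (1 + \<bar>x\<bar>) powr (- (r/2))"
      proof -
        have "(1 + \<bar>x\<bar>)\<^sup>2 = (1 + \<bar>x\<bar>) powr 2" by (simp add: powr_numeral)
        then show ?thesis by (simp only: powr_powr) simp
      qed
      finally show "norm (((1 + x\<^sup>2) powr (1/4)) powr (- r))
        \<le> norm (2 powr (r/4) * (1 + \<bar>x\<bar>) powr (- (r/2)))" by (simp add: mult.commute)
    qed
  qed (simp add: measurable_completion)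
qed

text \<open>Continuity at \<open>0\<close> of the passage from the weighted coefficients to \<open>L\<^sup>\<gamma>\<close>.  Choosing the parameter \<open>l\<close>
  large makes the contribution of the weight small, which is possible because the weight
  \<open>(1 + x\<^sup>2)\<^bsup>1/4\<^esup>\<close> raised to \<open>- \<gamma> / (2 - \<gamma>)\<close> is integrable: again this means \<open>\<gamma> > 4/3\<close>.  For \<open>\<gamma> = 2\<close>
  Parseval's identity suffices.\<close>
lemma hermite_sum_Lp_small:
  fixes \<gamma> e :: real
  assumes \<gamma>: "4 / 3 < \<gamma>" "\<gamma> \<le> 2" and e: "0 < e"
  obtains d where "0 < d" and "\<And>K c. finite K \<Longrightarrow>
    (\<Sum>k\<in>K. (2 * real k + 2) powr (1/4) * (c k)\<^sup>2) < d \<Longrightarrow>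
    (\<integral>x. \<bar>\<Sum>k\<in>K. c k * \<psi> k x\<bar> powr \<gamma> \<partial>lebesgue) < e"
proof (cases "\<gamma> = 2")
  case True
  show ?thesis
  proof (rule that[of e])
    fix K :: "nat set" and c :: "nat \<Rightarrow> real"
    assume K: "finite K" and d: "(\<Sum>k\<in>K. (2 * real k + 2) powr (1/4) * (c k)\<^sup>2) < e"
    have "(\<integral>x. \<bar>\<Sum>k\<in>K. c k * \<psi> k x\<bar> powr \<gamma> \<partial>lebesgue) = (\<Sum>k\<in>K. (c k)\<^sup>2)"
      using hermite_sum_square(2)[OF K, of "\<lambda>k. k" c] by (simp add: True powr_numeral)
    also have "\<dots> \<le> (\<Sum>k\<in>K. (2 * real k + 2) powr (1/4) * (c k)\<^sup>2)"
    proof (rule sum_mono)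
      fix k
      have "1 * (c k)\<^sup>2 \<le> (2 * real k + 2) powr (1/4) * (c k)\<^sup>2"
        by (intro mult_right_mono ge_one_powr_ge_zero) auto
      then show "(c k)\<^sup>2 \<le> (2 * real k + 2) powr (1/4) * (c k)\<^sup>2" by simp
    qed
    finally show "(\<integral>x. \<bar>\<Sum>k\<in>K. c k * \<psi> k x\<bar> powr \<gamma> \<partial>lebesgue) < e" using d by simp
  qed (rule e)
next
  case False
  then have g2: "\<gamma> < 2" using \<gamma> by simp
  define r where "r = \<gamma> / (2 - \<gamma>)"
  have r: "2 < r" using \<gamma> g2 by (simp add: r_def less_divide_eq)
  define W where "W = (\<integral>x. ((1 + x\<^sup>2) powr (1/4)) powr (- r) \<partial>lebesgue)"
  have W: "0 \<le> W" by (simp add: W_def)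
  \<comment> \<open>\<open>W + 1\<close> instead of \<open>W\<close> keeps the base positive\<close>
  define l where "l = (e / (2 * (W + 1))) powr (- (1 / r))"
  have l: "0 < l" using e W by (simp add: l_def)
  have lW: "l powr (- r) * W \<le> e / 2"
  proof -
    have "l powr (- r) = e / (2 * (W + 1))" using e W r by (simp add: l_def powr_powr)
    then have "l powr (- r) * W = e / 2 * (W / (W + 1))" by simp
    also have "\<dots> \<le> e / 2 * 1" using e W by (intro mult_left_mono) auto
    finally show ?thesis by simp
  qed
  show ?thesis
  proof (rule that[of "e / (32 * l)"])
    show "0 < e / (32 * l)" using e l by simp
    fix K :: "nat set" and c :: "nat \<Rightarrow> real"
    assume K: "finite K" and d: "(\<Sum>k\<in>K. (2 * real k + 2) powr (1/4) * (c k)\<^sup>2) < e / (32 * l)"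
    define q where "q x = (\<Sum>k\<in>K. c k * \<psi> k x)" for x
    have wq: "integrable lebesgue (\<lambda>x. (1 + x\<^sup>2) powr (1/4) * (q x)\<^sup>2)"
      "(\<integral>x. (1 + x\<^sup>2) powr (1/4) * (q x)\<^sup>2 \<partial>lebesgue)
        \<le> 16 * (\<Sum>k\<in>K. (2 * real k + 2) powr (1/4) * (c k)\<^sup>2)"
      unfolding q_def by (rule hermite_sum_weighted[OF K])+
    have q\<gamma>: "integrable lebesgue (\<lambda>x. \<bar>q x\<bar> powr \<gamma>)"
      unfolding q_def using \<gamma>
      by (intro Lp_spaceD(2)[OF Lp_space_sum] Lp_space_cmult hermite_function_Lp) auto
    have iR: "integrable lebesgue (\<lambda>x. l * ((1 + x\<^sup>2) powr (1/4) * (q x)\<^sup>2)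
        + l powr (- r) * ((1 + x\<^sup>2) powr (1/4)) powr (- r))"
      using wq(1) integrable_weight_powr[OF r] by simp
    have "(\<integral>x. \<bar>q x\<bar> powr \<gamma> \<partial>lebesgue)
        \<le> (\<integral>x. l * ((1 + x\<^sup>2) powr (1/4) * (q x)\<^sup>2)
          + l powr (- r) * ((1 + x\<^sup>2) powr (1/4)) powr (- r) \<partial>lebesgue)"
    proof (rule integral_mono[OF q\<gamma> iR])
      fix x :: real
      have p: "0 < 1 + x\<^sup>2" by (simp add: add_pos_nonneg)
      then have "0 < (1 + x\<^sup>2) powr (1/4)" by simp
      from powr_le_weighted_square[OF this l, of \<gamma> "q x"]
      show "\<bar>q x\<bar> powr \<gamma> \<le> l * ((1 + x\<^sup>2) powr (1/4) * (q x)\<^sup>2)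
          + l powr (- r) * ((1 + x\<^sup>2) powr (1/4)) powr (- r)"
        using \<gamma> g2 l by (simp only: r_def[symmetric] powr_mult)
    qed
    also have "\<dots> = l * (\<integral>x. (1 + x\<^sup>2) powr (1/4) * (q x)\<^sup>2 \<partial>lebesgue) + l powr (- r) * W"
      unfolding W_def using wq(1) integrable_weight_powr[OF r] by simp
    also have "\<dots> \<le> l * (16 * (\<Sum>k\<in>K. (2 * real k + 2) powr (1/4) * (c k)\<^sup>2)) + e / 2"
      using wq(2) l lW by (intro add_mono mult_left_mono) auto
    also have "\<dots> < l * (16 * (e / (32 * l))) + e / 2"
      by (intro add_strict_right_mono mult_strict_left_mono d l) simp
    also have "\<dots> = e" using l by simp
    finally show "(\<integral>x. \<bar>\<Sum>k\<in>K. c k * \<psi> k x\<bar> powr \<gamma> \<partial>lebesgue) < e"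
      unfolding q_def .
  qed
qed

lemma hermite_series_Lp_convergent:
  fixes c :: "nat \<Rightarrow> real" and \<gamma> :: real
  assumes \<gamma>: "4 / 3 < \<gamma>" "\<gamma> \<le> 2"
    and sm: "summable (\<lambda>k. (2 * real k + 2) powr (1/4) * (c k)\<^sup>2)"
  shows "\<exists>g. Lp_tendsto lebesgue \<gamma> (\<lambda>N s. \<Sum>k<N. c k * \<psi> k s) g"
proof (rule Lp_complete)
  show "0 < \<gamma>" using \<gamma> by simp
  show "(\<lambda>s. \<Sum>k<n. c k * \<psi> k s) \<in> Lp_space lebesgue \<gamma>" for n
    using \<gamma> by (intro Lp_space_sum Lp_space_cmult hermite_function_Lp) auto
  fix e :: real assume "0 < e"
  then obtain d where d: "0 < d" and dK: "\<And>K c. finite K \<Longrightarrow>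
    (\<Sum>k\<in>K. (2 * real k + 2) powr (1/4) * (c k)\<^sup>2) < d \<Longrightarrow>
    (\<integral>x. \<bar>\<Sum>k\<in>K. c k * \<psi> k x\<bar> powr \<gamma> \<partial>lebesgue) < e"
    using hermite_sum_Lp_small[OF \<gamma>] by blast
  obtain N where N: "\<And>m n. N \<le> m \<Longrightarrow>
      norm (\<Sum>k\<in>{m..<n}. (2 * real k + 2) powr (1/4) * (c k)\<^sup>2) < d"
    using sm d unfolding summable_Cauchy by blast
  have le: "(\<integral>x. \<bar>(\<Sum>k<m. c k * \<psi> k x) - (\<Sum>k<n. c k * \<psi> k x)\<bar> powr \<gamma> \<partial>lebesgue) < e"
    if "N \<le> m" "m \<le> n" for m n
  proof -
    have "(\<Sum>k<n. c k * \<psi> k x) - (\<Sum>k<m. c k * \<psi> k x)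
        = (\<Sum>k\<in>{m..<n}. c k * \<psi> k x)" for x
      using that(2) by (simp add: atLeast0LessThan[symmetric] sum_diff_nat_ivl)
    then have "\<bar>(\<Sum>k<m. c k * \<psi> k x) - (\<Sum>k<n. c k * \<psi> k x)\<bar>
        = \<bar>\<Sum>k\<in>{m..<n}. c k * \<psi> k x\<bar>" for x
      by (metis abs_minus_commute)
    then show ?thesis
      using dK[of "{m..<n}" c] N[OF that(1), of n] by simp
  qed
  have "(\<integral>x. \<bar>(\<Sum>k<m. c k * \<psi> k x) - (\<Sum>k<n. c k * \<psi> k x)\<bar> powr \<gamma> \<partial>lebesgue) < e"
    if "N \<le> m" "N \<le> n" for m n
  proof (cases "m \<le> n")
    case False
    then show ?thesis using le[of n m] that by (simp add: abs_minus_commute)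
  qed (use le that in auto)
  then show "\<exists>K. \<forall>m\<ge>K. \<forall>n\<ge>K. (\<integral>x. \<bar>(\<Sum>k<m. c k * \<psi> k x)
      - (\<Sum>k<n. c k * \<psi> k x)\<bar> powr \<gamma> \<partial>lebesgue) < e" by blast
qed

section \<open>Absolute moments of symmetric stable variables\<close>

lemma stable_abs_moment_integral_finite:
  fixes \<gamma> :: real
  assumes \<gamma>: "1 < \<gamma>"
  shows "(\<integral>\<^sup>+v. ennreal ((1 - exp (- (\<bar>v\<bar> powr \<gamma>))) / v\<^sup>2) \<partial>lborel) < \<infinity>"
proof -
  have near: "integrable lborel (\<lambda>v::real. indicator {-1..1} v * \<bar>v\<bar> powr (\<gamma> - 2))"
  proof (rule integrable_even_lborel)
    have "((\<lambda>v::real. v powr (\<gamma> - 2)) has_integral (1 powr (\<gamma> - 2 + 1) / (\<gamma> - 2 + 1))) {0..1}"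
      by (rule has_integral_powr_from_0) (use \<gamma> in auto)
    from nn_integral_has_integral_lebesgue[OF _ this]
    have "(\<integral>\<^sup>+v. ennreal (indicator {0..1} v * v powr (\<gamma> - 2)) \<partial>lborel) < \<infinity>"
      by (simp add: ennreal_mult' ennreal_indicator)
    moreover have "norm (indicator {0..} v * (indicator {-1..1} v * \<bar>v\<bar> powr (\<gamma> - 2)))
        = indicator {0..1} v * v powr (\<gamma> - 2)" for v :: real
      by (auto simp: indicator_def)
    ultimately show "integrable lborel (\<lambda>v::real. indicator {0..} v * (indicator {-1..1} v * \<bar>v\<bar> powr (\<gamma> - 2)))"
      by (auto simp: integrable_iff_bounded)
  qed (auto simp: indicator_def)
  have far: "integrable lborel (\<lambda>v::real. 4 * (1 + \<bar>v\<bar>) powr (- 2))"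
    by (intro integrable_mult_right integrable_one_plus_abs_powr) simp
  have le: "(1 - exp (- (\<bar>v\<bar> powr \<gamma>))) / v\<^sup>2
      \<le> indicator {-1..1} v * \<bar>v\<bar> powr (\<gamma> - 2) + 4 * (1 + \<bar>v\<bar>) powr (- 2)" for v :: real
  proof (cases "v = 0")
    case False
    have v2: "\<bar>v\<bar> powr 2 = v\<^sup>2" using False by (simp add: powr_numeral)
    show ?thesis
    proof (cases "\<bar>v\<bar> \<le> 1")
      case True
      have "1 - exp (- (\<bar>v\<bar> powr \<gamma>)) \<le> \<bar>v\<bar> powr \<gamma>"
        using exp_ge_add_one_self[of "- (\<bar>v\<bar> powr \<gamma>)"] by linarith
      then have "(1 - exp (- (\<bar>v\<bar> powr \<gamma>))) / v\<^sup>2 \<le> \<bar>v\<bar> powr \<gamma> / v\<^sup>2"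
        by (rule divide_right_mono) simp
      also have "\<dots> = \<bar>v\<bar> powr (\<gamma> - 2)" by (simp only: powr_diff v2)
      also have "\<dots> \<le> indicator {-1..1} v * \<bar>v\<bar> powr (\<gamma> - 2) + 4 * (1 + \<bar>v\<bar>) powr (- 2)"
        using True by (simp add: indicator_def abs_le_iff)
      finally show ?thesis .
    next
      case False
      then have "(1 + \<bar>v\<bar>)\<^sup>2 \<le> (2 * \<bar>v\<bar>)\<^sup>2" by (intro power_mono) auto
      then have *: "(1 + \<bar>v\<bar>)\<^sup>2 \<le> 4 * v\<^sup>2" by (simp add: power_mult_distrib)
      have "(1 - exp (- (\<bar>v\<bar> powr \<gamma>))) / v\<^sup>2 \<le> 1 / v\<^sup>2" by (intro divide_right_mono) auto
      also have "\<dots> \<le> 4 / (1 + \<bar>v\<bar>)\<^sup>2"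
        using * \<open>v \<noteq> 0\<close> by (simp add: divide_simps add_pos_nonneg)
      also have "\<dots> = 4 * (1 + \<bar>v\<bar>) powr (- 2)"
        by (simp add: powr_minus powr_numeral inverse_eq_divide)
      also have "\<dots> \<le> indicator {-1..1} v * \<bar>v\<bar> powr (\<gamma> - 2) + 4 * (1 + \<bar>v\<bar>) powr (- 2)" by simp
      finally show ?thesis .
    qed
  qed simp
  have "(\<integral>\<^sup>+v. ennreal ((1 - exp (- (\<bar>v\<bar> powr \<gamma>))) / v\<^sup>2) \<partial>lborel)
      \<le> (\<integral>\<^sup>+v. ennreal (indicator {-1..1} v * \<bar>v\<bar> powr (\<gamma> - 2) + 4 * (1 + \<bar>v\<bar>) powr (- 2)) \<partial>lborel)"
    by (intro nn_integral_mono ennreal_leI le)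
  also have "\<dots> < \<infinity>"
  proof -
    have "integrable lborel (\<lambda>v::real. indicator {-1..1} v * \<bar>v\<bar> powr (\<gamma> - 2) + 4 * (1 + \<bar>v\<bar>) powr (- 2))"
      using near far by simp
    from nn_integral_eq_integral[OF this] show ?thesis by simp
  qed
  finally show ?thesis .
qed

lemma nn_integral_scale:
  fixes f :: "real \<Rightarrow> real" and s :: real
  assumes [measurable]: "f \<in> borel_measurable borel" and f: "\<And>v. 0 \<le> f v" and s: "s \<noteq> 0"
  shows "(\<integral>\<^sup>+u. ennreal (f (s * u) / u\<^sup>2) \<partial>lborel) = ennreal \<bar>s\<bar> * (\<integral>\<^sup>+v. ennreal (f v / v\<^sup>2) \<partial>lborel)"
proof -
  have "(\<integral>\<^sup>+v. ennreal (f v / v\<^sup>2) \<partial>lborel)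
      = ennreal \<bar>s\<bar> * (\<integral>\<^sup>+u. ennreal (f (0 + s * u) / (0 + s * u)\<^sup>2) \<partial>lborel)"
    by (rule nn_integral_real_affine) (use s in measurable)
  also have "(\<integral>\<^sup>+u. ennreal (f (0 + s * u) / (0 + s * u)\<^sup>2) \<partial>lborel)
      = (\<integral>\<^sup>+u. ennreal (1 / s\<^sup>2) * ennreal (f (s * u) / u\<^sup>2) \<partial>lborel)"
    by (intro nn_integral_cong) (simp add: ennreal_mult'[symmetric] f power_mult_distrib)
  also have "\<dots> = ennreal (1 / s\<^sup>2) * (\<integral>\<^sup>+u. ennreal (f (s * u) / u\<^sup>2) \<partial>lborel)"
    by (rule nn_integral_cmult) measurable
  finally have "ennreal \<bar>s\<bar> * (\<integral>\<^sup>+v. ennreal (f v / v\<^sup>2) \<partial>lborel)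
      = (ennreal \<bar>s\<bar> * (ennreal \<bar>s\<bar> * ennreal (1 / s\<^sup>2))) * (\<integral>\<^sup>+u. ennreal (f (s * u) / u\<^sup>2) \<partial>lborel)"
    by (simp add: mult.assoc)
  also have "ennreal \<bar>s\<bar> * (ennreal \<bar>s\<bar> * ennreal (1 / s\<^sup>2)) = 1"
    using s by (simp add: ennreal_mult'[symmetric] power2_eq_square abs_mult_self_eq)
  finally show ?thesis by simp
qed

text \<open>The absolute value is recovered from cosines by
  \<open>\<integral> (1 - cos (u y)) / u\<^sup>2 du = \<kappa> \<bar>y\<bar>\<close>, so Tonelli's theorem expresses \<open>\<kappa> E \<bar>Y\<bar>\<close> through the characteristic
  function of \<open>Y\<close>.  Scaling extracts the factor \<open>S\<^bsup>1/\<gamma>\<^esup>\<close>, and the integral that remains converges at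
  the origin because \<open>\<gamma> > 1\<close>.  In place of its value \<open>\<pi>\<close>, the constant \<open>\<kappa>\<close> enters through
  the positive lower bound \<open>k0\<close>, obtained from the values \<open>1 \<le> v \<le> 2\<close>.\<close>
lemma stable_abs_moment:
  fixes \<gamma> :: real
  assumes \<gamma>: "1 < \<gamma>"
  obtains K where "0 \<le> K" and
    "\<And>(M :: 'a measure) Y S. prob_space M \<Longrightarrow> Y \<in> borel_measurable M \<Longrightarrow> 0 \<le> S \<Longrightarrow>
      (\<And>u. (\<integral>\<omega>. cos (u * Y \<omega>) \<partial>M) = exp (- (S * \<bar>u\<bar> powr \<gamma>))) \<Longrightarrow>
      integrable M Y \<and> (\<integral>\<omega>. \<bar>Y \<omega>\<bar> \<partial>M) \<le> K * S powr (1 / \<gamma>)"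
proof -
  define k0 where "k0 = (1 - cos 1) / (4::real)"
  have cos1: "cos (1::real) < 1"
    using cos_monotone_0_pi[of 0 1] pi_gt3 by simp
  then have k0: "0 < k0" by (simp add: k0_def)
  define \<kappa> where "\<kappa> = (\<integral>\<^sup>+v. ennreal ((1 - cos v) / v\<^sup>2) \<partial>lborel)"
  have \<kappa>: "ennreal k0 \<le> \<kappa>"
  proof -
    have "ennreal k0 = (\<integral>\<^sup>+v. ennreal k0 * indicator {1..2::real} v \<partial>lborel)"
      by (simp add: nn_integral_cmult_indicator)
    also have "\<dots> \<le> \<kappa>"
      unfolding \<kappa>_def
    proof (intro nn_integral_mono)
      fix v :: real
      show "ennreal k0 * indicator {1..2} v \<le> ennreal ((1 - cos v) / v\<^sup>2)"
      proof (cases "v \<in> {1..2}")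
        case True
        then have "cos v \<le> cos 1" using cos_monotone_0_pi_le[of 1 v] pi_gt3 by simp
        moreover have "v\<^sup>2 \<le> 2\<^sup>2" using True by (intro power_mono) auto
        ultimately have "(1 - cos 1) / 4 \<le> (1 - cos v) / v\<^sup>2"
          using True by (intro frac_le) auto
        then show ?thesis using True by (simp add: k0_def ennreal_leI)
      qed simp
    qed
    finally show ?thesis .
  qed
  obtain k1 where k1: "0 \<le> k1"
    "(\<integral>\<^sup>+v. ennreal ((1 - exp (- (\<bar>v\<bar> powr \<gamma>))) / v\<^sup>2) \<partial>lborel) = ennreal k1"
    by (rule that[OF enn2real_nonneg ennreal_enn2real[symmetric]])
      (use stable_abs_moment_integral_finite[OF \<gamma>] in simp)
  have main: "integrable M Y \<and> (\<integral>\<omega>. \<bar>Y \<omega>\<bar> \<partial>M) \<le> (k1 / k0) * S powr (1 / \<gamma>)"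
    if M: "prob_space M" and [measurable]: "Y \<in> borel_measurable M" and S: "0 \<le> S"
      and ch: "\<And>u. (\<integral>\<omega>. cos (u * Y \<omega>) \<partial>M) = exp (- (S * \<bar>u\<bar> powr \<gamma>))"
    for M :: "'a measure" and Y S
  proof -
    interpret prob_space M by fact
    interpret P: pair_sigma_finite lborel M ..
    have inner: "(\<integral>\<^sup>+u. ennreal ((1 - cos (u * y)) / u\<^sup>2) \<partial>lborel) = ennreal \<bar>y\<bar> * \<kappa>" for y :: real
    proof (cases "y = 0")
      case False
      then show ?thesis
        using nn_integral_scale[of "\<lambda>v. 1 - cos v" y] by (simp add: \<kappa>_def mult.commute)
    qed simp
    have "(\<integral>\<^sup>+\<omega>. ennreal \<bar>Y \<omega>\<bar> \<partial>M) * ennreal k0 \<le> (\<integral>\<^sup>+\<omega>. ennreal \<bar>Y \<omega>\<bar> \<partial>M) * \<kappa>"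
      by (intro mult_left_mono \<kappa>) auto
    also have "\<dots> = (\<integral>\<^sup>+\<omega>. ennreal \<bar>Y \<omega>\<bar> * \<kappa> \<partial>M)"
      by (rule nn_integral_multc[symmetric]) measurable
    also have "\<dots> = (\<integral>\<^sup>+\<omega>. (\<integral>\<^sup>+u. ennreal ((1 - cos (u * Y \<omega>)) / u\<^sup>2) \<partial>lborel) \<partial>M)"
      by (simp add: inner)
    also have "\<dots> = (\<integral>\<^sup>+u. (\<integral>\<^sup>+\<omega>. ennreal ((1 - cos (u * Y \<omega>)) / u\<^sup>2) \<partial>M) \<partial>lborel)"
      by (rule P.Fubini') measurable
    also have "\<dots> = (\<integral>\<^sup>+u. ennreal ((1 - exp (- (S * \<bar>u\<bar> powr \<gamma>))) / u\<^sup>2) \<partial>lborel)"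
    proof (intro nn_integral_cong)
      fix u :: real
      have i: "integrable M (\<lambda>\<omega>. cos (u * Y \<omega>))"
        by (rule integrable_const_bound[of _ 1]) auto
      have "(\<integral>\<^sup>+\<omega>. ennreal ((1 - cos (u * Y \<omega>)) / u\<^sup>2) \<partial>M)
          = ennreal (\<integral>\<omega>. (1 - cos (u * Y \<omega>)) / u\<^sup>2 \<partial>M)"
        using i by (intro nn_integral_eq_integral) auto
      also have "(\<integral>\<omega>. (1 - cos (u * Y \<omega>)) / u\<^sup>2 \<partial>M) = (1 - exp (- (S * \<bar>u\<bar> powr \<gamma>))) / u\<^sup>2"
        using i by (simp add: ch prob_space)
      finally show "(\<integral>\<^sup>+\<omega>. ennreal ((1 - cos (u * Y \<omega>)) / u\<^sup>2) \<partial>M)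
          = ennreal ((1 - exp (- (S * \<bar>u\<bar> powr \<gamma>))) / u\<^sup>2)" .
    qed
    also have "\<dots> = ennreal (S powr (1 / \<gamma>) * k1)"
    proof (cases "S = 0")
      case False
      define s where "s = S powr (1 / \<gamma>)"
      have s: "0 < s" using False S by (simp add: s_def)
      have "S * \<bar>u\<bar> powr \<gamma> = \<bar>s * u\<bar> powr \<gamma>" for u
        using S \<gamma> False by (simp add: s_def abs_mult powr_mult powr_powr)
      then show ?thesis
        using nn_integral_scale[of "\<lambda>v. 1 - exp (- (\<bar>v\<bar> powr \<gamma>))" s] s k1
        by (simp add: ennreal_mult' s_def)
    qed simp
    finally have *: "(\<integral>\<^sup>+\<omega>. ennreal \<bar>Y \<omega>\<bar> \<partial>M) * ennreal k0 \<le> ennreal (S powr (1 / \<gamma>) * k1)" .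
    have "(\<integral>\<^sup>+\<omega>. ennreal \<bar>Y \<omega>\<bar> \<partial>M) = (\<integral>\<^sup>+\<omega>. ennreal \<bar>Y \<omega>\<bar> \<partial>M) * (ennreal k0 * ennreal (1 / k0))"
      using k0 by (simp add: ennreal_mult'[symmetric])
    also have "\<dots> = (\<integral>\<^sup>+\<omega>. ennreal \<bar>Y \<omega>\<bar> \<partial>M) * ennreal k0 * ennreal (1 / k0)"
      by (simp only: mult.assoc)
    also have "\<dots> \<le> ennreal (S powr (1 / \<gamma>) * k1) * ennreal (1 / k0)"
      by (intro mult_right_mono *) auto
    also have "\<dots> = ennreal ((k1 / k0) * S powr (1 / \<gamma>))"
      using k0 k1 by (simp add: ennreal_mult'[symmetric] mult.commute)
    finally have **: "(\<integral>\<^sup>+\<omega>. ennreal \<bar>Y \<omega>\<bar> \<partial>M) \<le> ennreal ((k1 / k0) * S powr (1 / \<gamma>))" .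
    then have i: "integrable M Y" by (auto simp: integrable_iff_bounded le_less_trans)
    moreover have "(\<integral>\<omega>. \<bar>Y \<omega>\<bar> \<partial>M) \<le> (k1 / k0) * S powr (1 / \<gamma>)"
      using ** k0 k1 by (intro integral_real_bounded) auto
    ultimately show ?thesis by simp
  qed
  show ?thesis by (rule that[of "k1 / k0"]) (use k0 k1 main in auto)
qed

section \<open>Elementary stochastic integrals\<close>

text \<open>A list of triples \<open>(c, a, b)\<close> stands for the formal combination of the intervals from \<open>a\<close> to \<open>b\<close> with
  the coefficients \<open>c\<close>; overlaps are allowed, so that sums and differences are mere concatenations.
  Taking for \<open>F\<close> the indicator of \<open>x \<le> y\<close> gives the value at \<open>x\<close> of the step function, and
  taking the path \<open>y \<mapsto> X y \<omega>\<close> gives its elementary stochastic integral.  One identity that holds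
  for all \<open>F\<close> therefore transforms both in the same way.\<close>
definition incr_sum :: "(real \<times> real \<times> real) list \<Rightarrow> (real \<Rightarrow> real) \<Rightarrow> real" where
  "incr_sum L F = (\<Sum>(c, a, b)\<leftarrow>L. c * (F b - F a))"

definition proper :: "(real \<times> real \<times> real) list \<Rightarrow> bool" where
  "proper L \<longleftrightarrow> (\<forall>(c, a, b)\<in>set L. a \<le> b)"

lemma incr_sum_append: "incr_sum (L @ L') F = incr_sum L F + incr_sum L' F"
  by (simp add: incr_sum_def)

lemma incr_sum_scale: "incr_sum (map (\<lambda>(c, a, b). (r * c, a, b)) L) F = r * incr_sum L F"
  by (induction L) (auto simp: incr_sum_def algebra_simps)

lemma proper_append: "proper (L @ L') \<longleftrightarrow> proper L \<and> proper L'"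
  by (simp add: proper_def ball_Un)

lemma proper_scale: "proper L \<Longrightarrow> proper (map (\<lambda>(c, a, b). (r * c, a, b)) L)"
  by (auto simp: proper_def)

text \<open>Sort all end points that occur.  The increment of \<open>F\<close> over each interval telescopes into the
  increments over the cells of this partition that it contains.\<close>
lemma incr_sum_common_partition:
  assumes "proper L"
  obtains m :: nat and t :: "nat \<Rightarrow> real" and d :: "nat \<Rightarrow> real"
  where "strict_mono_on {..m} t" and
    "\<And>F. incr_sum L F = (\<Sum>j<m. d j * (F (t (Suc j)) - F (t j)))"
proof (cases "L = []")
  case True
  show ?thesis
    by (rule that[of 0 "\<lambda>j. real j" "\<lambda>_. 0"]) (auto simp: True incr_sum_def strict_mono_on_def)
next
  case False
  define P where "P = (\<Union>(c, a, b)\<in>set L. {a, b})"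
  have P: "finite P" "P \<noteq> {}" using False by (auto simp: P_def split: prod.splits) (metis list.set_intros(1) neq_Nil_conv prod_cases3)
  define ts where "ts = sorted_list_of_set P"
  have ts: "set ts = P" "sorted_wrt (<) ts" "ts \<noteq> []"
    using P by (auto simp: ts_def)
  define m where "m = length ts - 1"
  have len: "length ts = Suc m" using ts(3) by (simp add: m_def)
  define t where "t j = ts ! j" for j
  have mono: "strict_mono_on {..m} t"
    unfolding strict_mono_on_def t_def using ts(2) len by (auto simp: sorted_wrt_iff_nth_less)
  have pos: "\<exists>p\<le>m. t p = x" if "x \<in> P" for x
    using that len unfolding ts(1)[symmetric] in_set_conv_nth t_def by (auto simp: less_Suc_eq_le)
  have single: "(\<Sum>j<m. of_bool (a \<le> t j \<and> t (Suc j) \<le> b) * (F (t (Suc j)) - F (t j))) = F b - F a"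
    if ab: "a \<in> P" "b \<in> P" "a \<le> b" for a b and F :: "real \<Rightarrow> real"
  proof -
    obtain p where "p \<le> m" "t p = a" using pos[OF ab(1)] by blast
    moreover obtain q where "q \<le> m" "t q = b" using pos[OF ab(2)] by blast
    ultimately have pq: "p \<le> m" "t p = a" "q \<le> m" "t q = b" .
    have le_iff: "t i \<le> t j \<longleftrightarrow> i \<le> j" if "i \<le> m" "j \<le> m" for i j
      using strict_mono_on_less_eq[OF mono] that by simp
    have "p \<le> q" using le_iff[OF pq(1,3)] pq ab(3) by simp
    have "(\<Sum>j<m. of_bool (a \<le> t j \<and> t (Suc j) \<le> b) * (F (t (Suc j)) - F (t j)))
        = (\<Sum>j<m. of_bool (p \<le> j \<and> j < q) * (F (t (Suc j)) - F (t j)))"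
      using pq le_iff by (intro sum.cong refl) (auto simp: Suc_le_eq pq(2,4)[symmetric])
    also have "\<dots> = (\<Sum>j\<in>{p..<q}. F (t (Suc j)) - F (t j))"
      using pq by (intro sum.mono_neutral_cong_right) auto
    also have "\<dots> = F (t q) - F (t p)" using sum_Suc_diff'[OF \<open>p \<le> q\<close>, of "\<lambda>j. F (t j)"] .
    finally show ?thesis using pq by simp
  qed
  define d where "d j = (\<Sum>(c, a, b)\<leftarrow>L. c * of_bool (a \<le> t j \<and> t (Suc j) \<le> b))" for j
  have "incr_sum L F = (\<Sum>j<m. d j * (F (t (Suc j)) - F (t j)))" for F
  proof -
    have "incr_sum L' F = (\<Sum>j<m. (\<Sum>(c, a, b)\<leftarrow>L'. c * of_bool (a \<le> t j \<and> t (Suc j) \<le> b))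
        * (F (t (Suc j)) - F (t j)))" if "set L' \<subseteq> set L" for L'
      using that
    proof (induction L')
      case Nil
      then show ?case by (simp add: incr_sum_def)
    next
      case (Cons e L')
      obtain c a b where e: "e = (c, a, b)" by (cases e)
      have ab: "a \<in> P" "b \<in> P" "a \<le> b"
        using Cons.prems assms unfolding e P_def proper_def by force+
      have "incr_sum (e # L') F = c * (F b - F a) + incr_sum L' F" by (simp add: incr_sum_def e)
      also have "\<dots> = (\<Sum>j<m. c * (of_bool (a \<le> t j \<and> t (Suc j) \<le> b) * (F (t (Suc j)) - F (t j))))
          + (\<Sum>j<m. (\<Sum>(c, a, b)\<leftarrow>L'. c * of_bool (a \<le> t j \<and> t (Suc j) \<le> b))
            * (F (t (Suc j)) - F (t j)))"
        using Cons single[OF ab, of F] by (simp add: sum_distrib_left[symmetric])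
      also have "\<dots> = (\<Sum>j<m. (\<Sum>(c, a, b)\<leftarrow>e # L'. c * of_bool (a \<le> t j \<and> t (Suc j) \<le> b))
            * (F (t (Suc j)) - F (t j)))"
        unfolding sum.distrib[symmetric] by (intro sum.cong refl) (simp add: e algebra_simps)
      finally show ?case .
    qed
    from this[OF order_refl] show ?thesis unfolding d_def .
  qed
  then show ?thesis using that mono by blast
qed

definition step_of :: "(real \<times> real \<times> real) list \<Rightarrow> real \<Rightarrow> real" where
  "step_of L x = incr_sum L (\<lambda>y. of_bool (x \<le> y))"

definition integral_of :: "(real \<Rightarrow> 'a \<Rightarrow> real) \<Rightarrow> (real \<times> real \<times> real) list \<Rightarrow> 'a \<Rightarrow> real" where
  "integral_of X L \<omega> = incr_sum L (\<lambda>y. X y \<omega>)"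

lemma partition_cell:
  fixes t :: "nat \<Rightarrow> real"
  assumes mono: "strict_mono_on {..m} t" and i: "i < m" "x \<in> {t i<..t (Suc i)}" and j: "j < m"
  shows "(indicator {t j<..t (Suc j)} x :: real) = of_bool (j = i)"
proof -
  have t_le: "t i \<le> t j" if "i \<le> j" "j \<le> m" for i j
    using strict_mono_on_leD[OF mono] that by simp
  show ?thesis
  proof (cases j i rule: linorder_cases)
    case less
    then show ?thesis using t_le[of "Suc j" i] i by (auto simp: indicator_def)
  next
    case greater
    then show ?thesis using t_le[of "Suc i" j] i j by (auto simp: indicator_def)
  qed (use i in simp)
qed

lemma step_powr_integral:
  fixes t d :: "nat \<Rightarrow> real" and p :: real
  assumes mono: "strict_mono_on {..m} t" and p: "0 < p"
  shows "has_bochner_integral lebesgue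
    (\<lambda>x. \<bar>\<Sum>j<m. d j * (of_bool (x \<le> t (Suc j)) - of_bool (x \<le> t j))\<bar> powr p)
    (\<Sum>j<m. \<bar>d j\<bar> powr p * (t (Suc j) - t j))"
proof -
  have t_le: "t i \<le> t j" if "i \<le> j" "j \<le> m" for i j
    using strict_mono_on_leD[OF mono] that by simp
  have ind: "of_bool (x \<le> t (Suc j)) - of_bool (x \<le> t j) = (indicator {t j<..t (Suc j)} x :: real)"
    if "j < m" for j x
    using t_le[of j "Suc j"] that by (auto simp: indicator_def)
  have eq: "\<bar>\<Sum>j<m. d j * (of_bool (x \<le> t (Suc j)) - of_bool (x \<le> t j))\<bar> powr p
      = (\<Sum>j<m. \<bar>d j\<bar> powr p * indicator {t j<..t (Suc j)} x)" for x
  proof (cases "\<exists>i<m. x \<in> {t i<..t (Suc i)}")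
    case True
    then obtain i where i: "i < m" "x \<in> {t i<..t (Suc i)}" by blast
    note off = partition_cell[OF mono i]
    have "(\<Sum>j<m. d j * (of_bool (x \<le> t (Suc j)) - of_bool (x \<le> t j))) = (\<Sum>j<m. d j * of_bool (j = i))"
      by (intro sum.cong refl) (simp add: ind off)
    moreover have "(\<Sum>j<m. \<bar>d j\<bar> powr p * indicator {t j<..t (Suc j)} x) = (\<Sum>j<m. \<bar>d j\<bar> powr p * of_bool (j = i))"
      by (intro sum.cong refl) (simp add: off)
    moreover have "(\<Sum>j<m. f j * of_bool (j = i)) = (f i :: real)" for f
      using i(1) by (simp add: of_bool_def if_distrib[of "\<lambda>z. _ * z"] cong: if_cong)
    ultimately show ?thesis by simp
  next
    case False
    then have "(indicator {t j<..t (Suc j)} x :: real) = 0" if "j < m" for j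
      using that by (auto simp: indicator_def)
    then show ?thesis using ind p by simp
  qed
  have "has_bochner_integral lebesgue (\<lambda>x. \<Sum>j<m. \<bar>d j\<bar> powr p * indicator {t j<..t (Suc j)} x)
      (\<Sum>j<m. \<bar>d j\<bar> powr p * measure lebesgue {t j<..t (Suc j)})"
    by (intro has_bochner_integral_sum has_bochner_integral_mult_right has_bochner_integral_real_indicator)
      (use t_le in \<open>auto simp: emeasure_lborel_Ioc\<close>)
  moreover have "(\<Sum>j<m. \<bar>d j\<bar> powr p * measure lebesgue {t j<..t (Suc j)})
      = (\<Sum>j<m. \<bar>d j\<bar> powr p * (t (Suc j) - t j))"
    using t_le by (intro sum.cong refl) (simp add: measure_completion)
  ultimately show ?thesis unfolding eq by simp
qed

text \<open>After passing to a common partition the increments are independent, so the elementary integral has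
  the characteristic function \<open>u \<mapsto> exp (- c \<bar>u\<bar>\<^sup>\<gamma> \<integral> \<bar>\<phi>\<bar>\<^sup>\<gamma>)\<close>, where \<open>\<phi>\<close> is the step function.\<close>
lemma stable_step_bound:
  assumes X: "symmetric_stable_process M \<gamma> X" and \<gamma>: "1 < \<gamma>"
  obtains K where "0 \<le> K" and
    "\<And>L. proper L \<Longrightarrow> step_of L \<in> Lp_space lebesgue \<gamma> \<and> integrable M (integral_of X L) \<and>
      (\<integral>\<omega>. \<bar>integral_of X L \<omega>\<bar> \<partial>M) \<le> K * (\<integral>x. \<bar>step_of L x\<bar> powr \<gamma> \<partial>lebesgue) powr (1 / \<gamma>)"
proof -
  interpret prob_space M using X by (simp add: symmetric_stable_process_def)
  have [measurable]: "X t \<in> borel_measurable M" for t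
    using X by (simp add: symmetric_stable_process_def)
  have indep: "strict_mono_on {..m} t \<Longrightarrow>
      indep_vars (\<lambda>_. borel) (\<lambda>j \<omega>. X (t (Suc j)) \<omega> - X (t j) \<omega>) {..<m}" for m :: nat and t
    using X by (simp add: symmetric_stable_process_def)
  obtain c where c: "0 < c" and ch: "\<And>s t u.
      (\<integral>\<omega>. exp (\<i> * complex_of_real (u * (X t \<omega> - X s \<omega>))) \<partial>M)
        = complex_of_real (exp (- c * \<bar>t - s\<bar> * \<bar>u\<bar> powr \<gamma>))"
    using X unfolding symmetric_stable_process_def by blast
  obtain K0 where K0: "0 \<le> K0" and moment:
    "\<And>(M :: 'a measure) Y S. prob_space M \<Longrightarrow> Y \<in> borel_measurable M \<Longrightarrow> 0 \<le> S \<Longrightarrow>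
      (\<And>u. (\<integral>\<omega>. cos (u * Y \<omega>) \<partial>M) = exp (- (S * \<bar>u\<bar> powr \<gamma>))) \<Longrightarrow>
      integrable M Y \<and> (\<integral>\<omega>. \<bar>Y \<omega>\<bar> \<partial>M) \<le> K0 * S powr (1 / \<gamma>)"
    using stable_abs_moment[OF \<gamma>] by blast
  have main: "step_of L \<in> Lp_space lebesgue \<gamma> \<and> integrable M (integral_of X L) \<and>
      (\<integral>\<omega>. \<bar>integral_of X L \<omega>\<bar> \<partial>M)
        \<le> K0 * c powr (1 / \<gamma>) * (\<integral>x. \<bar>step_of L x\<bar> powr \<gamma> \<partial>lebesgue) powr (1 / \<gamma>)"
    if L: "proper L" for L
  proof -
    obtain m t d where mono: "strict_mono_on {..m} t" and
      eq: "\<And>F. incr_sum L F = (\<Sum>j<m. d j * (F (t (Suc j)) - F (t j)))"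
      by (rule incr_sum_common_partition[OF L]) (rule that)
    have t_le: "t j \<le> t (Suc j)" if "j < m" for j
      using strict_mono_on_leD[OF mono, of j "Suc j"] that by simp
    define S where "S = (\<Sum>j<m. \<bar>d j\<bar> powr \<gamma> * (t (Suc j) - t j))"
    have S: "0 \<le> S" unfolding S_def using t_le by (intro sum_nonneg mult_nonneg_nonneg) auto
    have hb: "has_bochner_integral lebesgue (\<lambda>x. \<bar>step_of L x\<bar> powr \<gamma>) S"
      unfolding step_of_def eq S_def using \<gamma> by (intro step_powr_integral[OF mono]) auto
    have Y: "integral_of X L = (\<lambda>\<omega>. \<Sum>j<m. d j * (X (t (Suc j)) \<omega> - X (t j) \<omega>))"
      by (rule ext) (simp add: integral_of_def eq)
    have ind: "indep_vars (\<lambda>_. borel) (\<lambda>j \<omega>. d j * (X (t (Suc j)) \<omega> - X (t j) \<omega>)) {..<m}"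
      using indep_vars_compose2[OF indep[OF mono], of "\<lambda>j x. d j * x" "\<lambda>_. borel"] by simp
    have cos_eq: "(\<integral>\<omega>. cos (u * integral_of X L \<omega>) \<partial>M) = exp (- ((c * S) * \<bar>u\<bar> powr \<gamma>))" for u
    proof -
      have "(\<integral>\<omega>. exp (\<i> * complex_of_real (u * integral_of X L \<omega>)) \<partial>M)
          = char (distr M borel (integral_of X L)) u"
        by (simp add: char_def integral_distr Y)
      also have "\<dots> = (\<Prod>j<m. char (distr M borel (\<lambda>\<omega>. d j * (X (t (Suc j)) \<omega> - X (t j) \<omega>))) u)"
        unfolding Y by (rule char_distr_sum[OF ind])
      also have "\<dots> = (\<Prod>j<m. complex_of_real (exp (- (c * \<bar>u\<bar> powr \<gamma> * (\<bar>d j\<bar> powr \<gamma> * (t (Suc j) - t j))))))"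
      proof (rule prod.cong[OF refl])
        fix j assume "j \<in> {..<m}"
        then have "\<bar>t (Suc j) - t j\<bar> = t (Suc j) - t j" using t_le by simp
        then show "char (distr M borel (\<lambda>\<omega>. d j * (X (t (Suc j)) \<omega> - X (t j) \<omega>))) u
            = complex_of_real (exp (- (c * \<bar>u\<bar> powr \<gamma> * (\<bar>d j\<bar> powr \<gamma> * (t (Suc j) - t j)))))"
          using ch[of "u * d j" "t (Suc j)" "t j"]
          by (simp add: char_def integral_distr abs_mult powr_mult mult_ac)
      qed
      also have "\<dots> = complex_of_real (exp (- ((c * S) * \<bar>u\<bar> powr \<gamma>)))"
        by (simp only: of_real_prod[symmetric] exp_sum[OF finite_lessThan, symmetric] sum_negf
            sum_distrib_left[symmetric] S_def[symmetric]) (simp add: mult_ac)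
      finally have e: "(\<integral>\<omega>. exp (\<i> * complex_of_real (u * integral_of X L \<omega>)) \<partial>M)
          = complex_of_real (exp (- ((c * S) * \<bar>u\<bar> powr \<gamma>)))" .
      have i: "integrable M (\<lambda>\<omega>. exp (\<i> * complex_of_real (u * integral_of X L \<omega>)))"
        by (rule integrable_const_bound[of _ 1]) (auto simp: Y)
      have "(\<integral>\<omega>. cos (u * integral_of X L \<omega>) \<partial>M)
          = (\<integral>\<omega>. Re (exp (\<i> * complex_of_real (u * integral_of X L \<omega>))) \<partial>M)"
        by (simp add: Re_exp)
      also have "\<dots> = Re (\<integral>\<omega>. exp (\<i> * complex_of_real (u * integral_of X L \<omega>)) \<partial>M)"
        by (rule integral_Re[OF i])
      finally show ?thesis unfolding e by simp
    qed
    have meas: "integral_of X L \<in> borel_measurable M" unfolding Y by measurable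
    have "integrable M (integral_of X L) \<and>
        (\<integral>\<omega>. \<bar>integral_of X L \<omega>\<bar> \<partial>M) \<le> K0 * (c * S) powr (1 / \<gamma>)"
      using cos_eq c S by (intro moment[OF prob_space_axioms meas]) auto
    moreover have "step_of L \<in> borel_measurable lebesgue"
    proof -
      have "(\<lambda>x. \<Sum>j<m. d j * (of_bool (x \<le> t (Suc j)) - of_bool (x \<le> t j))) \<in> borel_measurable borel"
        by measurable
      then show ?thesis by (simp add: step_of_def[abs_def] eq measurable_completion)
    qed
    ultimately show ?thesis
      using hb c S by (auto simp: Lp_space_def has_bochner_integral_iff powr_mult mult.assoc)
  qed
  show ?thesis
    by (rule that[of "K0 * c powr (1 / \<gamma>)"]) (use K0 main in auto)
qed

section \<open>Density of step functions\<close>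

lemma Lp_space_1_iff: "Y \<in> Lp_space N 1 \<longleftrightarrow> integrable N Y"
proof -
  have "integrable N (\<lambda>x. \<bar>Y x\<bar>) \<longleftrightarrow> integrable N Y" if "Y \<in> borel_measurable N"
    using integrable_norm_iff[OF that] by simp
  then show ?thesis
    by (auto simp: Lp_space_def)
qed

lemma Lp_tendsto_1_iff:
  "Lp_tendsto N 1 u h \<longleftrightarrow> (\<forall>n. integrable N (u n)) \<and> integrable N h \<and>
    (\<lambda>n. \<integral>x. \<bar>u n x - h x\<bar> \<partial>N) \<longlonglongrightarrow> 0"
  by (simp add: Lp_tendsto_def Lp_space_1_iff)

lemma indicator_abs_powr:
  assumes "0 < p"
  shows "\<bar>indicator S x * y\<bar> powr p = indicator S x * \<bar>y :: real\<bar> powr p"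
  using assms by (simp add: indicator_def)

lemma Lp_space_lebesgue_on:
  assumes "0 < p" "S \<in> sets lebesgue"
  shows "h \<in> Lp_space (lebesgue_on S) p \<longleftrightarrow> (\<lambda>x. indicator S x * h x) \<in> Lp_space lebesgue p"
  using assms
  by (simp add: Lp_space_def borel_measurable_restrict_space_iff integrable_restrict_space
      indicator_abs_powr)

lemma Lp_tendsto_lebesgue_on:
  assumes "0 < p" "S \<in> sets lebesgue"
  shows "Lp_tendsto (lebesgue_on S) p u h
    \<longleftrightarrow> Lp_tendsto lebesgue p (\<lambda>n x. indicator S x * u n x) (\<lambda>x. indicator S x * h x)"
proof -
  have "(\<integral>x. \<bar>u n x - h x\<bar> powr p \<partial>lebesgue_on S)
      = (\<integral>x. \<bar>indicator S x * u n x - indicator S x * h x\<bar> powr p \<partial>lebesgue)" for n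
    using assms by (simp add: integral_restrict_space indicator_abs_powr right_diff_distrib[symmetric])
  then show ?thesis using assms by (simp add: Lp_tendsto_def Lp_space_lebesgue_on)
qed

lemma Lp_space_indicator:
  assumes "0 < p" "S \<in> sets N" "h \<in> Lp_space N p"
  shows "(\<lambda>x. indicator S x * h x) \<in> Lp_space N p"
proof -
  have "integrable N (\<lambda>x. indicator S x * \<bar>h x\<bar> powr p)"
    using integrable_mult_indicator[OF assms(2) Lp_spaceD(2)[OF assms(3)]] by simp
  then show ?thesis
    using assms Lp_spaceD(1)[OF assms(3)] by (simp add: Lp_space_def indicator_abs_powr)
qed

lemma Lp_dominated_convergence:
  fixes u :: "nat \<Rightarrow> 'b \<Rightarrow> real"
  assumes p: "0 < p" and [measurable]: "\<And>n. u n \<in> borel_measurable N" "v \<in> borel_measurable N"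
    and w: "integrable N w" and bound: "\<And>n x. \<bar>u n x - v x\<bar> powr p \<le> w x"
    and lim: "AE x in N. (\<lambda>n. u n x) \<longlonglongrightarrow> v x"
  shows "(\<lambda>n. power_dist N p (u n) v) \<longlonglongrightarrow> 0"
proof -
  have "(\<lambda>n. power_dist N p (u n) v) \<longlonglongrightarrow> (\<integral>x. 0 \<partial>N)"
  proof (rule integral_dominated_convergence[OF _ _ w])
    show "AE x in N. (\<lambda>n. \<bar>u n x - v x\<bar> powr p) \<longlonglongrightarrow> 0"
      using lim
    proof eventually_elim
      fix x assume "(\<lambda>n. u n x) \<longlonglongrightarrow> v x"
      then have "(\<lambda>n. \<bar>u n x - v x\<bar>) \<longlonglongrightarrow> 0"
        by (simp add: LIM_zero tendsto_rabs_zero)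
      then show "(\<lambda>n. \<bar>u n x - v x\<bar> powr p) \<longlonglongrightarrow> 0"
        using p by (intro tendsto_zero_powrI[where b = p]) auto
    qed
  qed (use bound in auto)
  then show ?thesis by simp
qed

lemma LIMSEQ_0_exE:
  fixes f :: "nat \<Rightarrow> real"
  assumes "f \<longlonglongrightarrow> 0" "0 < e"
  obtains n where "f n < e"
  using order_tendstoD(2)[OF assms] by (auto simp: eventually_sequentially)

lemma borel_measurable_step_function [measurable]:
  "step_function m t c \<in> borel_measurable borel"
  unfolding step_function_def[abs_def] by measurable

lemma step_function_cell:
  assumes "strict_mono_on {..m} t" and i: "i < m" "x \<in> {t i<..t (Suc i)}"
  shows "step_function m t c x = c i"
proof -
  have "step_function m t c x = (\<Sum>j<m. c j * of_bool (j = i))"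
    unfolding step_function_def using partition_cell[OF assms(1) i] by (intro sum.cong) auto
  also have "\<dots> = c i"
    using i(1) by (simp add: of_bool_def if_distrib[of "\<lambda>z. _ * z"] cong: if_cong)
  finally show ?thesis .
qed

lemma step_function_abs_le:
  assumes "strict_mono_on {..m} t" and "\<And>j. \<bar>c j\<bar> \<le> K" and "0 \<le> K"
  shows "\<bar>step_function m t c x\<bar> \<le> K"
proof (cases "\<exists>i<m. x \<in> {t i<..t (Suc i)}")
  case True
  then show ?thesis using step_function_cell[OF assms(1)] assms(2) by metis
next
  case False
  then have "step_function m t c x = 0" unfolding step_function_def by (intro sum.neutral) auto
  then show ?thesis using assms(3) by simp
qed

lemma step_function_support:
  assumes "step_partition a b m t"
  shows "indicator {a..b} x * step_function m t c x = step_function m t c x"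
proof (cases "x \<in> {a..b}")
  case False
  have "t j \<in> {a..b}" if "j \<le> m" for j using assms that by (auto simp: step_partition_def)
  then have "x \<notin> {t j<..t (Suc j)}" if "j < m" for j
    using that False by (meson Suc_leI atLeastAtMost_iff greaterThanAtMost_iff less_imp_le order_trans)
  then have "step_function m t c x = 0" unfolding step_function_def by (intro sum.neutral) auto
  then show ?thesis by simp
qed simp

lemma uniform_partition:
  fixes a b :: real and n :: nat
  assumes "a < b"
  defines "t \<equiv> \<lambda>j. a + real j * (b - a) / real (Suc n)"
  shows "step_partition a b (Suc n) t"
    and "\<And>x. x \<in> {a<..b} \<Longrightarrow> \<exists>i<Suc n. x \<in> {t i<..t (Suc i)} \<and> \<bar>t (Suc i) - x\<bar> \<le> (b - a) / real (Suc n)"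
proof -
  define d where "d = (b - a) / real (Suc n)"
  have d: "0 < d" using assms(1) by (simp add: d_def)
  have t: "t j = a + real j * d" for j by (simp add: t_def d_def)
  have tN: "t (Suc n) = b" by (simp add: t_def)
  have mono: "t i < t j" if "i < j" for i j using that d by (simp add: t)
  have "t j \<in> {a..b}" if "j \<le> Suc n" for j
  proof -
    have "t j \<le> t (Suc n)" using mono[of j "Suc n"] that by (cases "j = Suc n") auto
    moreover have "a \<le> t j" using d by (simp add: t)
    ultimately show ?thesis using tN by simp
  qed
  then show "step_partition a b (Suc n) t"
    using mono by (auto simp: step_partition_def strict_mono_on_def)
  fix x assume x: "x \<in> {a<..b}"
  have "\<exists>i<N. t i < x \<and> x \<le> t (Suc i)" if "x \<le> t N" for N
    using that
  proof (induction N)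
    case 0
    then show ?case using x by (simp add: t)
  next
    case (Suc N)
    then show ?case by (cases "x \<le> t N") (auto intro: less_SucI)
  qed
  from this[of "Suc n"] obtain i where i: "i < Suc n" "t i < x" "x \<le> t (Suc i)"
    using x tN by auto
  moreover have "t (Suc i) = t i + d" by (simp add: t algebra_simps)
  ultimately show "\<exists>i<Suc n. x \<in> {t i<..t (Suc i)} \<and> \<bar>t (Suc i) - x\<bar> \<le> (b - a) / real (Suc n)"
    unfolding d_def[symmetric] by auto
qed

text \<open>Sample \<open>G\<close> at the right end points of finer and finer uniform partitions.  If \<open>a = b\<close> the only
  admissible step function is \<open>0\<close>, and the interval is a null set.\<close>
lemma step_functions_dense_bounded_continuous:
  fixes G :: "real \<Rightarrow> real"
  assumes p: "0 < p" and cont: "continuous_on UNIV G" and K: "\<And>x. \<bar>G x\<bar> \<le> K"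
    and ab: "a \<le> b" and e: "0 < e"
  obtains m t c where "step_partition a b m t"
    and "(\<integral>x. \<bar>step_function m t c x - indicator {a..b} x * G x\<bar> powr p \<partial>lebesgue) < e"
proof (cases "a = b")
  case True
  have "AE x in lebesgue. x \<noteq> a"
    by (rule AE_completion) (use AE_lborel_singleton in auto)
  then have "AE x in lebesgue.
      \<bar>step_function 0 (\<lambda>_. a) (\<lambda>_. 0) x - indicator {a..b} x * G x\<bar> powr p = 0"
    by eventually_elim (use p True in \<open>auto simp: step_function_def indicator_def\<close>)
  from integral_eq_zero_AE[OF this] show ?thesis
    by (intro that[of 0 "\<lambda>_. a" "\<lambda>_. 0"])
      (use e True in \<open>auto simp: step_partition_def strict_mono_on_def\<close>)
next
  case False
  then have ab: "a < b" using ab by simp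
  define t where "t n j = a + real j * (b - a) / real (Suc n)" for n j
  define u where "u n = step_function (Suc n) (t n) (\<lambda>j. G (t n (Suc j)))" for n
  note part = uniform_partition[OF ab, folded t_def]
  have [measurable]: "G \<in> borel_measurable borel" by (rule borel_measurable_continuous_onI[OF cont])
  have um: "u n \<in> borel_measurable lebesgue" for n
    unfolding u_def by (simp add: measurable_completion)
  have K0: "0 \<le> K" using K[of 0] by linarith
  have "(\<lambda>n. \<integral>x. \<bar>u n x - indicator {a..b} x * G x\<bar> powr p \<partial>lebesgue) \<longlonglongrightarrow> 0"
  proof (rule Lp_dominated_convergence[OF p um])
    show "integrable lebesgue (\<lambda>x. (2 * K) powr p * indicator {a..b} x)"
      by (intro integrable_mult_right integrable_real_indicator) (use ab in auto)
    show "\<bar>u n x - indicator {a..b} x * G x\<bar> powr p \<le> (2 * K) powr p * indicator {a..b} x" for n x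
    proof -
      have "u n x = indicator {a..b} x * u n x"
        unfolding u_def using step_function_support[OF part(1)] by simp
      moreover have "\<bar>u n x\<bar> \<le> K"
        unfolding u_def using part(1)[of n] K K0
        by (intro step_function_abs_le) (auto simp: step_partition_def)
      ultimately show ?thesis
        using K[of x] p by (cases "x \<in> {a..b}") (auto intro!: powr_mono2)
    qed
    have lim: "(\<lambda>n. u n x) \<longlonglongrightarrow> indicator {a..b} x * G x" if "x \<noteq> a" for x
    proof (cases "x \<in> {a<..b}")
      case True
      define \<tau> where "\<tau> n = (SOME y. \<bar>y - x\<bar> \<le> (b - a) / real (Suc n) \<and> u n x = G y)" for n
      have \<tau>: "\<bar>\<tau> n - x\<bar> \<le> (b - a) / real (Suc n) \<and> u n x = G (\<tau> n)" for n
      proof -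
        obtain i where i: "i < Suc n" "x \<in> {t n i<..t n (Suc i)}"
          "\<bar>t n (Suc i) - x\<bar> \<le> (b - a) / real (Suc n)" using part(2)[OF True, of n] by blast
        have "u n x = G (t n (Suc i))"
          unfolding u_def using part(1)[of n] i by (intro step_function_cell) (auto simp: step_partition_def)
        with i(3) have "\<bar>t n (Suc i) - x\<bar> \<le> (b - a) / real (Suc n) \<and> u n x = G (t n (Suc i))" by simp
        then show ?thesis unfolding \<tau>_def by (rule someI)
      qed
      have "(\<lambda>n. (b - a) / real (Suc n)) \<longlonglongrightarrow> 0"
        by (rule LIMSEQ_Suc[OF lim_const_over_n])
      then have "(\<lambda>n. \<tau> n - x) \<longlonglongrightarrow> 0"
        by (rule Lim_null_comparison[rotated]) (use \<tau> in auto)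
      then have "\<tau> \<longlonglongrightarrow> x" by (simp add: LIM_zero_iff)
      then have "(\<lambda>n. G (\<tau> n)) \<longlonglongrightarrow> G x"
        using cont by (intro continuous_on_tendsto_compose[OF cont]) auto
      then show ?thesis using \<tau> True by simp
    next
      case False
      then have "x \<notin> {a..b}" using that by auto
      then have "u n x = 0" for n
        using step_function_support[OF part(1)[of n], of x "\<lambda>j. G (t n (Suc j))"]
        by (simp add: u_def)
      then show ?thesis using \<open>x \<notin> {a..b}\<close> by simp
    qed
    have "AE x in lebesgue. x \<noteq> a"
      by (rule AE_completion) (use AE_lborel_singleton in auto)
    then show "AE x in lebesgue. (\<lambda>n. u n x) \<longlonglongrightarrow> indicator {a..b} x * G x"
      by eventually_elim (rule lim)
  qed (simp add: measurable_completion)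
  then obtain n where "(\<integral>x. \<bar>u n x - indicator {a..b} x * G x\<bar> powr p \<partial>lebesgue) < e"
    using LIMSEQ_0_exE e by blast
  then show ?thesis using that[OF part(1)[of n]] unfolding u_def by blast
qed

text \<open>Three approximations, each by dominated convergence: truncate the values of \<open>h\<close>, replace the bounded
  function by continuous functions that converge to it almost everywhere, and replace these by step
  functions.\<close>
lemma step_functions_dense:
  fixes h :: "real \<Rightarrow> real"
  assumes p: "0 < p" and h: "h \<in> Lp_space lebesgue p" and ab: "a \<le> b" and e: "0 < e"
  obtains m t c where "step_partition a b m t"
    and "(\<integral>x. \<bar>step_function m t c x - indicator {a..b} x * h x\<bar> powr p \<partial>lebesgue) < e"
proof -
  \<comment> \<open>the loss from applying the quasi-triangle inequality twice\<close>
  define R where "R = 2 powr p * 2 powr p + 2 powr p"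
  have R: "0 < R" by (simp add: R_def add_pos_pos)
  define e1 where "e1 = e / (4 * R)"
  have e1: "0 < e1" using e R by (simp add: e1_def)
  define H where "H x = indicator {a..b} x * h x" for x
  have H: "H \<in> Lp_space lebesgue p"
    unfolding H_def by (rule Lp_space_indicator[OF p _ h]) simp
  note [measurable] = Lp_spaceD(1)[OF H]
  define clip where "clip k y = max (- real k) (min (real k) y)" for k :: nat and y :: real
  have clip_le: "\<bar>clip k y\<bar> \<le> real k" for k y by (auto simp: clip_def)
  have "(\<lambda>k. \<integral>x. \<bar>clip k (H x) - H x\<bar> powr p \<partial>lebesgue) \<longlonglongrightarrow> 0"
  proof (rule Lp_dominated_convergence[OF p _ _ Lp_spaceD(2)[OF H]])
    show "\<bar>clip k (H x) - H x\<bar> powr p \<le> \<bar>H x\<bar> powr p" for k x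
      using p by (intro powr_mono2) (auto simp: clip_def)
    show "AE x in lebesgue. (\<lambda>k. clip k (H x)) \<longlonglongrightarrow> H x"
    proof (rule AE_I2)
      fix x
      have "\<forall>\<^sub>F k in sequentially. clip k (H x) = H x"
        using eventually_ge_at_top[of "nat \<lceil>\<bar>H x\<bar>\<rceil>"]
      proof eventually_elim
        fix k assume "nat \<lceil>\<bar>H x\<bar>\<rceil> \<le> k"
        then have "\<bar>H x\<bar> \<le> real k" by linarith
        then show "clip k (H x) = H x" by (auto simp: clip_def)
      qed
      then show "(\<lambda>k. clip k (H x)) \<longlonglongrightarrow> H x" by (rule tendsto_eventually)
    qed
  qed (auto simp: clip_def)
  then obtain k where k: "(\<integral>x. \<bar>clip k (H x) - H x\<bar> powr p \<partial>lebesgue) < e1"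
    using LIMSEQ_0_exE e1 by blast
  define B where "B x = clip k (H x)" for x
  have Bm [measurable]: "B \<in> borel_measurable lebesgue" unfolding B_def[abs_def] clip_def by measurable
  have B0: "B x = indicator {a..b} x * B x" for x by (auto simp: B_def H_def clip_def indicator_def)
  have "B measurable_on UNIV"
    by (rule lebesgue_measurable_imp_measurable_on[OF Bm]) simp
  then obtain N g where N: "negligible N" and g: "\<And>n. continuous_on UNIV (g n)"
    and gB: "\<And>x. x \<notin> N \<Longrightarrow> (\<lambda>n. g n x) \<longlonglongrightarrow> B x"
    unfolding measurable_on_def by auto
  define G where "G n x = clip k (g n x)" for n x
  have Gc: "continuous_on UNIV (G n)" for n
    unfolding G_def clip_def by (intro continuous_intros g)
  have [measurable]: "G n \<in> borel_measurable borel" for n by (rule borel_measurable_continuous_onI[OF Gc])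
  have "(\<lambda>n. \<integral>x. \<bar>indicator {a..b} x * G n x - B x\<bar> powr p \<partial>lebesgue) \<longlonglongrightarrow> 0"
  proof (rule Lp_dominated_convergence[OF p])
    show "integrable lebesgue (\<lambda>x. (2 * real k) powr p * indicator {a..b} x)"
      by (intro integrable_mult_right integrable_real_indicator) (use ab in auto)
    show "\<bar>indicator {a..b} x * G n x - B x\<bar> powr p \<le> (2 * real k) powr p * indicator {a..b} x" for n x
    proof (cases "x \<in> {a..b}")
      case True
      have "\<bar>G n x - B x\<bar> \<le> 2 * real k"
        using clip_le[of k "g n x"] clip_le[of k "H x"] by (simp add: G_def B_def)
      then show ?thesis using True p by (auto intro!: powr_mono2)
    qed (subst B0, simp)
    have "N \<in> null_sets lebesgue" using N by (simp add: negligible_iff_null_sets)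
    then have "AE x in lebesgue. x \<notin> N" by (rule AE_not_in)
    then show "AE x in lebesgue. (\<lambda>n. indicator {a..b} x * G n x) \<longlonglongrightarrow> B x"
    proof eventually_elim
      fix x assume "x \<notin> N"
      then have "(\<lambda>n. indicator {a..b} x * clip k (g n x)) \<longlonglongrightarrow> indicator {a..b} x * clip k (B x)"
        unfolding clip_def by (intro tendsto_intros gB)
      moreover have "clip k (B x) = B x" by (auto simp: B_def clip_def)
      ultimately show "(\<lambda>n. indicator {a..b} x * G n x) \<longlonglongrightarrow> B x"
        by (simp add: G_def B0[symmetric])
    qed
  qed (auto simp: measurable_completion)
  then obtain n where n: "(\<integral>x. \<bar>indicator {a..b} x * G n x - B x\<bar> powr p \<partial>lebesgue) < e1"
    using LIMSEQ_0_exE e1 by blast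
  obtain m t c where part: "step_partition a b m t"
    and st: "(\<integral>x. \<bar>step_function m t c x - indicator {a..b} x * G n x\<bar> powr p \<partial>lebesgue) < e1"
    by (rule step_functions_dense_bounded_continuous[OF p Gc _ ab e1, of n "real k"])
      (auto simp: G_def clip_le intro: that)
  have bounded_Lp: "v \<in> Lp_space lebesgue p"
    if [measurable]: "v \<in> borel_measurable lebesgue" and "\<And>x. \<bar>v x\<bar> \<le> C * indicator {a..b} x" for v C
  proof (rule Lp_space_bound)
    show "integrable lebesgue (\<lambda>x. C powr p * indicator {a..b} x)"
      by (intro integrable_mult_right integrable_real_indicator) (use ab in auto)
    have "\<bar>v x\<bar> powr p \<le> C powr p * indicator {a..b} x" for x
    proof (cases "x \<in> {a..b}")
      case True
      then show ?thesis using that(2)[of x] p by (auto intro!: powr_mono2)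
    next
      case False
      then show ?thesis using that(2)[of x] by simp
    qed
    then show "AE x in lebesgue. \<bar>v x\<bar> powr p \<le> C powr p * indicator {a..b} x" by simp
  qed fact
  have B_Lp: "B \<in> Lp_space lebesgue p"
    by (rule bounded_Lp[OF Bm, of "real k"]) (subst B0, use clip_le in \<open>auto simp: indicator_def B_def\<close>)
  have G_Lp: "(\<lambda>x. indicator {a..b} x * G n x) \<in> Lp_space lebesgue p"
  proof (rule bounded_Lp)
    show "(\<lambda>x. indicator {a..b} x * G n x) \<in> borel_measurable lebesgue"
      by (simp add: measurable_completion)
    show "\<bar>indicator {a..b} x * G n x\<bar> \<le> real k * indicator {a..b} x" for x
      using clip_le by (auto simp: indicator_def G_def)
  qed
  have s_Lp: "step_function m t c \<in> Lp_space lebesgue p"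
  proof (rule bounded_Lp)
    show "step_function m t c \<in> borel_measurable lebesgue" by (simp add: measurable_completion)
    have "\<bar>step_function m t c x\<bar> \<le> (\<Sum>j<m. \<bar>c j\<bar>)" for x
      unfolding step_function_def
      by (intro order_trans[OF sum_abs] sum_mono) (simp add: indicator_def abs_mult)
    then show "\<bar>step_function m t c x\<bar> \<le> (\<Sum>j<m. \<bar>c j\<bar>) * indicator {a..b} x" for x
      using step_function_support[OF part, of x c] by (cases "x \<in> {a..b}") auto
  qed
  have p0: "0 \<le> p" using p by simp
  have "power_dist lebesgue p (step_function m t c) H
      \<le> 2 powr p * ((\<integral>x. \<bar>step_function m t c x - indicator {a..b} x * G n x\<bar> powr p \<partial>lebesgue)
        + (\<integral>x. \<bar>indicator {a..b} x * G n x - H x\<bar> powr p \<partial>lebesgue))"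
    by (rule Lp_triangle[OF p0 s_Lp G_Lp H])
  also have "\<dots> \<le> 2 powr p * (e1 + 2 powr p * (e1 + e1))"
    using Lp_triangle[OF p0 G_Lp B_Lp H] st n k
    by (intro mult_left_mono add_mono order_trans[OF Lp_triangle[OF p0 G_Lp B_Lp H]])
      (auto simp: B_def)
  also have "\<dots> < e"
  proof -
    have "2 powr p * (e1 + 2 powr p * (e1 + e1)) \<le> 2 * (e1 * R)"
      using e1 by (simp add: R_def algebra_simps)
    also have "e1 * R = e / 4" using R by (simp add: e1_def)
    finally show ?thesis using e by simp
  qed
  finally show ?thesis using that[OF part] by (simp add: H_def)
qed

definition step_list :: "nat \<Rightarrow> (nat \<Rightarrow> real) \<Rightarrow> (nat \<Rightarrow> real) \<Rightarrow> (real \<times> real \<times> real) list" where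
  "step_list m t c = map (\<lambda>j. (c j, t j, t (Suc j))) [0..<m]"

lemma incr_sum_step_list:
  "incr_sum (step_list m t c) F = (\<Sum>j<m. c j * (F (t (Suc j)) - F (t j)))"
  by (simp add: incr_sum_def step_list_def comp_def interv_sum_list_conv_sum_set_nat atLeast0LessThan)

lemma step_partition_le:
  assumes "step_partition a b m t" "j < m"
  shows "t j \<le> t (Suc j)"
  using assms strict_mono_on_leD[of "{..m}" t j "Suc j"] by (simp add: step_partition_def)

lemma proper_step_list:
  assumes "step_partition a b m t"
  shows "proper (step_list m t c)"
  using step_partition_le[OF assms] by (auto simp: proper_def step_list_def)

lemma step_of_step_list:
  assumes "step_partition a b m t"
  shows "step_of (step_list m t c) = step_function m t c"
proof
  fix x
  have "of_bool (x \<le> t (Suc j)) - of_bool (x \<le> t j) = (indicator {t j<..t (Suc j)} x :: real)"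
    if "j < m" for j
    using step_partition_le[OF assms that] by (auto simp: indicator_def)
  then show "step_of (step_list m t c) x = step_function m t c x"
    by (simp add: step_of_def incr_sum_step_list step_function_def)
qed

lemma integral_of_step_list: "integral_of X (step_list m t c) = step_integral X m t c"
  by (rule ext) (simp add: integral_of_def incr_sum_step_list step_integral_def)

section \<open>The stochastic integral over the line\<close>

locale stable_process =
  fixes M :: "'a measure" and \<gamma> :: real and X :: "real \<Rightarrow> 'a \<Rightarrow> real"
  assumes stable: "symmetric_stable_process M \<gamma> X" and index: "1 < \<gamma>"
begin

lemma index_pos: "0 < \<gamma>" "0 \<le> \<gamma>"
  using index by auto

text \<open>A description of the stochastic integral in one step, by a single sequence of step functions on the
  whole line.  Unlike the definition through bounded intervals and all approximating sequences,
  it is visibly linear; the equivalence of the two is shown below.\<close>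
definition has_line_integral :: "(real \<Rightarrow> real) \<Rightarrow> ('a \<Rightarrow> real) \<Rightarrow> bool" where
  "has_line_integral h Y \<longleftrightarrow> h \<in> Lp_space lebesgue \<gamma> \<and> integrable M Y \<and>
    (\<exists>L. (\<forall>n. proper (L n)) \<and>
      (\<lambda>n. power_dist lebesgue \<gamma> (step_of (L n)) h) \<longlonglongrightarrow> 0 \<and>
      (\<lambda>n. mean_dist M (integral_of X (L n)) Y) \<longlonglongrightarrow> 0)"

lemma proper_Lp:
  assumes "proper L"
  shows "step_of L \<in> Lp_space lebesgue \<gamma>" and "integrable M (integral_of X L)"
  using stable_step_bound[OF stable index] assms by metis+

lemma step_difference_bound:
  obtains K where "0 \<le> K" and "\<And>L L'. proper L \<Longrightarrow> proper L' \<Longrightarrow>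
    mean_dist M (integral_of X L) (integral_of X L')
      \<le> K * power_dist lebesgue \<gamma> (step_of L) (step_of L') powr (1 / \<gamma>)"
proof -
  obtain K where K: "0 \<le> K" "\<And>L. proper L \<Longrightarrow>
      (\<integral>\<omega>. \<bar>integral_of X L \<omega>\<bar> \<partial>M) \<le> K * (\<integral>x. \<bar>step_of L x\<bar> powr \<gamma> \<partial>lebesgue) powr (1 / \<gamma>)"
    using stable_step_bound[OF stable index] by metis
  have "mean_dist M (integral_of X L) (integral_of X L')
      \<le> K * power_dist lebesgue \<gamma> (step_of L) (step_of L') powr (1 / \<gamma>)"
    if "proper L" "proper L'" for L L'
    using K(2)[of "L @ map (\<lambda>(c, a, b). ((-1) * c, a, b)) L'"] that proper_scale[of L' "-1"]
    by (simp only: proper_append integral_of_def step_of_def incr_sum_append incr_sum_scale)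
      simp
  then show ?thesis using K(1) that by blast
qed

text \<open>The bound for step functions passes to the limit.  Applied to \<open>h = h'\<close> it says that the integral is
  almost surely unique; in general it is the continuity that transports convergence in \<open>L\<^sup>\<gamma>\<close> to
  convergence in the mean.\<close>
lemma has_line_integral_diff_bound:
  obtains K where "0 \<le> K" and "\<And>h h' Y Y'. has_line_integral h Y \<Longrightarrow> has_line_integral h' Y' \<Longrightarrow>
    mean_dist M Y Y' \<le> K * power_dist lebesgue \<gamma> h h' powr (1 / \<gamma>)"
proof -
  obtain K where K: "0 \<le> K" and step: "\<And>L L'. proper L \<Longrightarrow> proper L' \<Longrightarrow>
    mean_dist M (integral_of X L) (integral_of X L')
      \<le> K * power_dist lebesgue \<gamma> (step_of L) (step_of L') powr (1 / \<gamma>)"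
    using step_difference_bound by blast
  define P where "P = 2 powr \<gamma>"
  have P: "0 \<le> P" by (simp add: P_def)
  define K' where "K' = K * (P * P) powr (1 / \<gamma>)"
  have "mean_dist M Y Y' \<le> K' * power_dist lebesgue \<gamma> h h' powr (1 / \<gamma>)"
    if Y: "has_line_integral h Y" and Y': "has_line_integral h' Y'" for h h' Y Y'
  proof -
    obtain L where L: "\<And>n. proper (L n)"
      and Lh: "(\<lambda>n. power_dist lebesgue \<gamma> (step_of (L n)) h) \<longlonglongrightarrow> 0"
      and LY: "(\<lambda>n. mean_dist M (integral_of X (L n)) Y) \<longlonglongrightarrow> 0"
      using Y unfolding has_line_integral_def by blast
    obtain L' where L': "\<And>n. proper (L' n)"
      and Lh': "(\<lambda>n. power_dist lebesgue \<gamma> (step_of (L' n)) h') \<longlonglongrightarrow> 0"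
      and LY': "(\<lambda>n. mean_dist M (integral_of X (L' n)) Y') \<longlonglongrightarrow> 0"
      using Y' unfolding has_line_integral_def by blast
    have h: "h \<in> Lp_space lebesgue \<gamma>" "h' \<in> Lp_space lebesgue \<gamma>" and iY: "integrable M Y" "integrable M Y'"
      using Y Y' by (auto simp: has_line_integral_def)
    define D where "D = power_dist lebesgue \<gamma> h h'"
    have D: "0 \<le> D" by (simp add: D_def)
    define e where "e n = power_dist lebesgue \<gamma> (step_of (L n)) h" for n
    define e' where "e' n = power_dist lebesgue \<gamma> (step_of (L' n)) h'" for n
    define r where "r n = mean_dist M (integral_of X (L n)) Y" for n
    define r' where "r' n = mean_dist M (integral_of X (L' n)) Y'" for n
    have bound: "mean_dist M Y Y' \<le> r n + K * (P * (e n + P * (D + e' n))) powr (1 / \<gamma>) + r' n" for n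
    proof -
      note i = proper_Lp(2)[OF L[of n]] proper_Lp(2)[OF L'[of n]]
      note s = proper_Lp(1)[OF L[of n]] proper_Lp(1)[OF L'[of n]]
      have "power_dist lebesgue \<gamma> (step_of (L n)) (step_of (L' n))
          \<le> P * (e n + power_dist lebesgue \<gamma> h (step_of (L' n)))"
        unfolding P_def e_def by (rule Lp_triangle[OF index_pos(2) s(1) h(1) s(2)])
      also have "\<dots> \<le> P * (e n + P * (D + power_dist lebesgue \<gamma> h' (step_of (L' n))))"
        unfolding P_def D_def
        by (intro mult_left_mono add_mono order_refl Lp_triangle[OF index_pos(2) h s(2)]) auto
      finally have *: "power_dist lebesgue \<gamma> (step_of (L n)) (step_of (L' n))
          \<le> P * (e n + P * (D + e' n))"
        by (simp add: e'_def abs_minus_commute)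
      have "mean_dist M (integral_of X (L n)) (integral_of X (L' n))
          \<le> K * power_dist lebesgue \<gamma> (step_of (L n)) (step_of (L' n)) powr (1 / \<gamma>)"
        by (rule step[OF L L'])
      also have "\<dots> \<le> K * (P * (e n + P * (D + e' n))) powr (1 / \<gamma>)"
        using K index * by (intro mult_left_mono powr_mono2) auto
      finally have **: "mean_dist M (integral_of X (L n)) (integral_of X (L' n)) \<le> \<dots>" .
      have "mean_dist M Y Y' \<le> (\<integral>\<omega>. \<bar>integral_of X (L n) \<omega> - Y \<omega>\<bar>
          + \<bar>integral_of X (L n) \<omega> - integral_of X (L' n) \<omega>\<bar> + \<bar>integral_of X (L' n) \<omega> - Y' \<omega>\<bar> \<partial>M)"
        using i iY by (intro integral_mono) auto
      also have "\<dots> = r n + mean_dist M (integral_of X (L n)) (integral_of X (L' n)) + r' n"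
        using i iY by (simp add: r_def r'_def)
      finally show ?thesis using ** by linarith
    qed
    have "(\<lambda>n. r n + K * (P * (e n + P * (D + e' n))) powr (1 / \<gamma>) + r' n)
        \<longlonglongrightarrow> 0 + K * (P * (0 + P * (D + 0))) powr (1 / \<gamma>) + 0"
      using index P D
      by (intro tendsto_add tendsto_mult tendsto_const tendsto_powr' Lh[folded e_def] Lh'[folded e'_def]
          LY[folded r_def] LY'[folded r'_def])
        (auto simp: e_def e'_def intro!: always_eventually mult_nonneg_nonneg add_nonneg_nonneg)
    from LIMSEQ_le_const[OF this] bound
    have "mean_dist M Y Y' \<le> K * (P * P * D) powr (1 / \<gamma>)" by (auto simp: mult.assoc)
    also have "\<dots> = K' * D powr (1 / \<gamma>)" using P D by (simp add: K'_def powr_mult)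
    finally show ?thesis by (simp add: D_def)
  qed
  moreover have "0 \<le> K'" using K by (simp add: K'_def)
  ultimately show ?thesis using that by blast
qed

lemma has_line_integral_step:
  assumes "proper L"
  shows "has_line_integral (step_of L) (integral_of X L)"
  unfolding has_line_integral_def using proper_Lp[OF assms] assms
  by (auto intro!: exI[of _ "\<lambda>_. L"])

lemma has_line_integral_add:
  assumes "has_line_integral h Y" "has_line_integral h' Y'"
  shows "has_line_integral (\<lambda>x. h x + h' x) (\<lambda>\<omega>. Y \<omega> + Y' \<omega>)"
proof -
  obtain L where L: "\<And>n. proper (L n)"
    and Lh: "(\<lambda>n. power_dist lebesgue \<gamma> (step_of (L n)) h) \<longlonglongrightarrow> 0"
    and LY: "(\<lambda>n. mean_dist M (integral_of X (L n)) Y) \<longlonglongrightarrow> 0"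
    using assms(1) unfolding has_line_integral_def by blast
  obtain L' where L': "\<And>n. proper (L' n)"
    and Lh': "(\<lambda>n. power_dist lebesgue \<gamma> (step_of (L' n)) h') \<longlonglongrightarrow> 0"
    and LY': "(\<lambda>n. mean_dist M (integral_of X (L' n)) Y') \<longlonglongrightarrow> 0"
    using assms(2) unfolding has_line_integral_def by blast
  have h: "h \<in> Lp_space lebesgue \<gamma>" "h' \<in> Lp_space lebesgue \<gamma>" and iY: "integrable M Y" "integrable M Y'"
    using assms by (auto simp: has_line_integral_def)
  have "(\<lambda>n. \<integral>x. \<bar>step_of (L n @ L' n) x - (h x + h' x)\<bar> powr \<gamma> \<partial>lebesgue) \<longlonglongrightarrow> 0"
  proof (rule Lim_null_comparison)
    have "(\<lambda>n. 2 powr \<gamma> * (power_dist lebesgue \<gamma> (step_of (L n)) h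
        + power_dist lebesgue \<gamma> (step_of (L' n)) h')) \<longlonglongrightarrow> 2 powr \<gamma> * (0 + 0)"
      by (intro tendsto_intros Lh Lh')
    then show "(\<lambda>n. 2 powr \<gamma> * (power_dist lebesgue \<gamma> (step_of (L n)) h
        + power_dist lebesgue \<gamma> (step_of (L' n)) h')) \<longlonglongrightarrow> 0" by simp
    show "\<forall>\<^sub>F n in sequentially. norm (\<integral>x. \<bar>step_of (L n @ L' n) x - (h x + h' x)\<bar> powr \<gamma> \<partial>lebesgue)
        \<le> 2 powr \<gamma> * (power_dist lebesgue \<gamma> (step_of (L n)) h
          + power_dist lebesgue \<gamma> (step_of (L' n)) h')"
    proof (intro always_eventually allI)
      fix n
      have eq: "step_of (L n @ L' n) x - (h x + h' x) = (step_of (L n) x - h x) + (step_of (L' n) x - h' x)" for x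
        by (simp add: step_of_def incr_sum_append)
      show "norm (\<integral>x. \<bar>step_of (L n @ L' n) x - (h x + h' x)\<bar> powr \<gamma> \<partial>lebesgue)
          \<le> 2 powr \<gamma> * (power_dist lebesgue \<gamma> (step_of (L n)) h
            + power_dist lebesgue \<gamma> (step_of (L' n)) h')"
        unfolding eq
        using Lp_space_add(2)[OF index_pos(2) Lp_space_diff[OF index_pos(2) proper_Lp(1)[OF L[of n]] h(1)]
            Lp_space_diff[OF index_pos(2) proper_Lp(1)[OF L'[of n]] h(2)]] by simp
    qed
  qed
  moreover have "(\<lambda>n. \<integral>\<omega>. \<bar>integral_of X (L n @ L' n) \<omega> - (Y \<omega> + Y' \<omega>)\<bar> \<partial>M) \<longlonglongrightarrow> 0"
  proof (rule Lim_null_comparison)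
    show "(\<lambda>n. mean_dist M (integral_of X (L n)) Y + mean_dist M (integral_of X (L' n)) Y') \<longlonglongrightarrow> 0"
      using tendsto_add[OF LY LY'] by simp
    show "\<forall>\<^sub>F n in sequentially. norm (\<integral>\<omega>. \<bar>integral_of X (L n @ L' n) \<omega> - (Y \<omega> + Y' \<omega>)\<bar> \<partial>M)
        \<le> mean_dist M (integral_of X (L n)) Y + mean_dist M (integral_of X (L' n)) Y'"
    proof (intro always_eventually allI)
      fix n
      note i = proper_Lp(2)[OF L[of n]] proper_Lp(2)[OF L'[of n]]
      have eq: "integral_of X (L n @ L' n) \<omega> = integral_of X (L n) \<omega> + integral_of X (L' n) \<omega>" for \<omega>
        by (simp add: integral_of_def incr_sum_append)
      have "(\<integral>\<omega>. \<bar>integral_of X (L n @ L' n) \<omega> - (Y \<omega> + Y' \<omega>)\<bar> \<partial>M)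
          \<le> (\<integral>\<omega>. \<bar>integral_of X (L n) \<omega> - Y \<omega>\<bar> + \<bar>integral_of X (L' n) \<omega> - Y' \<omega>\<bar> \<partial>M)"
        unfolding eq using i iY by (intro integral_mono) auto
      also have "\<dots> = mean_dist M (integral_of X (L n)) Y + mean_dist M (integral_of X (L' n)) Y'"
        using i iY by simp
      finally show "norm (\<integral>\<omega>. \<bar>integral_of X (L n @ L' n) \<omega> - (Y \<omega> + Y' \<omega>)\<bar> \<partial>M) \<le> \<dots>" by simp
    qed
  qed
  ultimately show ?thesis
    unfolding has_line_integral_def
    using L L' iY Lp_space_add(1)[OF index_pos(2) h]
    by (auto intro!: exI[of _ "\<lambda>n. L n @ L' n"] simp: proper_append)
qed

lemma has_line_integral_cmult:
  assumes "has_line_integral h Y"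
  shows "has_line_integral (\<lambda>x. r * h x) (\<lambda>\<omega>. r * Y \<omega>)"
proof -
  obtain L where L: "\<And>n. proper (L n)"
    and Lh: "(\<lambda>n. power_dist lebesgue \<gamma> (step_of (L n)) h) \<longlonglongrightarrow> 0"
    and LY: "(\<lambda>n. mean_dist M (integral_of X (L n)) Y) \<longlonglongrightarrow> 0"
    using assms(1) unfolding has_line_integral_def by blast
  define S where "S n = map (\<lambda>(c, a, b). (r * c, a, b)) (L n)" for n
  have S: "step_of (S n) x = r * step_of (L n) x" "integral_of X (S n) \<omega> = r * integral_of X (L n) \<omega>" for n x \<omega>
    unfolding S_def step_of_def integral_of_def by (rule incr_sum_scale)+
  have "(\<lambda>n. \<integral>x. \<bar>step_of (S n) x - r * h x\<bar> powr \<gamma> \<partial>lebesgue) \<longlonglongrightarrow> 0"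
    using tendsto_mult[OF tendsto_const Lh, of "\<bar>r\<bar> powr \<gamma>"]
    by (simp add: S right_diff_distrib[symmetric] abs_mult powr_mult)
  moreover have "(\<lambda>n. \<integral>\<omega>. \<bar>integral_of X (S n) \<omega> - r * Y \<omega>\<bar> \<partial>M) \<longlonglongrightarrow> 0"
    using tendsto_mult[OF tendsto_const LY, of "\<bar>r\<bar>"]
    by (simp add: S right_diff_distrib[symmetric] abs_mult)
  moreover have "proper (S n)" for n unfolding S_def by (rule proper_scale[OF L])
  ultimately show ?thesis
    using assms Lp_space_cmult[of h lebesgue \<gamma> r] unfolding has_line_integral_def by auto
qed

lemma has_line_integral_sum:
  assumes "\<And>k. k \<in> I \<Longrightarrow> has_line_integral (h k) (Y k)"
  shows "has_line_integral (\<lambda>x. \<Sum>k\<in>I. h k x) (\<lambda>\<omega>. \<Sum>k\<in>I. Y k \<omega>)"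
proof -
  have "step_of [] = (\<lambda>x. 0)" "integral_of X [] = (\<lambda>\<omega>. 0)"
    by (auto simp: fun_eq_iff step_of_def integral_of_def incr_sum_def)
  then have zero: "has_line_integral (\<lambda>x. 0) (\<lambda>\<omega>. 0)"
    using has_line_integral_step[of "[]"] by (simp add: proper_def)
  show ?thesis using assms
  proof (induction I rule: infinite_finite_induct)
    case (insert k I)
    then show ?case using has_line_integral_add[of "h k" "Y k"] by simp
  next
    case (infinite I)
    then show ?case using zero by simp
  next
    case empty
    then show ?case using zero by simp
  qed
qed

lemma Lp_truncation:
  assumes "h \<in> Lp_space lebesgue \<gamma>"
  shows "(\<lambda>n. \<integral>x. \<bar>indicator {- real n..real n} x * h x - h x\<bar> powr \<gamma> \<partial>lebesgue) \<longlonglongrightarrow> 0"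
proof (rule Lp_dominated_convergence[OF index_pos(1) _ _ Lp_spaceD(2)[OF assms]])
  show "\<bar>indicator {- real n..real n} x * h x - h x\<bar> powr \<gamma> \<le> \<bar>h x\<bar> powr \<gamma>" for n x
    using index by (intro powr_mono2) (auto simp: indicator_def)
  show "AE x in lebesgue. (\<lambda>n. indicator {- real n..real n} x * h x) \<longlonglongrightarrow> h x"
  proof (rule AE_I2, rule tendsto_eventually)
    fix x :: real
    show "\<forall>\<^sub>F n in sequentially. indicator {- real n..real n} x * h x = h x"
      using eventually_ge_at_top[of "nat \<lceil>\<bar>x\<bar>\<rceil>"]
    proof eventually_elim
      fix n assume "nat \<lceil>\<bar>x\<bar>\<rceil> \<le> n"
      then have "\<bar>x\<bar> \<le> real n" by linarith
      then show "indicator {- real n..real n} x * h x = h x" by (simp add: indicator_def abs_le_iff)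
    qed
  qed
qed (use Lp_spaceD(1)[OF assms] in \<open>auto intro!: borel_measurable_times borel_measurable_indicator\<close>)

text \<open>Approximate \<open>h\<close> on \<open>[-n, n]\<close> by a step function up to \<open>1 / (n + 1)\<close>.  The integrals of these step
  functions form a Cauchy sequence in \<open>L\<^sup>1\<close>, since those of differences are controlled.\<close>
lemma has_line_integral_exists:
  assumes h: "h \<in> Lp_space lebesgue \<gamma>"
  shows "\<exists>Y. has_line_integral h Y"
proof -
  have "\<exists>L. proper L \<and> (\<integral>x. \<bar>step_of L x - indicator {- real n..real n} x * h x\<bar> powr \<gamma> \<partial>lebesgue)
      < 1 / real (Suc n)" for n
  proof -
    obtain m t c where "step_partition (- real n) (real n) m t"
      "(\<integral>x. \<bar>step_function m t c x - indicator {- real n..real n} x * h x\<bar> powr \<gamma> \<partial>lebesgue)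
        < 1 / real (Suc n)"
      by (rule step_functions_dense[OF index_pos(1) h, of "- real n" "real n" "1 / real (Suc n)"])
        (auto intro: that)
    then show ?thesis
      by (intro exI[of _ "step_list m t c"]) (auto simp: step_of_step_list proper_step_list)
  qed
  then obtain L where L: "\<And>n. proper (L n)" and Ln: "\<And>n.
      (\<integral>x. \<bar>step_of (L n) x - indicator {- real n..real n} x * h x\<bar> powr \<gamma> \<partial>lebesgue) < 1 / real (Suc n)"
    by metis
  have trunc: "(\<lambda>x. indicator {- real n..real n} x * h x) \<in> Lp_space lebesgue \<gamma>" for n
    by (rule Lp_space_indicator[OF index_pos(1) _ h]) simp
  define e where "e n = power_dist lebesgue \<gamma> (step_of (L n)) h" for n
  have e0: "0 \<le> e n" for n by (simp add: e_def)
  have Lh: "e \<longlonglongrightarrow> 0"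
  proof (rule Lim_null_comparison)
    have "(\<lambda>n. 1 / real (Suc n)) \<longlonglongrightarrow> 0" by (rule LIMSEQ_Suc[OF lim_const_over_n])
    from tendsto_mult[OF tendsto_const tendsto_add[OF this Lp_truncation[OF h]], of "2 powr \<gamma>"]
    show "(\<lambda>n. 2 powr \<gamma> * (1 / real (Suc n)
        + (\<integral>x. \<bar>indicator {- real n..real n} x * h x - h x\<bar> powr \<gamma> \<partial>lebesgue))) \<longlonglongrightarrow> 0" by simp
    show "\<forall>\<^sub>F n in sequentially. norm (e n) \<le> 2 powr \<gamma> * (1 / real (Suc n)
        + (\<integral>x. \<bar>indicator {- real n..real n} x * h x - h x\<bar> powr \<gamma> \<partial>lebesgue))"
    proof (intro always_eventually allI)
      fix n
      have "e n \<le> 2 powr \<gamma> * ((\<integral>x. \<bar>step_of (L n) x - indicator {- real n..real n} x * h x\<bar> powr \<gamma> \<partial>lebesgue)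
          + (\<integral>x. \<bar>indicator {- real n..real n} x * h x - h x\<bar> powr \<gamma> \<partial>lebesgue))"
        unfolding e_def by (rule Lp_triangle[OF index_pos(2) proper_Lp(1)[OF L] trunc h])
      also have "\<dots> \<le> 2 powr \<gamma> * (1 / real (Suc n)
          + (\<integral>x. \<bar>indicator {- real n..real n} x * h x - h x\<bar> powr \<gamma> \<partial>lebesgue))"
        using Ln[of n] by (intro mult_left_mono add_mono) auto
      finally show "norm (e n) \<le> \<dots>" using e0[of n] by simp
    qed
  qed
  obtain K where K: "0 \<le> K" and step: "\<And>L L'. proper L \<Longrightarrow> proper L' \<Longrightarrow>
    mean_dist M (integral_of X L) (integral_of X L')
      \<le> K * power_dist lebesgue \<gamma> (step_of L) (step_of L') powr (1 / \<gamma>)"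
    using step_difference_bound by blast
  have "\<exists>Y. Lp_tendsto M 1 (\<lambda>n. integral_of X (L n)) Y"
  proof (rule Lp_complete)
    show "integral_of X (L n) \<in> Lp_space M 1" for n
      by (simp add: Lp_space_1_iff proper_Lp(2)[OF L])
    fix d :: real assume d: "0 < d"
    \<comment> \<open>solves \<open>K (2\<^sup>\<gamma> (q + q))\<^bsup>1/\<gamma>\<^esup> < d\<close>, also when \<open>K = 0\<close>\<close>
    define q where "q = (d / (K + 1)) powr \<gamma> / (2 * 2 powr \<gamma>)"
    have q: "0 < q" using d K by (simp add: q_def)
    obtain N where N: "\<And>n. N \<le> n \<Longrightarrow> e n < q"
      using order_tendstoD(2)[OF Lh q] by (auto simp: eventually_sequentially)
    have "(\<integral>\<omega>. \<bar>integral_of X (L m) \<omega> - integral_of X (L n) \<omega>\<bar> powr 1 \<partial>M) < d"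
      if "N \<le> m" "N \<le> n" for m n
    proof -
      have "power_dist lebesgue \<gamma> (step_of (L m)) (step_of (L n))
          \<le> 2 powr \<gamma> * (e m + power_dist lebesgue \<gamma> h (step_of (L n)))"
        unfolding e_def by (rule Lp_triangle[OF index_pos(2) proper_Lp(1)[OF L] h proper_Lp(1)[OF L]])
      also have "\<dots> = 2 powr \<gamma> * (e m + e n)" by (simp add: e_def abs_minus_commute)
      also have "\<dots> \<le> 2 powr \<gamma> * (q + q)"
        using N that by (intro mult_left_mono add_mono) (auto intro: less_imp_le)
      also have "\<dots> = (d / (K + 1)) powr \<gamma>" by (simp add: q_def)
      finally have "power_dist lebesgue \<gamma> (step_of (L m)) (step_of (L n)) powr (1 / \<gamma>)
          \<le> ((d / (K + 1)) powr \<gamma>) powr (1 / \<gamma>)"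
        using index by (intro powr_mono2) auto
      also have "\<dots> = d / (K + 1)" using index d K by (simp add: powr_powr)
      finally have "K * power_dist lebesgue \<gamma> (step_of (L m)) (step_of (L n)) powr (1 / \<gamma>)
          \<le> K * (d / (K + 1))"
        using K by (rule mult_left_mono)
      also have "\<dots> < d" using K d by (simp add: divide_less_eq)
      finally show ?thesis using step[OF L L, of m n] by simp
    qed
    then show "\<exists>N. \<forall>m\<ge>N. \<forall>n\<ge>N. (\<integral>\<omega>. \<bar>integral_of X (L m) \<omega> - integral_of X (L n) \<omega>\<bar> powr 1 \<partial>M) < d"
      by blast
  qed simp
  then obtain Y where "Lp_tendsto M 1 (\<lambda>n. integral_of X (L n)) Y" by blast
  then have "has_line_integral h Y"
    unfolding has_line_integral_def Lp_tendsto_1_iff using h L Lh unfolding e_def by blast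
  then show ?thesis by blast
qed

lemma has_line_integral_tendsto:
  assumes u: "\<And>n. has_line_integral (u n) (Y n)" and h: "has_line_integral h Z"
    and lim: "(\<lambda>n. power_dist lebesgue \<gamma> (u n) h) \<longlonglongrightarrow> 0"
  shows "Lp_tendsto M 1 Y Z"
proof -
  obtain K where K: "0 \<le> K" and bd: "\<And>h h' Y Y'. has_line_integral h Y \<Longrightarrow> has_line_integral h' Y' \<Longrightarrow>
    mean_dist M Y Y' \<le> K * power_dist lebesgue \<gamma> h h' powr (1 / \<gamma>)"
    using has_line_integral_diff_bound by blast
  have "(\<lambda>n. mean_dist M (Y n) Z) \<longlonglongrightarrow> 0"
  proof (rule Lim_null_comparison)
    have "(\<lambda>n. K * power_dist lebesgue \<gamma> (u n) h powr (1 / \<gamma>)) \<longlonglongrightarrow> K * 0 powr (1 / \<gamma>)"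
      using index by (intro tendsto_mult tendsto_const tendsto_powr' lim) auto
    then show "(\<lambda>n. K * power_dist lebesgue \<gamma> (u n) h powr (1 / \<gamma>)) \<longlonglongrightarrow> 0" by simp
  qed (use bd[OF u h] in auto)
  then show ?thesis
    using u h by (auto simp: Lp_tendsto_1_iff has_line_integral_def)
qed

lemma has_line_integral_AE_cong:
  assumes "has_line_integral h Y" and Y': "integrable M Y'" and eq: "mean_dist M Y Y' = 0"
  shows "has_line_integral h Y'"
proof -
  obtain L where L: "\<And>n. proper (L n)"
    and Lh: "(\<lambda>n. power_dist lebesgue \<gamma> (step_of (L n)) h) \<longlonglongrightarrow> 0"
    and LY: "(\<lambda>n. mean_dist M (integral_of X (L n)) Y) \<longlonglongrightarrow> 0"
    and Y: "integrable M Y" and h: "h \<in> Lp_space lebesgue \<gamma>"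
    using assms(1) unfolding has_line_integral_def by blast
  have "(\<lambda>n. mean_dist M (integral_of X (L n)) Y') \<longlonglongrightarrow> 0"
  proof (rule Lim_null_comparison[OF _ LY], intro always_eventually allI)
    fix n
    note i = proper_Lp(2)[OF L[of n]]
    have "mean_dist M (integral_of X (L n)) Y'
        \<le> (\<integral>\<omega>. \<bar>integral_of X (L n) \<omega> - Y \<omega>\<bar> + \<bar>Y \<omega> - Y' \<omega>\<bar> \<partial>M)"
      using i Y Y' by (intro integral_mono) auto
    also have "\<dots> = mean_dist M (integral_of X (L n)) Y" using i Y Y' eq by simp
    finally show "norm (mean_dist M (integral_of X (L n)) Y')
        \<le> mean_dist M (integral_of X (L n)) Y" by simp
  qed
  then show ?thesis unfolding has_line_integral_def using L Lh Y' h by blast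
qed

lemma has_stoch_integral_on_of_line:
  assumes "has_line_integral (\<lambda>x. indicator {a..b} x * h x) Y"
  shows "has_stoch_integral_on M X \<gamma> a b h Y"
  unfolding has_stoch_integral_on_def
proof (intro conjI allI impI)
  have S: "{a..b} \<in> sets lebesgue" by simp
  note on = Lp_space_lebesgue_on[OF index_pos(1) S] Lp_tendsto_lebesgue_on[OF index_pos(1) S]
  show "h \<in> Lp_space (lebesgue_on {a..b}) \<gamma>"
    using assms by (simp add: on has_line_integral_def)
  show "Y \<in> Lp_space M 1" using assms by (simp add: Lp_space_1_iff has_line_integral_def)
  fix m t c
  assume part: "\<forall>n. step_partition a b (m n) (t n)"
    and lim: "Lp_tendsto (lebesgue_on {a..b}) \<gamma> (\<lambda>n. step_function (m n) (t n) (c n)) h"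
  from lim[unfolded on(2)] part have "(\<lambda>n. \<integral>x. \<bar>step_function (m n) (t n) (c n) x - indicator {a..b} x * h x\<bar> powr \<gamma> \<partial>lebesgue) \<longlonglongrightarrow> 0"
    by (simp add: Lp_tendsto_def step_function_support)
  moreover have "has_line_integral (step_function (m n) (t n) (c n)) (step_integral X (m n) (t n) (c n))" for n
  proof -
    have p: "step_partition a b (m n) (t n)" using part by blast
    from has_line_integral_step[OF proper_step_list[OF p]] show ?thesis
      by (simp add: step_of_step_list[OF p] integral_of_step_list)
  qed
  ultimately show "Lp_tendsto M 1 (\<lambda>n. step_integral X (m n) (t n) (c n)) Y"
    using assms by (intro has_line_integral_tendsto)
qed

text \<open>The definition quantifies over all approximating sequences, and would hold vacuously if there were
  none; density of the step functions supplies one, and it exhibits \<open>Y\<close> as a limit.\<close>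
lemma line_of_has_stoch_integral_on:
  assumes "has_stoch_integral_on M X \<gamma> a b h Y" and h: "h \<in> Lp_space lebesgue \<gamma>" and ab: "a \<le> b"
  shows "has_line_integral (\<lambda>x. indicator {a..b} x * h x) Y"
proof -
  have S: "{a..b} \<in> sets lebesgue" by simp
  note on = Lp_tendsto_lebesgue_on[OF index_pos(1) S]
  have hS: "(\<lambda>x. indicator {a..b} x * h x) \<in> Lp_space lebesgue \<gamma>"
    by (rule Lp_space_indicator[OF index_pos(1) S h])
  have "\<exists>z. case z of (m, t, c) \<Rightarrow> step_partition a b m t \<and>
      (\<integral>x. \<bar>step_function m t c x - indicator {a..b} x * h x\<bar> powr \<gamma> \<partial>lebesgue) < 1 / real (Suc n)" for n
  proof -
    have "0 < 1 / real (Suc n)" by simp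
    then obtain m t c where "step_partition a b m t"
      "(\<integral>x. \<bar>step_function m t c x - indicator {a..b} x * h x\<bar> powr \<gamma> \<partial>lebesgue) < 1 / real (Suc n)"
      by (rule step_functions_dense[OF index_pos(1) h ab]) (rule that)
    then show ?thesis by (intro exI[of _ "(m, t, c)"]) simp
  qed
  then have "\<exists>z. \<forall>n. case z n of (m, t, c) \<Rightarrow> step_partition a b m t \<and>
      (\<integral>x. \<bar>step_function m t c x - indicator {a..b} x * h x\<bar> powr \<gamma> \<partial>lebesgue) < 1 / real (Suc n)"
    by (intro choice allI)
  then obtain z where z: "\<forall>n. case z n of (m, t, c) \<Rightarrow> step_partition a b m t \<and>
      (\<integral>x. \<bar>step_function m t c x - indicator {a..b} x * h x\<bar> powr \<gamma> \<partial>lebesgue) < 1 / real (Suc n)" ..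
  define m where "m n = fst (z n)" for n
  define t where "t n = fst (snd (z n))" for n
  define c where "c n = snd (snd (z n))" for n
  have part: "step_partition a b (m n) (t n)" and le:
    "(\<integral>x. \<bar>step_function (m n) (t n) (c n) x - indicator {a..b} x * h x\<bar> powr \<gamma> \<partial>lebesgue) < 1 / real (Suc n)" for n
    using z[rule_format, of n] by (simp_all add: m_def t_def c_def case_prod_beta)
  have sLp: "step_function (m n) (t n) (c n) \<in> Lp_space lebesgue \<gamma>" for n
    using proper_Lp(1)[OF proper_step_list[OF part]] by (simp add: step_of_step_list[OF part])
  have lim: "(\<lambda>n. \<integral>x. \<bar>step_function (m n) (t n) (c n) x - indicator {a..b} x * h x\<bar> powr \<gamma> \<partial>lebesgue) \<longlonglongrightarrow> 0"
  proof (rule Lim_null_comparison)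
    show "(\<lambda>n. 1 / real (Suc n)) \<longlonglongrightarrow> 0" by (rule LIMSEQ_Suc[OF lim_const_over_n])
  qed (use le in \<open>auto intro!: always_eventually less_imp_le\<close>)
  then have "Lp_tendsto (lebesgue_on {a..b}) \<gamma> (\<lambda>n. step_function (m n) (t n) (c n)) h"
    unfolding on using hS sLp by (simp add: Lp_tendsto_def step_function_support[OF part])
  then have "Lp_tendsto M 1 (\<lambda>n. step_integral X (m n) (t n) (c n)) Y"
    using assms(1) part unfolding has_stoch_integral_on_def by blast
  then have "integrable M Y"
    and "(\<lambda>n. mean_dist M (step_integral X (m n) (t n) (c n)) Y) \<longlonglongrightarrow> 0"
    by (auto simp: Lp_tendsto_1_iff)
  then show ?thesis
    unfolding has_line_integral_def using hS lim proper_step_list[OF part]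
    by (auto intro!: exI[of _ "\<lambda>n. step_list (m n) (t n) (c n)"]
        simp: step_of_step_list[OF part] integral_of_step_list)
qed

text \<open>From left to right, the integrals \<open>Z n\<close> over \<open>[-n, n]\<close> converge to \<open>Y\<close> by assumption and to any line
  integral \<open>Y'\<close> of \<open>h\<close> by continuity, so \<open>Y\<close> and \<open>Y'\<close> agree almost surely.\<close>
lemma has_stoch_integral_iff_line:
  assumes h: "h \<in> Lp_space lebesgue \<gamma>"
  shows "has_stoch_integral M X \<gamma> h Y \<longleftrightarrow> has_line_integral h Y"
proof
  have trunc: "(\<lambda>x. indicator {- real n..real n} x * h x) \<in> Lp_space lebesgue \<gamma>" for n
    by (rule Lp_space_indicator[OF index_pos(1) _ h]) simp
  {
    assume Y: "has_line_integral h Y"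
    obtain Z where Z: "\<And>n. has_line_integral (\<lambda>x. indicator {- real n..real n} x * h x) (Z n)"
      using has_line_integral_exists[OF trunc] by metis
    have "Lp_tendsto M 1 Z Y"
      by (rule has_line_integral_tendsto[OF Z Y Lp_truncation[OF h]])
    then show "has_stoch_integral M X \<gamma> h Y"
      unfolding has_stoch_integral_def using has_stoch_integral_on_of_line[OF Z] by blast
  }
  assume "has_stoch_integral M X \<gamma> h Y"
  then obtain Z where Z: "\<And>n. has_stoch_integral_on M X \<gamma> (- real n) (real n) h (Z n)"
    and ZY: "Lp_tendsto M 1 Z Y"
    unfolding has_stoch_integral_def by blast
  obtain Y' where Y': "has_line_integral h Y'" using has_line_integral_exists[OF h] by blast
  have ZY': "Lp_tendsto M 1 Z Y'"
    by (rule has_line_integral_tendsto[OF line_of_has_stoch_integral_on[OF Z h] Y' Lp_truncation[OF h]]) simp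
  have i: "integrable M (Z n)" "integrable M Y" "integrable M Y'" for n
    using ZY ZY' by (auto simp: Lp_tendsto_1_iff)
  have le: "mean_dist M Y' Y \<le> mean_dist M (Z n) Y' + mean_dist M (Z n) Y" for n
  proof -
    have "mean_dist M Y' Y \<le> (\<integral>\<omega>. \<bar>Z n \<omega> - Y' \<omega>\<bar> + \<bar>Z n \<omega> - Y \<omega>\<bar> \<partial>M)"
      using i by (intro integral_mono) auto
    then show ?thesis using i by simp
  qed
  have "(\<lambda>n. mean_dist M (Z n) Y' + mean_dist M (Z n) Y) \<longlonglongrightarrow> 0 + 0"
    using ZY ZY' by (intro tendsto_add) (auto simp: Lp_tendsto_1_iff)
  from LIMSEQ_le_const[OF this] le have "mean_dist M Y' Y \<le> 0" by auto
  moreover have "0 \<le> mean_dist M Y' Y" by simp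
  ultimately show "has_line_integral h Y"
    by (intro has_line_integral_AE_cong[OF Y' i(2)]) simp
qed

lemma stoch_integral_line:
  assumes h: "h \<in> Lp_space lebesgue \<gamma>"
  shows "stoch_integrable M X \<gamma> h" and "has_line_integral h (stoch_integral M X \<gamma> h)"
proof -
  obtain Y where Y: "has_stoch_integral M X \<gamma> h Y"
    using has_line_integral_exists[OF h] has_stoch_integral_iff_line[OF h] by blast
  then show "stoch_integrable M X \<gamma> h" unfolding stoch_integrable_def by blast
  show "has_line_integral h (stoch_integral M X \<gamma> h)"
    unfolding stoch_integral_def has_stoch_integral_iff_line[OF h, symmetric]
    by (rule someI[of "has_stoch_integral M X \<gamma> h" Y, OF Y])
qed

end

section \<open>Hermite series with stable random coefficients\<close>

no_notation hermite_function ("\<psi>")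

theorem theorem11:
  fixes M :: "'a measure" and X :: "real \<Rightarrow> 'a \<Rightarrow> real" and \<gamma> :: real and f :: "real \<Rightarrow> real"
    and a :: "nat \<Rightarrow> real" and A :: "nat \<Rightarrow> 'a \<Rightarrow> real"
  assumes "symmetric_stable_process M \<gamma> X"
    and "4 / 3 < \<gamma>" and "\<gamma> \<le> 2"
    and "f \<in> Lp_space lebesgue 1 \<inter> Lp_space lebesgue \<gamma>"
    and "\<And>n. a n = (\<integral>t. f t * hermite_function n t \<partial>lebesgue)"
    and "\<And>n. A n = stoch_integral M X \<gamma> (hermite_function n)"
  shows "(\<forall>n. stoch_integrable M X \<gamma> (hermite_function n)) \<and>
    (\<forall>t. \<exists>g.
       Lp_tendsto lebesgue \<gamma>
         (\<lambda>N s. \<Sum>k<N. a k * hermite_function k s * hermite_function k t) g \<and>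
       stoch_integrable M X \<gamma> g \<and>
       Lp_tendsto M 1
         (\<lambda>N \<omega>. \<Sum>n<N. a n * A n \<omega> * hermite_function n t) (stoch_integral M X \<gamma> g))"
proof -
  interpret stable_process M \<gamma> X
    using assms(1,2) by unfold_locales auto
  have f: "f \<in> Lp_space lebesgue \<gamma>" using assms(4) by simp
  have hermite_Lp: "hermite_function n \<in> Lp_space lebesgue \<gamma>" for n
    using index by (intro hermite_function_Lp) simp
  have A: "has_line_integral (hermite_function n) (A n)" for n
    unfolding assms(6) by (rule stoch_integral_line(2)[OF hermite_Lp])
  have "\<exists>g. Lp_tendsto lebesgue \<gamma>
         (\<lambda>N s. \<Sum>k<N. a k * hermite_function k s * hermite_function k t) g \<and>
       stoch_integrable M X \<gamma> g \<and>
       Lp_tendsto M 1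
         (\<lambda>N \<omega>. \<Sum>n<N. a n * A n \<omega> * hermite_function n t) (stoch_integral M X \<gamma> g)" for t
  proof -
    define c where "c k = a k * hermite_function k t" for k
    have "summable (\<lambda>k. (2 * real k + 2) powr (1/4) * (c k)\<^sup>2)"
      unfolding c_def assms(5) by (rule summable_hermite_weights[OF f assms(2,3)])
    then obtain g where g: "Lp_tendsto lebesgue \<gamma> (\<lambda>N s. \<Sum>k<N. c k * hermite_function k s) g"
      using hermite_series_Lp_convergent[OF assms(2,3)] by blast
    have g_Lp: "g \<in> Lp_space lebesgue \<gamma>" using g by (simp add: Lp_tendsto_def)
    have "has_line_integral (\<lambda>s. \<Sum>k<N. c k * hermite_function k s) (\<lambda>\<omega>. \<Sum>k<N. c k * A k \<omega>)" for N
      by (intro has_line_integral_sum has_line_integral_cmult A)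
    then have lim: "Lp_tendsto M 1 (\<lambda>N \<omega>. \<Sum>k<N. c k * A k \<omega>) (stoch_integral M X \<gamma> g)"
      using stoch_integral_line(2)[OF g_Lp] g
      by (intro has_line_integral_tendsto) (auto simp: Lp_tendsto_def)
    have c: "c k * y = a k * y * hermite_function k t" for k y
      by (simp add: c_def)
    show ?thesis
      using g lim stoch_integral_line(1)[OF g_Lp] unfolding c by blast
  qed
  then show ?thesis using stoch_integral_line(1)[OF hermite_Lp] by blast
qed

end
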